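(* Let $n\ge1$ and let $W:\mathbb{R}^n\setminus\{0\}\to\mathbb{R}$ satisfy the following three assumptions: (W1) $W\in C^1(\mathbb{R}^n\setminus\{0\})\cap L^1_{loc}(\mathbb{R}^n)$ is radially symmetric, $W(x)=w(|x|)$ for some $w:(0,\infty)\to\mathbb{R}$; (W2) $w'(r)<0$ for all $r>0$; (W3) there exists $c>0$ such that $w'(r)\le -cr$ for all $r\in(0,1)$. For every $R\in(0,\infty)$ there is a constant $c(W,R)>0$, depending only on $W$ and $R$, such that for every probability density $\rho\in\mathcal{P}(\mathbb{R}^n)\cap L^\infty(\mathbb{R}^n)$ with $\mathrm{supp}\,\rho\subset B(0,R)$ and center of mass $x_0:=\int_{\mathbb{R}^n}x\rho(x)\,dx$, $$\mathcal{E}_W[\rho^*]-\mathcal{E}_W[\rho]\ \ge\ c(W,R)\,W_2^2(T_{x_0}\rho,\rho^* ).$$ In particular, if $W=W_k$ with $k\in(-n,2]$, the constant is given by $c(W_k,R)=(2R)^{k-2}$.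
   Context: $B(a,r)$ is the ball in $\mathbb{R}^n$ centered at $a$ with radius $r$. $\mathcal{P}(\mathbb{R}^n)$ is the set of probability measures on $\mathbb{R}^n$; measures with densities are identified with their densities with respect to Lebesgue measure. The interaction energy is $$\mathcal{E}_W[\rho]:=\int_{\mathbb{R}^n}\int_{\mathbb{R}^n}\rho(x)\rho(y)W(x-y)\,dx\,dy .$$ $\rho^*$ denotes the radially symmetric decreasing rearrangement of $\rho$: $\rho^*(x)=\int_0^\infty 1_{D_h^*}(x)\,dh$ with $D_h=\{\rho>h\}$, where for a set $D$ of finite measure $D^*$ is the ball centered at the origin with $|D^*|=|D|$. For $a\in\mathbb{R}^n$, $T_a\rho:=\rho(\cdot+a)$. $W_2(\cdot,\cdot)$ (with two arguments) is the 2-Wasserstein distance between probability measures with finite second moment; it is not to be confused with the power-law potentials $W_k(x):=-\frac{|x|^k}{k}$ for $k\ne0$ and $W_0(x):=-\log|x|$, which for $k\in(-n,2]$ satisfy (W1)-(W3). *)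

theory Defs
  imports "HOL-Analysis.Analysis" "HOL-Probability.Probability"
begin

section \<open>Interaction potentials\<close>

text \<open>
  A potential on $V \setminus \{0\}$ is represented by a total function on \<open>V\<close>. No definition
  below depends on its value at \<open>0\<close>: the conditions on differentiability and on the profile are
  restricted to \<open>x \<noteq> 0\<close> and \<open>r > 0\<close>, and integrals do not see a single point.
\<close>

definition C1_off_origin :: "('a::euclidean_space \<Rightarrow> real) \<Rightarrow> bool" where
  "C1_off_origin W \<longleftrightarrow>
     (\<exists>W' :: 'a \<Rightarrow> 'a \<Rightarrow>\<^sub>L real.
        (\<forall>x. x \<noteq> 0 \<longrightarrow> (W has_derivative blinfun_apply (W' x)) (at x)) \<and>
        continuous_on (- {0}) W')"

definition locally_integrable :: "('a::euclidean_space \<Rightarrow> real) \<Rightarrow> bool" where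
  "locally_integrable W \<longleftrightarrow> (\<forall>K. compact K \<longrightarrow> set_integrable lborel K W)"

text \<open>
  The profile \<open>w\<close> is determined by \<open>W\<close> on \<open>{0<..}\<close>, and it is differentiable there because \<open>W\<close> is
  differentiable off the origin, so \<open>deriv w r\<close> is the true derivative for \<open>r > 0\<close>.
\<close>

definition interaction_potential :: "('a::euclidean_space \<Rightarrow> real) \<Rightarrow> bool" where
  "interaction_potential W \<longleftrightarrow>
     C1_off_origin W \<and> locally_integrable W \<and>
     (\<exists>w :: real \<Rightarrow> real.
        (\<forall>x. x \<noteq> 0 \<longrightarrow> W x = w (norm x)) \<and>
        (\<forall>r>0. deriv w r < 0) \<and>
        (\<exists>c>0. \<forall>r\<in>{0<..<1}. deriv w r \<le> - c * r))"

definition power_potential :: "real \<Rightarrow> 'a::euclidean_space \<Rightarrow> real" where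
  "power_potential k x = (if k = 0 then - ln (norm x) else - ((norm x powr k) / k))"

definition interaction_energy ::
  "('a::euclidean_space \<Rightarrow> real) \<Rightarrow> ('a \<Rightarrow> real) \<Rightarrow> real" where
  "interaction_energy W \<rho> = (LINT x|lborel. (LINT y|lborel. \<rho> x * \<rho> y * W (x - y)))"


section \<open>Densities\<close>

abbreviation density_measure :: "('a::euclidean_space \<Rightarrow> real) \<Rightarrow> 'a measure" where
  "density_measure \<rho> \<equiv> density lborel (\<lambda>x. ennreal (\<rho> x))"

definition measure_support :: "'a::topological_space measure \<Rightarrow> 'a set" where
  "measure_support M = {x. \<forall>U. open U \<and> x \<in> U \<longrightarrow> emeasure M U \<noteq> 0}"

text \<open>
  The sign condition is needed separately because \<^const>\<open>ennreal\<close> truncates negative values to \<open>0\<close>.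
\<close>

definition bounded_prob_density :: "('a::euclidean_space \<Rightarrow> real) \<Rightarrow> bool" where
  "bounded_prob_density \<rho> \<longleftrightarrow>
     \<rho> \<in> borel_measurable borel \<and> (AE x in lborel. 0 \<le> \<rho> x) \<and>
     prob_space (density_measure \<rho>) \<and>
     (\<exists>M. AE x in lborel. \<bar>\<rho> x\<bar> \<le> M)"

definition center_of_mass :: "('a::euclidean_space \<Rightarrow> real) \<Rightarrow> 'a" where
  "center_of_mass \<rho> = (LINT x|lborel. \<rho> x *\<^sub>R x)"

definition translate :: "'a::euclidean_space \<Rightarrow> ('a \<Rightarrow> real) \<Rightarrow> 'a \<Rightarrow> real" where
  "translate a \<rho> = (\<lambda>x. \<rho> (x + a))"


section \<open>Symmetric decreasing rearrangement\<close>

text \<open>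
  The centered open ball with the volume of \<open>D\<close>; it is unique as a set (the empty ball if \<open>D\<close> is a
  null set). It is meaningful only when \<open>D\<close> has finite measure.
\<close>

definition rearrange_set :: "'a::euclidean_space set \<Rightarrow> 'a set" where
  "rearrange_set D = (THE B. (\<exists>r. B = ball 0 r) \<and> emeasure lborel B = emeasure lborel D)"

definition rearrange :: "('a::euclidean_space \<Rightarrow> real) \<Rightarrow> 'a \<Rightarrow> real" where
  "rearrange \<rho> x =
     (LINT h:{0<..}|lborel. indicator (rearrange_set {y. \<rho> y > h}) x)"


section \<open>The 2-Wasserstein distance\<close>

definition couplings :: "'a measure \<Rightarrow> 'b measure \<Rightarrow> ('a \<times> 'b) measure set" where
  "couplings M N =
     {P. sets P = sets (M \<Otimes>\<^sub>M N) \<and> distr P M fst = M \<and> distr P N snd = N}"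

definition wasserstein2 :: "'a::metric_space measure \<Rightarrow> 'a measure \<Rightarrow> real" where
  "wasserstein2 M N =
     sqrt (enn2real (INF P\<in>couplings M N. \<integral>\<^sup>+ z. ennreal ((dist (fst z) (snd z))\<^sup>2) \<partial>P))"

end

theory Submission
  imports Defs "HOL-Complex_Analysis.Great_Picard"
begin

text \<open>
  If \<open>w' r \<le> - c r\<close> on \<open>(0, 2R)\<close>, then \<open>K = W + c |x|\<^sup>2 / 2\<close> is still radially decreasing on the
  differences of points of \<open>B(0, R)\<close>. The Riesz inequality for \<open>K\<close> therefore leaves
  \<open>E\<^sub>W[\<rho>\<^sup>*] - E\<^sub>W[\<rho>] \<ge> c (M(T \<rho>) - M(\<rho>\<^sup>*))\<close>, where \<open>M\<close> is the second moment and \<open>T \<rho>\<close> the centered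
  density. It remains to see that \<open>W\<^sub>2\<^sup>2(\<rho>, \<rho>\<^sup>*) \<le> M(\<rho>) - M(\<rho>\<^sup>*)\<close> for every \<open>\<rho>\<close>: couple each superlevel set
  \<open>D\<close> with the ball \<open>B\<close> of the same volume by the Knothe map \<open>S : B \<rightarrow> D\<close>. Its differential is triangular with
  positive diagonal and determinant 1, so \<open>div S \<ge> n\<close>, and integration by parts against \<open>(r\<^sup>2 - |y|\<^sup>2) / 2\<close>
  gives \<open>\<integral>\<^sub>B S(y) \<bullet> y dy \<ge> \<integral>\<^sub>B |y|\<^sup>2 dy\<close>. The argument is run by induction on the dimension, without
  differentiating \<open>S\<close>.
\<close>


section \<open>Reflections and polarization\<close>

text \<open>The Riesz inequality is proved for kernels with values in \<open>ennreal\<close>. For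
  this reason \<open>K\<close> is also shifted by a constant and set to zero beyond distance
  \<open>2 * R\<close>: it becomes nonnegative, integrable and radially decreasing, with the
  singularity at the origin kept. The constant cancels because all masses are one. The quadratic
  part, integrated against the density in both variables, gives \<open>c\<close> times the variance
  and not the second moment; hence the centering. The Knothe map takes the place of the optimal one
  because each coordinate is a one-dimensional quantile map and comes without existence theory. The
  obstacle is that superlevel sets are merely measurable and that their slices depend on the earlier
  choices. So the induction carries a kernel that is measurable in a parameter, and the explicit
  tail moment of the marginal of a ball stands in for a derivative. For \<open>W_k\<close> the
  quotient \<open>- w' r / r\<close> is \<open>r powr (k - 2)\<close>, nonincreasing for
  \<open>k \<le> 2\<close>; its value at the end \<open>2 * R\<close> of the range of distances is
  the stated constant.\<close>

definition mirror :: "'a::euclidean_space \<Rightarrow> real \<Rightarrow> 'a \<Rightarrow> 'a" where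
  "mirror v d x = x - (2 * (x \<bullet> v - d)) *\<^sub>R v"

lemma mirror_inner: "norm v = 1 \<Longrightarrow> mirror v d x \<bullet> v = 2 * d - x \<bullet> v"
  by (simp add: mirror_def inner_diff_left algebra_simps norm_eq_1)

lemma mirror_mirror [simp]: "norm v = 1 \<Longrightarrow> mirror v d (mirror v d x) = x"
  using mirror_inner[of v d x] by (simp add: mirror_def algebra_simps flip: scaleR_add_left)

lemma norm_mirror_power2:
  assumes "norm v = 1"
  shows "(norm (mirror v d x))\<^sup>2 = (norm x)\<^sup>2 - 4 * d * (x \<bullet> v - d)"
  using assms unfolding mirror_def power2_norm_eq_inner
  by (simp add: inner_diff_left inner_diff_right inner_commute norm_eq_1 algebra_simps)

lemma mirror_diff: "mirror v d x - mirror v d y = mirror v 0 (x - y)"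
  by (simp add: mirror_def inner_diff_left algebra_simps)

lemma norm_mirror_0: "norm v = 1 \<Longrightarrow> norm (mirror v 0 x) = norm x"
  using norm_mirror_power2[of v 0 x] by simp

lemma norm_mirror_diff: "norm v = 1 \<Longrightarrow> norm (mirror v d x - mirror v d y) = norm (x - y)"
  by (simp add: mirror_diff norm_mirror_0)

text \<open>The correction is positive exactly when \<open>x\<close> and \<open>y\<close> lie
  strictly on the same side of the mirror. Of the two inequalities derived from it, the first drives
  the energy comparison and the second the control of moduli of continuity.\<close>

lemma norm_diff_mirror_power2:
  assumes "norm v = 1"
  shows "(norm (x - mirror v d y))\<^sup>2 = (norm (x - y))\<^sup>2 + 4 * (x \<bullet> v - d) * (y \<bullet> v - d)"
  using assms unfolding mirror_def power2_norm_eq_inner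
  by (simp add: inner_diff_left inner_diff_right inner_commute norm_eq_1 algebra_simps)

lemma norm_diff_mirror_ge:
  assumes "norm v = 1" "(x \<bullet> v - d) * (y \<bullet> v - d) \<ge> 0"
  shows "norm (x - y) \<le> norm (x - mirror v d y)"
proof (rule power2_le_imp_le)
  show "(norm (x - y))\<^sup>2 \<le> (norm (x - mirror v d y))\<^sup>2"
    unfolding norm_diff_mirror_power2[OF assms(1)] mult.assoc using assms(2) by linarith
qed auto

lemma norm_diff_mirror_le:
  assumes "norm v = 1" "(x \<bullet> v - d) * (y \<bullet> v - d) \<le> 0"
  shows "norm (x - mirror v d y) \<le> norm (x - y)"
proof (rule power2_le_imp_le)
  show "(norm (x - mirror v d y))\<^sup>2 \<le> (norm (x - y))\<^sup>2"
    unfolding norm_diff_mirror_power2[OF assms(1)] mult.assoc using assms(2) by linarith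
qed auto

lemma norm_mirror_commute: "norm v = 1 \<Longrightarrow> norm (mirror v d x - y) = norm (x - mirror v d y)"
  using norm_mirror_diff[of v d x "mirror v d y"] by simp

lemma continuous_on_mirror [continuous_intros]: "continuous_on A (mirror v d)"
  unfolding mirror_def by (intro continuous_intros)

lemma borel_measurable_mirror [measurable]: "mirror v d \<in> borel_measurable borel"
  by (intro borel_measurable_continuous_onI continuous_intros)

section \<open>Invariance of Lebesgue integrals under translations and reflections\<close>

lemma nn_integral_lborel_shift:
  fixes f :: "'a::euclidean_space \<Rightarrow> ennreal"
  assumes [measurable]: "f \<in> borel_measurable borel"
  shows "(\<integral>\<^sup>+x. f (x + a) \<partial>lborel) = (\<integral>\<^sup>+x. f x \<partial>lborel)"
proof -
  have "(\<integral>\<^sup>+x. f x \<partial>lborel) = (\<integral>\<^sup>+x. f x \<partial>distr lborel borel ((+) a))"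
    by (subst lborel_distr_plus) simp
  then show ?thesis by (simp add: nn_integral_distr add.commute)
qed

lemma nn_integral_lborel_reflect:
  fixes f :: "'a::euclidean_space \<Rightarrow> ennreal"
  assumes [measurable]: "f \<in> borel_measurable borel"
  shows "(\<integral>\<^sup>+x. f (a - x) \<partial>lborel) = (\<integral>\<^sup>+x. f x \<partial>lborel)"
proof -
  have "(\<integral>\<^sup>+x. f x \<partial>lborel) = (\<integral>\<^sup>+x. f x \<partial>density (distr lborel borel (\<lambda>x. a + (-1) *\<^sub>R x)) (\<lambda>_. \<bar>-1::real\<bar>^DIM('a)))"
    by (subst lborel_affine[of "-1" a]) simp_all
  then show ?thesis by (simp add: nn_integral_density nn_integral_distr)
qed

text \<open>Uniqueness of a translation-invariant measure up to a factor, which is read off the unit ball.\<close>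

lemma nn_integral_mirror:
  fixes v :: "'a::euclidean_space"
  assumes v: "norm v = 1" and f [measurable]: "f \<in> borel_measurable borel"
  shows "(\<integral>\<^sup>+x. f (mirror v d x) \<partial>lborel) = (\<integral>\<^sup>+x. f x \<partial>lborel)"
proof -
  let ?T = "mirror v 0"
  have T: "?T (x - ?T y) = ?T x - y" for x y
    using mirror_diff[of v 0 x "?T y"] mirror_mirror[OF v, of 0 y] by simp
  have lin: "(\<integral>\<^sup>+x. f (?T x) \<partial>lborel) = (\<integral>\<^sup>+x. f x \<partial>lborel)"
    if [measurable]: "f \<in> borel_measurable borel" for f :: "'a \<Rightarrow> ennreal"
  proof -
    \<comment> \<open>The unit ball is invariant under the reflection and has finite positive
      volume. Integrating \<open>f (?T x) * g (y + ?T x)\<close> in both orders compares the two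
      integrals of \<open>f\<close> up to a factor that can be cancelled.\<close>
    define g :: "'a \<Rightarrow> ennreal" where "g = indicator (ball 0 1)"
    have [measurable]: "g \<in> borel_measurable borel" unfolding g_def by (intro borel_measurable_indicator) simp
    have gT: "g (?T x) = g x" for x by (simp add: g_def indicator_def norm_mirror_0[OF v])
    have "(\<integral>\<^sup>+x. f (?T x) \<partial>lborel) * (\<integral>\<^sup>+y. g y \<partial>lborel) = (\<integral>\<^sup>+x. f (?T x) * (\<integral>\<^sup>+y. g y \<partial>lborel) \<partial>lborel)"
      by (simp add: nn_integral_multc)
    also have "\<dots> = (\<integral>\<^sup>+x. (\<integral>\<^sup>+y. f (?T x) * g (y + ?T x) \<partial>lborel) \<partial>lborel)"
      by (simp add: nn_integral_lborel_shift nn_integral_cmult)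
    also have "\<dots> = (\<integral>\<^sup>+y. (\<integral>\<^sup>+x. f (?T x) * g (y + ?T x) \<partial>lborel) \<partial>lborel)"
      by (rule lborel_pair.Fubini') measurable
    also have "\<dots> = (\<integral>\<^sup>+y. (\<integral>\<^sup>+x. f (?T x - y) * g (?T x) \<partial>lborel) \<partial>lborel)"
    proof (rule nn_integral_cong)
      fix y
      show "(\<integral>\<^sup>+x. f (?T x) * g (y + ?T x) \<partial>lborel) = (\<integral>\<^sup>+x. f (?T x - y) * g (?T x) \<partial>lborel)"
        using nn_integral_lborel_shift[of "\<lambda>x. f (?T x) * g (y + ?T x)" "- ?T y"] by (simp add: T)
    qed
    also have "\<dots> = (\<integral>\<^sup>+x. (\<integral>\<^sup>+y. f (?T x - y) * g (?T x) \<partial>lborel) \<partial>lborel)"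
      by (rule lborel_pair.Fubini') measurable
    also have "\<dots> = (\<integral>\<^sup>+x. f x \<partial>lborel) * (\<integral>\<^sup>+y. g y \<partial>lborel)"
      by (simp add: nn_integral_multc nn_integral_lborel_reflect nn_integral_cmult gT)
    finally have eq: "(\<integral>\<^sup>+x. f (?T x) \<partial>lborel) * (\<integral>\<^sup>+y. g y \<partial>lborel) = (\<integral>\<^sup>+x. f x \<partial>lborel) * (\<integral>\<^sup>+y. g y \<partial>lborel)" .
    have "(\<integral>\<^sup>+y. g y \<partial>lborel) = ennreal (unit_ball_vol (DIM('a)))"
      by (simp add: g_def emeasure_ball)
    moreover have "unit_ball_vol (DIM('a)) > 0" by simp
    ultimately show ?thesis
      using eq by (metis mult_divide_eq_ennreal ennreal_neq_top ennreal_eq_0_iff less_le_not_le)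
  qed
  have m: "mirror v d x = ?T x + 2 *\<^sub>R d *\<^sub>R v" for x
    by (simp add: mirror_def algebra_simps)
  show ?thesis
    unfolding m using lin[of "\<lambda>x. f (x + 2 *\<^sub>R d *\<^sub>R v)"] nn_integral_lborel_shift[of f "2 *\<^sub>R d *\<^sub>R v"]
    by simp
qed

text \<open>Folding along the mirror, whose hyperplane is a null set. Each pair of mirror points is
  represented by its member with \<open>x \<bullet> v < d\<close>, so that statements about
  polarization become pointwise statements about the values at such pairs.\<close>

lemma nn_integral_halfspace_split:
  fixes v :: "'a::euclidean_space"
  assumes v: "norm v = 1" and [measurable]: "f \<in> borel_measurable borel"
  shows "(\<integral>\<^sup>+x. f x \<partial>lborel) =
    (\<integral>\<^sup>+x. (f x + f (mirror v d x)) * indicator {x. x \<bullet> v < d} x \<partial>lborel)"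
proof -
  have "v \<noteq> 0" using v by auto
  then have "negligible {x. v \<bullet> x = d}" by (intro negligible_hyperplane) auto
  then have "{x. v \<bullet> x = d} \<in> null_sets lborel"
    by (subst (asm) negligible_iff_null_sets)
      (auto simp: null_sets_completion_iff)
  then have ae: "AE x in lborel. x \<bullet> v \<noteq> d"
    by (auto intro!: AE_I'[of "{x. v \<bullet> x = d}"] simp: inner_commute)
  have "(\<integral>\<^sup>+x. f x \<partial>lborel) = (\<integral>\<^sup>+x. f x * indicator {x. x \<bullet> v < d} x
      + f x * indicator {x. x \<bullet> v > d} x \<partial>lborel)"
    using ae by (intro nn_integral_cong_AE) (auto elim!: eventually_mono simp: indicator_def)
  also have "\<dots> = (\<integral>\<^sup>+x. f x * indicator {x. x \<bullet> v < d} x \<partial>lborel)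
      + (\<integral>\<^sup>+x. f x * indicator {x. x \<bullet> v > d} x \<partial>lborel)"
    by (intro nn_integral_add) auto
  also have "(\<integral>\<^sup>+x. f x * indicator {x. x \<bullet> v > d} x \<partial>lborel) =
     (\<integral>\<^sup>+x. f (mirror v d x) * indicator {x. x \<bullet> v > d} (mirror v d x) \<partial>lborel)"
    by (rule nn_integral_mirror[OF v, symmetric]) simp
  also have "\<dots> = (\<integral>\<^sup>+x. f (mirror v d x) * indicator {x. x \<bullet> v < d} x \<partial>lborel)"
    by (intro nn_integral_cong) (auto simp: indicator_def mirror_inner[OF v])
  finally show ?thesis
    by (simp add: nn_integral_add[symmetric] distrib_right)
qed

text \<open>Two-point symmetrization. For \<open>d > 0\<close> the half-space that receives the
  larger values contains the origin, so mass moves inwards.\<close>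

definition polarize :: "'a::euclidean_space \<Rightarrow> real \<Rightarrow> ('a \<Rightarrow> real) \<Rightarrow> 'a \<Rightarrow> real" where
  "polarize v d f x =
     (if x \<bullet> v < d then max (f x) (f (mirror v d x)) else min (f x) (f (mirror v d x)))"

lemma borel_measurable_polarize [measurable]:
  assumes [measurable]: "f \<in> borel_measurable borel"
  shows "polarize v d f \<in> borel_measurable borel"
  unfolding polarize_def by measurable

lemma polarize_mirror:
  "norm v = 1 \<Longrightarrow> x \<bullet> v < d \<Longrightarrow> polarize v d f (mirror v d x) = min (f x) (f (mirror v d x))"
  by (simp add: polarize_def mirror_inner min.commute)

lemma nn_integral_polarize_comp:
  fixes v :: "'a::euclidean_space" and \<Phi> :: "real \<Rightarrow> ennreal"
  assumes v: "norm v = 1" and [measurable]: "f \<in> borel_measurable borel" "\<Phi> \<in> borel_measurable borel"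
  shows "(\<integral>\<^sup>+x. \<Phi> (polarize v d f x) \<partial>lborel) = (\<integral>\<^sup>+x. \<Phi> (f x) \<partial>lborel)"
proof -
  have "(\<integral>\<^sup>+x. \<Phi> (polarize v d f x) \<partial>lborel) = (\<integral>\<^sup>+x. (\<Phi> (polarize v d f x) +
      \<Phi> (polarize v d f (mirror v d x))) * indicator {x. x \<bullet> v < d} x \<partial>lborel)"
    by (rule nn_integral_halfspace_split[OF v]) measurable
  also have "\<dots> = (\<integral>\<^sup>+x. (\<Phi> (f x) + \<Phi> (f (mirror v d x))) * indicator {x. x \<bullet> v < d} x \<partial>lborel)"
  proof (rule nn_integral_cong)
    fix x
    show "(\<Phi> (polarize v d f x) + \<Phi> (polarize v d f (mirror v d x))) * indicator {x. x \<bullet> v < d} x =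
       (\<Phi> (f x) + \<Phi> (f (mirror v d x))) * indicator {x. x \<bullet> v < d} x"
      by (cases "x \<bullet> v < d") (simp_all add: polarize_mirror[OF v],
        simp_all add: polarize_def max_def min_def add.commute)
  qed
  also have "\<dots> = (\<integral>\<^sup>+x. \<Phi> (f x) \<partial>lborel)"
    by (rule nn_integral_halfspace_split[OF v, symmetric]) measurable
  finally show ?thesis .
qed

lemma emeasure_superlevel_polarize:
  fixes v :: "'a::euclidean_space"
  assumes v: "norm v = 1" and [measurable]: "f \<in> borel_measurable borel"
  shows "emeasure lborel {x. polarize v d f x > h} = emeasure lborel {x. f x > h}"
proof -
  have "emeasure lborel {x. g x > h} = (\<integral>\<^sup>+x. indicator {h<..} (g x) \<partial>lborel)"
    if [measurable]: "g \<in> borel_measurable borel" for g :: "'a \<Rightarrow> real"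
  proof -
    have "(\<integral>\<^sup>+x. indicator {h<..} (g x) \<partial>lborel) = (\<integral>\<^sup>+x. indicator {x. g x > h} x \<partial>lborel)"
      by (intro nn_integral_cong) (simp add: indicator_def)
    also have "\<dots> = emeasure lborel {x. g x > h}"
      by (rule nn_integral_indicator) measurable
    finally show ?thesis ..
  qed
  then show ?thesis
    by (simp add: nn_integral_polarize_comp[OF v])
qed

text \<open>On each mirror pair the loss of second moment is the exchanged mass times the difference
  of the squared norms. An identity is recorded, not just an inequality, because a function of least
  second moment is tested later by the vanishing of this loss.\<close>

lemma nn_integral_polarize_moment:
  fixes v :: "'a::euclidean_space"
  assumes v: "norm v = 1" and d: "d \<ge> 0" and [measurable]: "f \<in> borel_measurable borel"
    and f: "\<And>x. f x \<ge> 0"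
  shows "(\<integral>\<^sup>+x. ennreal (polarize v d f x * (norm x)\<^sup>2) \<partial>lborel) +
    (\<integral>\<^sup>+x. ennreal (max 0 (f (mirror v d x) - f x) * ((norm (mirror v d x))\<^sup>2 - (norm x)\<^sup>2)) *
       indicator {x. x \<bullet> v < d} x \<partial>lborel)
    = (\<integral>\<^sup>+x. ennreal (f x * (norm x)\<^sup>2) \<partial>lborel)"
proof -
  let ?s = "mirror v d" and ?p = "polarize v d f"
  have pt: "ennreal (?p x * (norm x)\<^sup>2) + ennreal (?p (?s x) * (norm (?s x))\<^sup>2)
     + ennreal (max 0 (f (?s x) - f x) * ((norm (?s x))\<^sup>2 - (norm x)\<^sup>2))
     = ennreal (f x * (norm x)\<^sup>2) + ennreal (f (?s x) * (norm (?s x))\<^sup>2)" if x: "x \<bullet> v < d" for x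
  proof -
    define N N' where "N = (norm x)\<^sup>2" and "N' = (norm (?s x))\<^sup>2"
    have N: "0 \<le> N" "N \<le> N'"
      using x d mult_nonneg_nonneg[of d "d - x \<bullet> v"] unfolding N_def N'_def norm_mirror_power2[OF v]
      by (auto simp: algebra_simps)
    have p: "?p x = max (f x) (f (?s x))" "?p (?s x) = min (f x) (f (?s x))"
      using x by (simp_all only: polarize_mirror[OF v]) (simp add: polarize_def)
    have *: "max a b * N + min a b * N' + max 0 (b - a) * (N' - N) = a * N + b * N'" for a b :: real
      by (cases "a \<le> b") (auto simp: max_def min_def algebra_simps)
    show ?thesis
      unfolding p N_def[symmetric] N'_def[symmetric] using *[of "f x" "f (?s x)"] N f[of x] f[of "?s x"]
      by (simp add: ennreal_plus[symmetric] del: ennreal_plus)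
  qed
  show ?thesis
    apply (subst nn_integral_halfspace_split[OF v, of "\<lambda>x. ennreal (?p x * (norm x)\<^sup>2)" d], measurable)
    apply (subst nn_integral_halfspace_split[OF v, of "\<lambda>x. ennreal (f x * (norm x)\<^sup>2)" d], measurable)
    apply (subst nn_integral_add[symmetric], simp, simp)
    apply (intro nn_integral_cong)
    subgoal for x by (cases "x \<bullet> v < d") (simp_all add: pt)
    done
qed

section \<open>Interaction energy with a nonnegative kernel\<close>

definition nn_energy :: "('a::euclidean_space \<Rightarrow> ennreal) \<Rightarrow> ('a \<Rightarrow> real) \<Rightarrow> ennreal" where
  "nn_energy K f = (\<integral>\<^sup>+x. \<integral>\<^sup>+y. ennreal (f x) * ennreal (f y) * K (x - y) \<partial>lborel \<partial>lborel)"

lemma ennreal_two_point: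
  fixes p q k l :: ennreal
  assumes "p \<le> q" "l \<le> k"
  shows "p * k + q * l \<le> q * k + p * l"
proof -
  obtain e where e: "k = l + e" using assms(2) by (auto simp: le_iff_add)
  have "p * k + q * l = (p * l + q * l) + p * e" by (simp add: e algebra_simps)
  also have "\<dots> \<le> (p * l + q * l) + q * e" using assms(1) by (intro add_left_mono mult_right_mono) auto
  finally show ?thesis by (simp add: e algebra_simps)
qed

text \<open>After folding both variables only the kernel values at \<open>x - y\<close> and at
  \<open>x - mirror v d y\<close> remain, and the first is the larger one for points on the same
  side. What is left concerns four values of \<open>f\<close>: polarization pairs the larger sum of
  products with the larger kernel value.\<close>

lemma nn_energy_polarize:
  fixes v :: "'a::euclidean_space"
  assumes v: "norm v = 1" and [measurable]: "f \<in> borel_measurable borel" "K \<in> borel_measurable borel"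
    and f: "\<And>x. f x \<ge> 0"
    and K: "\<And>x y. norm x \<le> norm y \<Longrightarrow> K y \<le> K x"
  shows "nn_energy K f \<le> nn_energy K (polarize v d f)"
proof -
  let ?s = "mirror v d" and ?H = "{x. x \<bullet> v < d}"
  have split: "nn_energy K g = (\<integral>\<^sup>+x. (\<integral>\<^sup>+y. ((ennreal (g x) * ennreal (g y) + ennreal (g (?s x)) * ennreal (g (?s y))) * K (x - y)
       + (ennreal (g x) * ennreal (g (?s y)) + ennreal (g (?s x)) * ennreal (g y)) * K (x - ?s y)) * indicator ?H y \<partial>lborel)
         * indicator ?H x \<partial>lborel)"
    if [measurable]: "g \<in> borel_measurable borel" for g
  proof -
    have K1: "K (?s x - ?s y) = K (x - y)" "K (?s x - y) = K (x - ?s y)" for x y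
      by (intro antisym K; simp add: norm_mirror_diff[OF v] norm_mirror_commute[OF v, of d x y])+
    define h where "h x y = ennreal (g x) * ennreal (g y) * K (x - y)" for x y
    have [measurable]: "case_prod h \<in> borel_measurable (borel \<Otimes>\<^sub>M borel)"
      unfolding h_def by measurable
    have "nn_energy K g = (\<integral>\<^sup>+x. (\<integral>\<^sup>+y. h x y \<partial>lborel) \<partial>lborel)"
      by (simp add: nn_energy_def h_def)
    also have "\<dots> = (\<integral>\<^sup>+x. ((\<integral>\<^sup>+y. h x y \<partial>lborel) + (\<integral>\<^sup>+y. h (?s x) y \<partial>lborel)) * indicator ?H x \<partial>lborel)"
      by (subst nn_integral_halfspace_split[OF v, of _ d]) auto
    also have "\<dots> = (\<integral>\<^sup>+x. ((\<integral>\<^sup>+y. (h x y + h x (?s y)) * indicator ?H y \<partial>lborel) +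
        (\<integral>\<^sup>+y. (h (?s x) y + h (?s x) (?s y)) * indicator ?H y \<partial>lborel)) * indicator ?H x \<partial>lborel)"
      by (intro nn_integral_cong arg_cong2[where f="(*)"] arg_cong2[where f="(+)"] refl
            nn_integral_halfspace_split[OF v]) auto
    also have "\<dots> = (\<integral>\<^sup>+x. (\<integral>\<^sup>+y. ((h x y + h x (?s y)) + (h (?s x) y + h (?s x) (?s y))) * indicator ?H y \<partial>lborel)
         * indicator ?H x \<partial>lborel)"
      by (subst nn_integral_add[symmetric]) (auto simp: distrib_right)
    also have "\<dots> = (\<integral>\<^sup>+x. (\<integral>\<^sup>+y. ((ennreal (g x) * ennreal (g y) + ennreal (g (?s x)) * ennreal (g (?s y))) * K (x - y)
       + (ennreal (g x) * ennreal (g (?s y)) + ennreal (g (?s x)) * ennreal (g y)) * K (x - ?s y)) * indicator ?H y \<partial>lborel)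
         * indicator ?H x \<partial>lborel)"
      unfolding h_def K1(1) unfolding K1(2) by (simp add: algebra_simps del: mirror_mirror)
    finally show ?thesis .
  qed
  \<comment> \<open>If the two mirror pairs are ordered alike, polarization changes nothing in this
    expression. If they are ordered oppositely, it exchanges the two sums of products, and the
    larger sum moves to the larger weight \<open>k\<close>.\<close>
  have pt: "(ennreal a * ennreal b + ennreal a' * ennreal b') * k + (ennreal a * ennreal b' + ennreal a' * ennreal b) * l
     \<le> (ennreal (max a a') * ennreal (max b b') + ennreal (min a a') * ennreal (min b b')) * k
      + (ennreal (max a a') * ennreal (min b b') + ennreal (min a a') * ennreal (max b b')) * l"
    if "l \<le> k" "0 \<le> a" "0 \<le> a'" "0 \<le> b" "0 \<le> b'" for a b a' b' :: real and k l :: ennreal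
  proof -
    have *: "ennreal x * ennreal y + ennreal x' * ennreal y' = ennreal (x * y + x' * y')" 
      if "0 \<le> x" "0 \<le> x'" "0 \<le> y" "0 \<le> y'" for x y x' y'
      using that by (simp add: ennreal_mult)
    have "(a \<le> a' \<and> b' \<le> b) \<or> (a' \<le> a \<and> b \<le> b') \<or> (a \<le> a' \<and> b \<le> b') \<or> (a' \<le> a \<and> b' \<le> b)"
      by linarith
    moreover have "a * b + a' * b' \<le> a * b' + a' * b" if "(a \<le> a' \<and> b' \<le> b) \<or> (a' \<le> a \<and> b \<le> b')"
      using that mult_nonneg_nonneg[of "a' - a" "b - b'"] mult_nonneg_nonneg[of "a - a'" "b' - b"]
      by (auto simp: algebra_simps)
    ultimately consider "(a \<le> a' \<and> b \<le> b') \<or> (a' \<le> a \<and> b' \<le> b)"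
      | "(a \<le> a' \<and> b' \<le> b) \<or> (a' \<le> a \<and> b \<le> b')" "a * b + a' * b' \<le> a * b' + a' * b" by blast
    then show ?thesis
    proof cases
      case 1
      then show ?thesis by (auto simp: max_absorb1 max_absorb2 min_absorb1 min_absorb2 add.commute)
    next
      case 2
      have "ennreal (a * b + a' * b') * k + ennreal (a * b' + a' * b) * l
        \<le> ennreal (a * b' + a' * b) * k + ennreal (a * b + a' * b') * l"
        using 2(2) that by (intro ennreal_two_point ennreal_leI) auto
      with 2(1) that show ?thesis
        by (auto simp: * max_absorb1 max_absorb2 min_absorb1 min_absorb2 add.commute)
    qed
  qed
  show ?thesis
    unfolding split[OF assms(2)] split[OF borel_measurable_polarize[OF assms(2)]]
  proof (rule nn_integral_mono, goal_cases)
    case (1 x)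
    show ?case
    proof (cases "x \<in> ?H")
      case x: True
      show ?thesis
        unfolding indicator_simps(1)[OF x] mult_1_right
      proof (rule nn_integral_mono, goal_cases)
        case (1 y)
        show ?case
        proof (cases "y \<in> ?H")
          case y: True
          have "K (x - ?s y) \<le> K (x - y)"
            using x y by (intro K norm_diff_mirror_ge[OF v]) (simp add: mult_nonpos_nonpos)
          from pt[OF this f[of x] f[of "?s x"] f[of y] f[of "?s y"]] x y show ?thesis
            by (simp add: polarize_mirror[OF v]) (simp add: polarize_def)
        qed simp
      qed
    qed simp
  qed
qed

text \<open>Continuity in \<open>L^1\<close> under a common bound, from \<open>f x * f y - g x * g y
  = (f x - g x) * f y + g x * (f y - g y)\<close> and the translation invariance of the integral of
  \<open>K\<close>. It serves for limits within the class below and for the passage from continuous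
  to bounded densities.\<close>

lemma nn_energy_le_add:
  fixes f g :: "'a::euclidean_space \<Rightarrow> real"
  assumes [measurable]: "f \<in> borel_measurable borel" "g \<in> borel_measurable borel" "K \<in> borel_measurable borel"
    and f: "\<And>x. 0 \<le> f x" "\<And>x. f x \<le> B" and g: "\<And>x. 0 \<le> g x" "\<And>x. g x \<le> B"
  shows "nn_energy K f \<le> nn_energy K g +
    2 * ennreal B * (\<integral>\<^sup>+x. K x \<partial>lborel) * (\<integral>\<^sup>+x. ennreal \<bar>f x - g x\<bar> \<partial>lborel)"
proof -
  let ?d = "\<lambda>x. ennreal \<bar>f x - g x\<bar>"
  have B: "0 \<le> B" using f order.trans by blast
  have pt: "ennreal (f x) * ennreal (f y) * k \<le> ennreal (g x) * ennreal (g y) * k +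
     (ennreal B * (?d x * k) + ennreal B * (?d y * k))" for x y k
  proof -
    have "f x * f y - g x * g y = (f x - g x) * f y + g x * (f y - g y)" by (simp add: algebra_simps)
    also have "\<dots> \<le> \<bar>f x - g x\<bar> * B + B * \<bar>f y - g y\<bar>"
    proof (rule add_mono)
      show "(f x - g x) * f y \<le> \<bar>f x - g x\<bar> * B" using f B by (intro mult_mono) auto
      have "g x * (f y - g y) \<le> g x * \<bar>f y - g y\<bar>" using g by (intro mult_left_mono) auto
      also have "\<dots> \<le> B * \<bar>f y - g y\<bar>" using g by (intro mult_right_mono) auto
      finally show "g x * (f y - g y) \<le> B * \<bar>f y - g y\<bar>" .
    qed
    finally have "ennreal (f x * f y) \<le> ennreal (g x * g y + (B * \<bar>f x - g x\<bar> + B * \<bar>f y - g y\<bar>))"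
      by (intro ennreal_leI) (simp add: algebra_simps)
    also have "\<dots> = ennreal (g x) * ennreal (g y) + (ennreal B * ?d x + ennreal B * ?d y)"
      using f g B by (simp add: ennreal_mult)
    finally have "ennreal (f x) * ennreal (f y) * k \<le> (ennreal (g x) * ennreal (g y) + (ennreal B * ?d x + ennreal B * ?d y)) * k"
      using f by (intro mult_right_mono) (auto simp: ennreal_mult)
    then show ?thesis by (simp add: algebra_simps)
  qed
  have 1: "(\<integral>\<^sup>+x. \<integral>\<^sup>+y. ?d x * K (x - y) \<partial>lborel \<partial>lborel) = (\<integral>\<^sup>+x. K x \<partial>lborel) * (\<integral>\<^sup>+x. ?d x \<partial>lborel)"
    by (simp add: nn_integral_cmult nn_integral_lborel_reflect nn_integral_multc mult.commute)
  have "(\<integral>\<^sup>+x. \<integral>\<^sup>+y. ?d y * K (x - y) \<partial>lborel \<partial>lborel) = (\<integral>\<^sup>+y. \<integral>\<^sup>+x. ?d y * K (x - y) \<partial>lborel \<partial>lborel)"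
    by (rule lborel_pair.Fubini') measurable
  also have "\<dots> = (\<integral>\<^sup>+y. \<integral>\<^sup>+x. ?d y * K (x + (- y)) \<partial>lborel \<partial>lborel)"
    by simp
  also have "\<dots> = (\<integral>\<^sup>+x. K x \<partial>lborel) * (\<integral>\<^sup>+x. ?d x \<partial>lborel)"
    by (subst nn_integral_cmult, measurable, subst nn_integral_lborel_shift, measurable)
      (simp add: nn_integral_cmult mult.commute)
  finally have 2: "(\<integral>\<^sup>+x. \<integral>\<^sup>+y. ?d y * K (x - y) \<partial>lborel \<partial>lborel) = (\<integral>\<^sup>+x. K x \<partial>lborel) * (\<integral>\<^sup>+x. ?d x \<partial>lborel)" .
  have "nn_energy K f \<le> (\<integral>\<^sup>+x. \<integral>\<^sup>+y. ennreal (g x) * ennreal (g y) * K (x - y) +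
     (ennreal B * (?d x * K (x - y)) + ennreal B * (?d y * K (x - y))) \<partial>lborel \<partial>lborel)"
    unfolding nn_energy_def by (intro nn_integral_mono pt)
  also have "\<dots> = nn_energy K g + (ennreal B * (\<integral>\<^sup>+x. \<integral>\<^sup>+y. ?d x * K (x - y) \<partial>lborel \<partial>lborel)
       + ennreal B * (\<integral>\<^sup>+x. \<integral>\<^sup>+y. ?d y * K (x - y) \<partial>lborel \<partial>lborel))"
    unfolding nn_energy_def
    by (simp add: nn_integral_add nn_integral_cmult del: distrib_left_numeral)
  also have "\<dots> = nn_energy K g + 2 * ennreal B * (\<integral>\<^sup>+x. K x \<partial>lborel) * (\<integral>\<^sup>+x. ?d x \<partial>lborel)"
    unfolding 1 2 by (simp add: mult.assoc mult_2 distrib_right)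
  finally show ?thesis .
qed

lemma emeasure_lborel_open_pos:
  fixes U :: "'a::euclidean_space set"
  assumes "open U" "x \<in> U"
  shows "emeasure lborel U > 0"
proof -
  obtain e where e: "e > 0" "ball x e \<subseteq> U" using assms by (meson open_contains_ball)
  have "0 < emeasure lborel (ball x e)" using e by (simp add: emeasure_ball)
  also have "\<dots> \<le> emeasure lborel U" using e assms by (intro emeasure_mono) auto
  finally show ?thesis .
qed

text \<open>
  The maximisation argument: among all functions that share the modulus of continuity, the
  bounds and the level-set bounds of \<open>f\<close> and have at least its energy, one of least second
  moment is symmetric decreasing, because polarization would lower its second moment.
\<close>

definition riesz_class :: "('a::euclidean_space \<Rightarrow> ennreal) \<Rightarrow> real \<Rightarrow> real \<Rightarrow> ('a \<Rightarrow> real) \<Rightarrow> ('a \<Rightarrow> real) set" where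
  "riesz_class K R B f = {F. (\<forall>x. 0 \<le> F x \<and> F x \<le> B) \<and> (\<forall>x. R < norm x \<longrightarrow> F x = 0) \<and>
     (\<forall>e d. (\<forall>x y. norm (x - y) < d \<longrightarrow> \<bar>f x - f y\<bar> \<le> e) \<longrightarrow> (\<forall>x y. norm (x - y) < d \<longrightarrow> \<bar>F x - F y\<bar> \<le> e)) \<and>
     (\<forall>h>0. emeasure lborel {x. F x > h} \<le> emeasure lborel {x. f x > h}) \<and> nn_energy K f \<le> nn_energy K F}"

lemma riesz_class_continuous:
  assumes "F \<in> riesz_class K R B f" "uniformly_continuous_on UNIV f"
  shows "continuous_on UNIV F"
proof (rule uniformly_continuous_imp_continuous)
  show "uniformly_continuous_on UNIV F"
    unfolding uniformly_continuous_on_def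
  proof (intro allI impI)
    fix e :: real assume "e > 0"
    then obtain d where d: "d > 0" "\<And>x y. dist x y < d \<Longrightarrow> dist (f x) (f y) < e / 2"
      using assms(2) unfolding uniformly_continuous_on_def by (metis UNIV_I half_gt_zero)
    have "\<forall>x y. norm (x - y) < d \<longrightarrow> \<bar>f x - f y\<bar> \<le> e / 2"
      using d(2) by (auto simp: dist_norm less_imp_le)
    then have "\<forall>x y. norm (x - y) < d \<longrightarrow> \<bar>F x - F y\<bar> \<le> e / 2"
      using assms(1) unfolding riesz_class_def by blast
    then show "\<exists>d>0. \<forall>x\<in>UNIV. \<forall>x'\<in>UNIV. dist x' x < d \<longrightarrow> dist (F x') (F x) < e"
      using d(1) \<open>e > 0\<close> by (intro exI[of _ d]) (force simp: dist_norm)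
  qed
qed

text \<open>The conditions of the class are chosen to survive a polarization with
  \<open>d > 0\<close>. Nothing appears outside the ball, because the mirror image of a point on the
  side of the origin is at least as far out; superlevel volumes are unchanged; maxima and minima do
  not worsen a modulus of continuity.\<close>

lemma riesz_class_polarize:
  assumes v: "norm v = 1" and d: "d > 0" and F: "F \<in> riesz_class K R B f"
    and f: "uniformly_continuous_on UNIV f"
    and [measurable]: "K \<in> borel_measurable borel" and K: "\<And>x y. norm x \<le> norm y \<Longrightarrow> K y \<le> K x"
  shows "polarize v d F \<in> riesz_class K R B f"
proof -
  let ?s = "mirror v d"
  have [measurable]: "F \<in> borel_measurable borel"
    using riesz_class_continuous[OF F f] by (rule borel_measurable_continuous_onI)
  have F0: "\<And>x. 0 \<le> F x" "\<And>x. F x \<le> B" and FR: "\<And>x. R < norm x \<Longrightarrow> F x = 0"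
    using F by (auto simp: riesz_class_def)
  have "polarize v d F x = 0" if "R < norm x" for x
  proof (cases "x \<bullet> v < d")
    case True
    have "(norm x)\<^sup>2 \<le> (norm (?s x))\<^sup>2"
      unfolding norm_mirror_power2[OF v] using True d mult_nonneg_nonneg[of d "d - x \<bullet> v"] by (simp add: algebra_simps)
    then have "norm x \<le> norm (?s x)" by (rule power2_le_imp_le) simp
    then show ?thesis using FR[of x] FR[of "?s x"] that by (simp add: polarize_def)
  next
    case False
    then show ?thesis using FR[OF that] F0[of "?s x"] by (simp add: polarize_def)
  qed
  moreover have "\<bar>polarize v d F x - polarize v d F y\<bar> \<le> e"
    if "\<forall>x y. norm (x - y) < \<delta> \<longrightarrow> \<bar>f x - f y\<bar> \<le> e" "norm (x - y) < \<delta>" for x y e \<delta>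
  proof -
    have m: "\<bar>F x - F y\<bar> \<le> e" if "norm (x - y) < \<delta>" for x y
      using F \<open>\<forall>x y. norm (x - y) < \<delta> \<longrightarrow> \<bar>f x - f y\<bar> \<le> e\<close> that unfolding riesz_class_def by blast
    have 1: "\<bar>F x - F y\<bar> \<le> e" "\<bar>F (?s x) - F (?s y)\<bar> \<le> e"
      using that by (auto intro!: m simp: norm_mirror_diff[OF v])
    \<comment> \<open>For points on opposite sides, the values to compare are those at one point and
      at the mirror image of the other, and these are no farther apart than \<open>x\<close> and
      \<open>y\<close>.\<close>
    have 2: "\<bar>F x - F (?s y)\<bar> \<le> e \<and> \<bar>F (?s x) - F y\<bar> \<le> e" if "x \<bullet> v < d \<longleftrightarrow> \<not> y \<bullet> v < d"
    proof -
      have "norm (x - ?s y) \<le> norm (x - y)"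
        using that by (intro norm_diff_mirror_le[OF v]) (auto simp: mult_le_0_iff)
      then show ?thesis using \<open>norm (x - y) < \<delta>\<close>
        by (auto intro!: m simp: norm_mirror_commute[OF v])
    qed
    show ?thesis
      using 1 2 by (auto simp: polarize_def max_def min_def abs_le_iff)
  qed
  moreover have "0 \<le> polarize v d F x \<and> polarize v d F x \<le> B" for x
    using F0 by (auto simp: polarize_def max_def min_def)
  moreover have "nn_energy K f \<le> nn_energy K (polarize v d F)"
  proof -
    have "nn_energy K f \<le> nn_energy K F" using F by (simp add: riesz_class_def)
    also have "\<dots> \<le> nn_energy K (polarize v d F)"
      by (rule nn_energy_polarize[OF v]) (use F0 K in auto)
    finally show ?thesis .
  qed
  moreover have "emeasure lborel {x. polarize v d F x > h} \<le> emeasure lborel {x. f x > h}" if "h > 0" for h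
    using F that by (simp add: riesz_class_def emeasure_superlevel_polarize[OF v])
  ultimately show ?thesis unfolding riesz_class_def by blast
qed

lemma nn_integral_le_limit:
  fixes f :: "nat \<Rightarrow> 'a \<Rightarrow> ennreal"
  assumes "\<And>n. f n \<in> borel_measurable M" "\<And>x. (\<lambda>n. f n x) \<longlonglongrightarrow> g x" "(\<lambda>n. c n) \<longlonglongrightarrow> c'"
    "\<And>n. (\<integral>\<^sup>+x. f n x \<partial>M) \<le> c n"
  shows "(\<integral>\<^sup>+x. g x \<partial>M) \<le> c'"
proof -
  have "(\<integral>\<^sup>+x. g x \<partial>M) = (\<integral>\<^sup>+x. liminf (\<lambda>n. f n x) \<partial>M)"
    using assms(2) by (intro nn_integral_cong) (metis lim_imp_Liminf sequentially_bot)
  also have "\<dots> \<le> liminf (\<lambda>n. \<integral>\<^sup>+x. f n x \<partial>M)"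
    using assms(1) by (rule nn_integral_liminf)
  also have "\<dots> \<le> liminf c" using assms(4) by (intro Liminf_mono) auto
  also have "\<dots> = c'" using assms(3) by (simp add: lim_imp_Liminf)
  finally show ?thesis .
qed

text \<open>Uniform convergence on the ball keeps the energy bound through the \<open>L^1\<close>
  estimate, and pointwise convergence keeps the rest; for the superlevel volumes this is Fatou's
  lemma.\<close>

lemma riesz_class_limit:
  fixes f :: "'a::euclidean_space \<Rightarrow> real"
  assumes F: "\<And>n::nat. F n \<in> riesz_class K R B f" and f: "uniformly_continuous_on UNIV f"
    and R: "R \<ge> 0"
    and lim: "\<And>e. e > 0 \<Longrightarrow> \<forall>\<^sub>F n in sequentially. \<forall>x\<in>cball 0 R. \<bar>F n x - G x\<bar> \<le> e"
    and G: "\<And>x. R < norm x \<Longrightarrow> G x = 0"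
    and [measurable]: "K \<in> borel_measurable borel" and Kfin: "(\<integral>\<^sup>+x. K x \<partial>lborel) < \<infinity>"
  shows "G \<in> riesz_class K R B f" "\<And>x. (\<lambda>n. F n x) \<longlonglongrightarrow> G x"
proof -
  have F0: "\<And>n x. 0 \<le> F n x" "\<And>n x. F n x \<le> B" and FR: "\<And>n x. R < norm x \<Longrightarrow> F n x = 0"
    using F by (auto simp: riesz_class_def)
  have [measurable]: "F n \<in> borel_measurable borel" for n
    using riesz_class_continuous[OF F f] by (rule borel_measurable_continuous_onI)
  show pw: "(\<lambda>n. F n x) \<longlonglongrightarrow> G x" for x
  proof (cases "R < norm x")
    case False
    show ?thesis
    proof (rule tendstoI)
      fix e :: real assume "e > 0"
      then have "\<forall>\<^sub>F n in sequentially. \<forall>x\<in>cball 0 R. \<bar>F n x - G x\<bar> \<le> e / 2" by (intro lim) auto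
      then show "\<forall>\<^sub>F n in sequentially. dist (F n x) (G x) < e"
      proof eventually_elim
        case (elim n)
        then have "\<bar>F n x - G x\<bar> \<le> e / 2" using False by auto
        then show ?case using \<open>e > 0\<close> by (simp add: dist_real_def)
      qed
    qed
  qed (simp add: FR G)
  have [measurable]: "G \<in> borel_measurable borel"
    by (rule borel_measurable_LIMSEQ_real[OF pw]) measurable
  have G0: "0 \<le> G x" "G x \<le> B" for x
    using LIMSEQ_le_const[OF pw] LIMSEQ_le_const2[OF pw] F0 by metis+
  have "\<bar>G x - G y\<bar> \<le> e" if "\<forall>x y. norm (x - y) < d \<longrightarrow> \<bar>f x - f y\<bar> \<le> e" "norm (x - y) < d" for e d x y
  proof (rule LIMSEQ_le_const2)
    show "(\<lambda>n. \<bar>F n x - F n y\<bar>) \<longlonglongrightarrow> \<bar>G x - G y\<bar>" by (intro tendsto_intros pw)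
    have "\<bar>F n x - F n y\<bar> \<le> e" for n using F[of n] that unfolding riesz_class_def by blast
    then show "\<exists>N. \<forall>n\<ge>N. \<bar>F n x - F n y\<bar> \<le> e" by blast
  qed
  moreover have "emeasure lborel {x. G x > h} \<le> emeasure lborel {x. f x > h}" if h: "h > 0" for h
  proof -
    have "emeasure lborel {x. G x > h} = (\<integral>\<^sup>+x. indicator {x. G x > h} x \<partial>lborel)" by simp
    \<comment> \<open>A strict inequality \<open>G x > h\<close> passes to \<open>F n x\<close> as
      soon as \<open>n\<close> is large, so the indicator for the limit is below the lower limit of
      the indicators.\<close>
    also have "\<dots> \<le> (\<integral>\<^sup>+x. liminf (\<lambda>n. indicator {x. F n x > h} x) \<partial>lborel)"
    proof (intro nn_integral_mono)
      fix x
      show "(indicator {x. G x > h} x :: ennreal) \<le> liminf (\<lambda>n. indicator {x. F n x > h} x)"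
      proof (cases "G x > h")
        case True
        have "\<forall>\<^sub>F n in sequentially. F n x > h" by (rule order_tendstoD(1)[OF pw True])
        then have "\<forall>\<^sub>F n in sequentially. (1::ennreal) \<le> indicator {x. F n x > h} x"
          by eventually_elim (simp add: indicator_def)
        then show ?thesis using True by (simp add: Liminf_bounded)
      qed simp
    qed
    also have "\<dots> \<le> liminf (\<lambda>n. \<integral>\<^sup>+x. indicator {x. F n x > h} x \<partial>lborel)"
      by (rule nn_integral_liminf) measurable
    also have "\<dots> \<le> liminf (\<lambda>n. emeasure lborel {x. f x > h})"
      using F h by (intro Liminf_mono) (auto simp: riesz_class_def)
    finally show ?thesis by (simp add: Liminf_const)
  qed
  moreover have "nn_energy K f \<le> nn_energy K G"
  proof (rule ennreal_le_epsilon)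
    fix e :: real assume "nn_energy K G < top" "0 < e"
    define C where "C = enn2real (2 * ennreal B * (\<integral>\<^sup>+x. K x \<partial>lborel))"
    have C: "ennreal C = 2 * ennreal B * (\<integral>\<^sup>+x. K x \<partial>lborel)" "C \<ge> 0"
      using Kfin unfolding C_def by (subst ennreal_enn2real) (auto simp: ennreal_mult_less_top)
    define V where "V = measure lborel (cball 0 R :: 'a set)"
    have V: "emeasure lborel (cball 0 R :: 'a set) = ennreal V" "V \<ge> 0"
      unfolding V_def using emeasure_lborel_cball_finite[of "0 :: 'a" R]
      by (auto intro: emeasure_eq_ennreal_measure)
    \<comment> \<open>An error \<open>\<eta>\<close> on the ball of volume \<open>V\<close> changes
      the energy by at most \<open>C * (\<eta> * V)\<close>; the summand 1 keeps the denominator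
      positive when \<open>C * V = 0\<close>.\<close>
    define \<eta> where "\<eta> = e / (C * V + 1)"
    have \<eta>: "\<eta> > 0" "C * (\<eta> * V) \<le> e"
    proof -
      have p: "C * V + 1 > 0" using C(2) V(2) by (simp add: add_nonneg_pos)
      show "\<eta> > 0" using p \<open>e > 0\<close> by (simp add: \<eta>_def)
      have "C * (\<eta> * V) = e * (C * V / (C * V + 1))" by (simp add: \<eta>_def)
      also have "\<dots> \<le> e * 1" using p \<open>e > 0\<close> by (intro mult_left_mono) auto
      finally show "C * (\<eta> * V) \<le> e" by simp
    qed
    obtain n where n: "\<forall>x\<in>cball 0 R. \<bar>F n x - G x\<bar> \<le> \<eta>"
      using eventually_happens[OF lim[OF \<eta>(1)]] by auto
    have "(\<integral>\<^sup>+x. ennreal \<bar>F n x - G x\<bar> \<partial>lborel) \<le> (\<integral>\<^sup>+x. ennreal \<eta> * indicator (cball 0 R :: 'a set) x \<partial>lborel)"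
      using n by (intro nn_integral_mono) (auto simp: indicator_def FR G intro!: ennreal_leI)
    also have "\<dots> = ennreal (\<eta> * V)"
      using \<eta>(1) by (subst nn_integral_cmult_indicator) (simp_all add: V ennreal_mult)
    finally have d: "(\<integral>\<^sup>+x. ennreal \<bar>F n x - G x\<bar> \<partial>lborel) \<le> ennreal (\<eta> * V)" .
    have "nn_energy K f \<le> nn_energy K (F n)" using F by (simp add: riesz_class_def)
    also have "\<dots> \<le> nn_energy K G + ennreal C * (\<integral>\<^sup>+x. ennreal \<bar>F n x - G x\<bar> \<partial>lborel)"
      unfolding C(1) by (rule nn_energy_le_add) (use F0 G0 in auto)
    also have "\<dots> \<le> nn_energy K G + ennreal C * ennreal (\<eta> * V)"
      by (intro add_left_mono mult_left_mono d) simp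
    also have "\<dots> \<le> nn_energy K G + ennreal e"
      using \<eta> C(2) V(2) by (intro add_left_mono) (simp add: ennreal_mult[symmetric] ennreal_leI)
    finally show "nn_energy K f \<le> nn_energy K G + ennreal e" .
  qed
  ultimately show "G \<in> riesz_class K R B f"
    unfolding riesz_class_def using G G0 by blast
qed

text \<open>A minimizer of \<open>J\<close> exists by Arzela-Ascoli, since the class is uniformly
  bounded, equicontinuous and supported in one compact ball, and by Fatou's lemma, which makes
  \<open>J\<close> lower semicontinuous.\<close>

lemma riesz_class_symmetric_decreasing:
  fixes f :: "'a::euclidean_space \<Rightarrow> real"
  assumes f: "uniformly_continuous_on UNIV f" "\<And>x. 0 \<le> f x" "\<And>x. f x \<le> B" "\<And>x. R < norm x \<Longrightarrow> f x = 0"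
    and R: "R \<ge> 0"
    and K [measurable]: "K \<in> borel_measurable borel" and Kmono: "\<And>x y. norm x \<le> norm y \<Longrightarrow> K y \<le> K x"
    and Kfin: "(\<integral>\<^sup>+x. K x \<partial>lborel) < \<infinity>"
  obtains G where "G \<in> riesz_class K R B f" "\<And>x y. norm x < norm y \<Longrightarrow> G y \<le> G x"
proof -
  define C where "C = riesz_class K R B f"
  define J :: "('a \<Rightarrow> real) \<Rightarrow> ennreal" where "J F = (\<integral>\<^sup>+x. ennreal (F x * (norm x)\<^sup>2) \<partial>lborel)" for F
  have fC: "f \<in> C" using f by (auto simp: C_def riesz_class_def)
  have B0: "0 \<le> B" using f(2,3) order.trans by blast
  have meas: "F \<in> borel_measurable borel" if "F \<in> C" for F
    using riesz_class_continuous[OF that[unfolded C_def] f(1)] by (rule borel_measurable_continuous_onI)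
  have Jfin: "J F < \<infinity>" if "F \<in> C" for F
  proof -
    have F: "\<And>x. 0 \<le> F x" "\<And>x. F x \<le> B" "\<And>x. R < norm x \<Longrightarrow> F x = 0"
      using that by (auto simp: C_def riesz_class_def)
    have "J F \<le> (\<integral>\<^sup>+x. ennreal (B * R\<^sup>2) * indicator (cball 0 R :: 'a set) x \<partial>lborel)"
      unfolding J_def
      by (intro nn_integral_mono) (use F B0 R in \<open>auto simp: indicator_def intro!: ennreal_leI mult_mono power_mono\<close>)
    also have "\<dots> < \<infinity>"
      using emeasure_lborel_cball_finite[of "0 :: 'a" R]
      by (subst nn_integral_cmult_indicator) (auto simp: ennreal_mult_less_top)
    finally show ?thesis .
  qed
  define \<mu> where "\<mu> = (INF F\<in>C. J F)"
  have \<mu>: "\<mu> < \<infinity>" using Jfin[OF fC] fC unfolding \<mu>_def by (meson INF_lower order.strict_trans1)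
  have "\<exists>F\<in>C. J F < \<mu> + ennreal (1 / Suc n)" for n
  proof -
    have "\<mu> < \<mu> + ennreal (1 / Suc n)"
      using \<mu> by (cases \<mu>) (auto simp: ennreal_plus[symmetric] ennreal_less_iff simp del: ennreal_plus of_nat_Suc)
    then show ?thesis by (subst (asm) (1) \<mu>_def) (simp add: INF_less_iff)
  qed
  then obtain F where F: "\<And>n. F n \<in> C" "\<And>n. J (F n) < \<mu> + ennreal (1 / Suc n)" by metis
  have FC: "0 \<le> F n x" "F n x \<le> B" "R < norm x \<Longrightarrow> F n x = 0" for n x
    using F(1)[of n] by (auto simp: C_def riesz_class_def)
  obtain g k where g: "continuous_on (cball 0 R) g" and k: "strict_mono (k :: nat \<Rightarrow> nat)"
    and gk: "\<And>e. 0 < e \<Longrightarrow> \<exists>N. \<forall>n x. n \<ge> N \<and> x \<in> cball 0 R \<longrightarrow> norm (F (k n) x - g x) < e"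
  proof (rule Arzela_Ascoli[of "cball 0 R" F B])
    show "compact (cball 0 R :: 'a set)" by simp
    show "norm (F n x) \<le> B" for n x using FC(1,2)[of n x] by simp
    fix x :: 'a and e :: real assume "0 < e"
    then obtain d where d: "d > 0" "\<And>x y. dist x y < d \<Longrightarrow> dist (f x) (f y) < e / 2"
      using f(1) unfolding uniformly_continuous_on_def by (metis UNIV_I half_gt_zero)
    have "\<forall>x y. norm (x - y) < d \<longrightarrow> \<bar>f x - f y\<bar> \<le> e / 2"
      using d(2) by (auto simp: dist_norm less_imp_le)
    then have le: "\<forall>x y. norm (x - y) < d \<longrightarrow> \<bar>F n x - F n y\<bar> \<le> e / 2" for n
      using F(1)[of n] unfolding C_def riesz_class_def by blast
    have "norm (F n x - F n y) < e" if "norm (x - y) < d" for n y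
      using le[of n, rule_format, OF that] \<open>0 < e\<close> by simp
    then show "\<exists>d>0. \<forall>n y. y \<in> cball 0 R \<and> norm (x - y) < d \<longrightarrow> norm (F n x - F n y) < e"
      using d(1) \<open>0 < e\<close> by (intro exI[of _ d]) auto
  qed blast
  define G where "G x = (if R < norm x then 0 else g x)" for x
  have lim: "\<forall>\<^sub>F n in sequentially. \<forall>x\<in>cball 0 R. \<bar>F (k n) x - G x\<bar> \<le> e" if "e > 0" for e
    using gk[OF that] unfolding eventually_sequentially by (force simp: G_def less_imp_le)
  have G0: "G x = 0" if "R < norm x" for x using that by (simp add: G_def)
  have GC: "G \<in> C" and pw: "\<And>x. (\<lambda>n. F (k n) x) \<longlonglongrightarrow> G x"
    using riesz_class_limit[of "\<lambda>n. F (k n)" K R B f G, OF F(1)[unfolded C_def] f(1) R lim G0 K Kfin]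
    by (auto simp: C_def)
  have JG: "J G \<le> \<mu>" unfolding J_def
  proof (rule nn_integral_le_limit)
    show "(\<lambda>x. ennreal (F (k n) x * (norm x)\<^sup>2)) \<in> borel_measurable lborel" for n
      using meas[OF F(1)[of "k n"]] by measurable
    show "(\<lambda>n. ennreal (F (k n) x * (norm x)\<^sup>2)) \<longlonglongrightarrow> ennreal (G x * (norm x)\<^sup>2)" for x
      by (intro tendsto_ennrealI tendsto_intros pw)
    have "(\<lambda>n. \<mu> + ennreal (1 / Suc n)) \<longlonglongrightarrow> \<mu> + ennreal 0"
      by (intro tendsto_add tendsto_const tendsto_ennrealI LIMSEQ_Suc lim_1_over_n) 
    then show "(\<lambda>n. \<mu> + ennreal (1 / Suc (k n))) \<longlonglongrightarrow> \<mu>"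
      using LIMSEQ_subseq_LIMSEQ[OF _ k] by (force simp: comp_def)
    show "(\<integral>\<^sup>+x. ennreal (F (k n) x * (norm x)\<^sup>2) \<partial>lborel) \<le> \<mu> + ennreal (1 / Suc (k n))" for n
      using F(2)[of "k n"] by (simp add: J_def less_imp_le)
  qed
  have "G y \<le> G x" if xy: "norm x < norm y" for x y
  proof (rule ccontr)
    assume neg: "\<not> G y \<le> G x"
    \<comment> \<open>The mirror is the perpendicular bisector of \<open>x\<close> and
      \<open>y\<close>, so it exchanges the two points; \<open>norm x < norm y\<close> puts the
      origin strictly on the side of \<open>x\<close>, that is \<open>d > 0\<close>.\<close>
    define v where "v = (1 / norm (y - x)) *\<^sub>R (y - x)"
    define d where "d = ((norm y)\<^sup>2 - (norm x)\<^sup>2) / (2 * norm (y - x))"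
    have nz: "norm (y - x) > 0" using xy by auto
    have v: "norm v = 1" using nz by (simp add: v_def)
    have d: "d > 0" using nz xy by (simp add: d_def power_strict_mono)
    have xv: "x \<bullet> v - d = - norm (y - x) / 2"
    proof -
      have "2 * (x \<bullet> (y - x)) - ((norm y)\<^sup>2 - (norm x)\<^sup>2) = - (norm (y - x))\<^sup>2"
        by (simp add: power2_norm_eq_inner inner_diff_left inner_diff_right inner_commute)
      moreover have "p / N - q / (2 * N) = - N / 2" if "2 * p - q = - N\<^sup>2" "N > 0" for p q N :: real
        using that by (simp add: field_simps power2_eq_square)
      moreover have "x \<bullet> v = (x \<bullet> (y - x)) / norm (y - x)" by (simp add: v_def)
      ultimately show ?thesis using nz by (simp only: d_def)
    qed
    have sx: "mirror v d x = y"
      unfolding mirror_def xv using nz by (simp add: v_def)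
    have [measurable]: "G \<in> borel_measurable borel" by (rule meas[OF GC])
    have Gc: "continuous_on UNIV G" using riesz_class_continuous[OF GC[unfolded C_def] f(1)] .
    have Gpos: "0 \<le> G x" for x using GC by (simp add: C_def riesz_class_def)
    define gain where "gain z = (max 0 (G (mirror v d z) - G z) * ((norm (mirror v d z))\<^sup>2 - (norm z)\<^sup>2))" for z
    have PC: "polarize v d G \<in> C"
      using riesz_class_polarize[OF v d GC[unfolded C_def] f(1) K Kmono] by (simp add: C_def)
    have "J (polarize v d G) + (\<integral>\<^sup>+z. ennreal (gain z) * indicator {z. z \<bullet> v < d} z \<partial>lborel) = J G"
      unfolding J_def gain_def using d by (intro nn_integral_polarize_moment[OF v]) (auto simp: Gpos)
    also have "\<dots> \<le> J (polarize v d G)"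
      using JG INF_lower[OF PC, of J] by (simp add: \<mu>_def)
    finally have z: "(\<integral>\<^sup>+z. ennreal (gain z) * indicator {z. z \<bullet> v < d} z \<partial>lborel) = 0"
      using Jfin[OF PC] ennreal_add_left_cancel_le[of "J (polarize v d G)" _ 0] by auto
    have ae0: "AE z in lborel. ennreal (gain z) * indicator {z. z \<bullet> v < d} z = 0"
      using z unfolding gain_def by (subst (asm) nn_integral_0_iff_AE) auto
    \<comment> \<open>The loss is strictly positive on \<open>U\<close>, while minimality makes it
      vanish almost everywhere. Thus the open set \<open>U\<close> is null, which contradicts
      \<open>x \<in> U\<close>.\<close>
    define U where "U = {z. z \<bullet> v < d} \<inter> {z. G z < G (mirror v d z)}"
    have gp: "gain z > 0" if "z \<in> U" for z
    proof -
      have "4 * d * (d - z \<bullet> v) > 0" using that d by (auto simp: U_def)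
      then have "(norm (mirror v d z))\<^sup>2 - (norm z)\<^sup>2 > 0"
        unfolding norm_mirror_power2[OF v] by (simp add: algebra_simps)
      moreover have "max 0 (G (mirror v d z) - G z) > 0" using that by (simp add: U_def)
      ultimately show ?thesis unfolding gain_def by (rule mult_pos_pos[rotated])
    qed
    from ae0 have "AE z in lborel. z \<notin> U"
    proof eventually_elim
      case (elim z)
      show ?case
      proof
        assume z: "z \<in> U"
        then have "ennreal (gain z) = 0" using elim by (simp add: U_def)
        then show False using gp[OF z] by (simp add: ennreal_eq_0_iff)
      qed
    qed
    moreover have oU: "open U" unfolding U_def
      by (intro open_Int open_Collect_less continuous_intros continuous_on_compose2[OF Gc]) (auto intro!: Gc continuous_on_mirror)
    ultimately have "emeasure lborel U = 0"
      by (subst (asm) AE_iff_measurable[OF _ refl]) auto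
    moreover have "x \<bullet> v < d" using xv nz by linarith
    then have "x \<in> U" using neg by (simp add: U_def sx)
    ultimately show False using emeasure_lborel_open_pos[OF oU] by force
  qed
  then show thesis using GC that unfolding C_def by blast
qed


section \<open>The rearrangement and the Riesz inequality\<close>

text \<open>Membership in the centered ball is a comparison of volumes: the ball with
  \<open>x\<close> on its boundary must be smaller than \<open>D\<close>. In this form no radius
  occurs, null sets give the empty ball, and measurability in \<open>x\<close> and in a level can be
  read off.\<close>

lemma rearrange_set_eq:
  fixes D :: "'a::euclidean_space set"
  assumes "emeasure lborel D < \<infinity>"
  shows "rearrange_set D = {x. ennreal (unit_ball_vol DIM('a) * norm x ^ DIM('a)) < emeasure lborel D}"
proof -
  let ?V = "unit_ball_vol DIM('a)" and ?n = "DIM('a)"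
  obtain m where m: "emeasure lborel D = ennreal m" "m \<ge> 0"
    using assms by (cases "emeasure lborel D") auto
  have V: "?V > 0" by simp
  have *: "ball 0 r = {x :: 'a. ?V * norm x ^ ?n < m}" if "emeasure lborel (ball (0::'a) r) = ennreal m" for r
  proof (cases "r > 0")
    case True
    then have "m = ?V * r ^ ?n" using that m by (simp add: emeasure_ball)
    moreover have "norm x ^ ?n < r ^ ?n \<longleftrightarrow> norm x < r" for x :: 'a
      using True power_mono_iff[of r "norm x" ?n] by (simp add: not_le[symmetric])
    ultimately show ?thesis by (simp add: set_eq_iff mult_less_cancel_left_pos[OF V] dist_norm)
  next
    case False
    then have "m = 0" using that m by (simp add: ball_empty)
    moreover have "\<not> ?V * norm x ^ ?n < 0" for x :: 'a using V by (simp add: not_less)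
    ultimately show ?thesis using False by (auto simp: ball_empty)
  qed
  define r where "r = root ?n (m / ?V)"
  have r: "r \<ge> 0" "r ^ ?n = m / ?V" using m V by (simp_all add: r_def)
  have "?V \<noteq> 0" using V by linarith
  then have e: "emeasure lborel (ball (0::'a) r) = ennreal m" using r by (simp add: emeasure_ball)
  have "rearrange_set D = ball 0 r"
    unfolding rearrange_set_def m(1)
  proof (rule the_equality)
    show "(\<exists>ra. ball (0::'a) r = ball 0 ra) \<and> emeasure lborel (ball (0::'a) r) = ennreal m" using e by blast
    fix B assume "(\<exists>r. B = ball (0::'a) r) \<and> emeasure lborel B = ennreal m"
    then show "B = ball 0 r" using *[OF e] * by auto
  qed
  then show ?thesis using *[OF e] V m by (simp add: ennreal_less_iff)
qed

lemma emeasure_ball_superlevel: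
  fixes m :: ennreal
  assumes "m < \<infinity>"
  shows "emeasure lborel {x::'a::euclidean_space. ennreal (unit_ball_vol DIM('a) * norm x ^ DIM('a)) < m} = m"
proof -
  let ?V = "unit_ball_vol DIM('a)" and ?n = "DIM('a)"
  obtain r where r: "m = ennreal r" "r \<ge> 0" using assms by (cases m) auto
  have V: "?V > 0" by simp
  define s where "s = root ?n (r / ?V)"
  have s: "s \<ge> 0" "s ^ ?n = r / ?V" using r V by (simp_all add: s_def)
  have "norm x ^ ?n < s ^ ?n \<longleftrightarrow> norm x < s" for x :: 'a
    using s(1) power_mono_iff[of s "norm x" ?n] by (simp add: not_le[symmetric])
  moreover have "?V * t < r \<longleftrightarrow> t < r / ?V" for t using V by (simp add: pos_less_divide_eq mult.commute)
  ultimately have "{x::'a. ennreal (?V * norm x ^ ?n) < m} = ball 0 s"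
    using s(2) V r by (auto simp: ennreal_less_iff)
  moreover have "?V \<noteq> 0" using V by linarith
  ultimately show ?thesis using s r by (simp add: emeasure_ball)
qed

text \<open>The bounds hold at every point and not only almost everywhere, so superlevel sets for
  \<open>h > 0\<close> lie in the closed ball of radius \<open>R\<close>. The mass is left free,
  which admits the continuous approximations of a density.\<close>

definition bounded_density :: "real \<Rightarrow> real \<Rightarrow> ('a::euclidean_space \<Rightarrow> real) \<Rightarrow> bool" where
  "bounded_density B R f \<longleftrightarrow> f \<in> borel_measurable borel \<and> (\<forall>x. 0 \<le> f x \<and> f x \<le> B) \<and>
     (\<forall>x. R < norm x \<longrightarrow> f x = 0)"

lemma bounded_densityD:
  assumes "bounded_density B R f"
  shows "f \<in> borel_measurable borel" "0 \<le> f x" "f x \<le> B" "R < norm x \<Longrightarrow> f x = 0"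
  using assms by (auto simp: bounded_density_def)

lemma emeasure_superlevel_finite:
  fixes f :: "'a::euclidean_space \<Rightarrow> real"
  assumes "bounded_density B R f" "0 < h"
  shows "emeasure lborel {y. f y > h} < \<infinity>"
proof -
  have "{y. f y > h} \<subseteq> cball 0 R"
  proof
    fix y assume "y \<in> {y. f y > h}"
    then show "y \<in> cball 0 R" using bounded_densityD(4)[OF assms(1), of y] assms(2) by (cases "R < norm y") auto
  qed
  then have "emeasure lborel {y. f y > h} \<le> emeasure lborel (cball (0::'a) R)"
    by (intro emeasure_mono) auto
  also have "\<dots> < \<infinity>" using emeasure_lborel_cball_finite[of "0::'a" R] by simp
  finally show ?thesis .
qed

lemma borel_measurable_superlevel_measure [measurable]:
  "(\<lambda>h. emeasure lborel {y. f y > h}) \<in> borel_measurable borel"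
  if [measurable]: "f \<in> borel_measurable borel" for f :: "'a::euclidean_space \<Rightarrow> real"
proof -
  have "(\<lambda>h. \<integral>\<^sup>+y. indicator {h<..} (f y) \<partial>lborel) \<in> borel_measurable borel"
    by (simp add: indicator_def)
  moreover have "(\<integral>\<^sup>+y. indicator {h<..} (f y) \<partial>lborel) = emeasure lborel {y. f y > h}" for h
  proof -
    have "(\<integral>\<^sup>+y. indicator {h<..} (f y) \<partial>lborel) = (\<integral>\<^sup>+y. indicator {y. f y > h} y \<partial>lborel)"
      by (intro nn_integral_cong) (simp add: indicator_def)
    also have "\<dots> = emeasure lborel {y. f y > h}" by (rule nn_integral_indicator) measurable
    finally show ?thesis .
  qed
  ultimately show ?thesis by simp
qed

text \<open>The levels that count for \<open>x\<close> form a Borel subset of \<open>{0..B}\<close>.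
  Its measure is finite, so the Bochner integral that defines the rearrangement is not a default
  value and agrees with the integral in \<open>ennreal\<close>.\<close>

lemma rearrange_eq_emeasure:
  fixes f :: "'a::euclidean_space \<Rightarrow> real"
  assumes f: "bounded_density B R f"
  shows "ennreal (rearrange f x) = (\<integral>\<^sup>+h. indicator {h. 0 < h \<and>
     ennreal (unit_ball_vol DIM('a) * norm x ^ DIM('a)) < emeasure lborel {y. f y > h}} h \<partial>lborel)"
    and "0 \<le> rearrange f x" and "rearrange f x \<le> B"
proof -
  let ?V = "unit_ball_vol DIM('a) * norm x ^ DIM('a)"
  note [measurable] = bounded_densityD(1)[OF f]
  define S where "S = {h. 0 < h \<and> ennreal ?V < emeasure lborel {y. f y > h}}"
  have [measurable]: "S \<in> sets borel" unfolding S_def by measurable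
  have B: "0 \<le> B" using bounded_densityD(2,3)[OF f] order.trans by blast
  have "S \<subseteq> {0..B}"
  proof
    fix h assume h: "h \<in> S"
    show "h \<in> {0..B}"
    proof (rule ccontr)
      assume "h \<notin> {0..B}"
      then have "B < h" using h by (simp add: S_def)
      then have "\<not> f y > h" for y using bounded_densityD(3)[OF f, of y] by linarith
      then have "{y. f y > h} = {}" by simp
      then show False using h by (simp add: S_def)
    qed
  qed
  then have SB: "emeasure lborel S \<le> ennreal B" using emeasure_mono[of S "{0..B}" lborel] B by simp
  have "rearrange f x = (\<integral>h. indicator S h \<partial>lborel)"
    unfolding rearrange_def set_lebesgue_integral_def
    by (intro Bochner_Integration.integral_cong)
      (auto simp: S_def indicator_def rearrange_set_eq[OF emeasure_superlevel_finite[OF f]])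
  then have r: "rearrange f x = measure lborel S" by simp
  then show "0 \<le> rearrange f x" by simp
  have "ennreal (rearrange f x) = emeasure lborel S"
    unfolding r using SB by (intro emeasure_eq_ennreal_measure[symmetric]) (auto simp: top_unique)
  then have e: "emeasure lborel S = ennreal (rearrange f x)" ..
  show "rearrange f x \<le> B"
    using SB unfolding e ennreal_le_iff[OF B] .
  have "(\<integral>\<^sup>+h. indicator S h \<partial>lborel) = emeasure lborel S" by (rule nn_integral_indicator) simp
  then have "ennreal (rearrange f x) = (\<integral>\<^sup>+h. indicator S h \<partial>lborel)" using e by simp
  then show "ennreal (rearrange f x) = (\<integral>\<^sup>+h. indicator {h. 0 < h \<and>
     ennreal (unit_ball_vol DIM('a) * norm x ^ DIM('a)) < emeasure lborel {y. f y > h}} h \<partial>lborel)"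
    unfolding S_def .
qed

lemma borel_measurable_rearrange [measurable]:
  fixes f :: "'a::euclidean_space \<Rightarrow> real"
  assumes f: "bounded_density B R f"
  shows "rearrange f \<in> borel_measurable borel"
proof -
  note [measurable] = bounded_densityD(1)[OF f]
  have "(\<lambda>x. enn2real (ennreal (rearrange f x))) \<in> borel_measurable borel"
    unfolding rearrange_eq_emeasure(1)[OF f] by (simp add: indicator_def)
  then show ?thesis using rearrange_eq_emeasure(2)[OF f] by simp
qed

lemma bounded_density_rearrange:
  fixes f :: "'a::euclidean_space \<Rightarrow> real"
  assumes f: "bounded_density B R f" and R: "R \<ge> 0"
  shows "bounded_density B R (rearrange f)"
proof -
  have "rearrange f x = 0" if "R < norm x" for x
  proof -
    have "\<not> ennreal (unit_ball_vol DIM('a) * norm x ^ DIM('a)) < emeasure lborel {y. f y > h}" if "h > 0" for h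
    proof -
      have "{y. f y > h} \<subseteq> cball 0 R"
        using bounded_densityD(4)[OF f] that by (force simp: not_less[symmetric])
      then have "emeasure lborel {y. f y > h} \<le> emeasure lborel (cball (0::'a) R)"
        by (intro emeasure_mono) auto
      also have "\<dots> = ennreal (unit_ball_vol DIM('a) * R ^ DIM('a))" using R by (simp add: emeasure_cball)
      also have "\<dots> \<le> ennreal (unit_ball_vol DIM('a) * norm x ^ DIM('a))"
        using R \<open>R < norm x\<close> by (intro ennreal_leI mult_left_mono power_mono) auto
      finally show ?thesis by (simp add: not_less)
    qed
    then have "ennreal (rearrange f x) = 0"
      unfolding rearrange_eq_emeasure(1)[OF f] by (auto simp: indicator_def cong: conj_cong)
    then show ?thesis using rearrange_eq_emeasure(2)[OF f, of x] by simp
  qed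
  then show ?thesis
    unfolding bounded_density_def
    using borel_measurable_rearrange[OF f] rearrange_eq_emeasure(2,3)[OF f] by blast
qed

section \<open>Layer-cake formulas and comparison of rearrangements\<close>

lemma layer_cake:
  fixes a :: real assumes "0 \<le> a"
  shows "ennreal a = (\<integral>\<^sup>+h. indicator {h. 0 < h \<and> h < a} h \<partial>lborel)"
proof -
  have "{h. 0 < h \<and> h < a} = {0<..<a}" by auto
  then show ?thesis using assms by simp
qed

lemma nn_integral_layers:
  fixes f :: "'a::euclidean_space \<Rightarrow> real"
  assumes f: "bounded_density B R f" and [measurable]: "g \<in> borel_measurable borel"
  shows "(\<integral>\<^sup>+x. ennreal (f x) * g x \<partial>lborel) =
    (\<integral>\<^sup>+h. indicator {0<..} h * (\<integral>\<^sup>+x. g x * indicator {x. f x > h} x \<partial>lborel) \<partial>lborel)"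
proof -
  note [measurable] = bounded_densityD(1)[OF f]
  have "(\<integral>\<^sup>+x. ennreal (f x) * g x \<partial>lborel) = (\<integral>\<^sup>+x. (\<integral>\<^sup>+h. indicator {h. 0 < h \<and> h < f x} h * g x \<partial>lborel) \<partial>lborel)"
    by (intro nn_integral_cong, subst nn_integral_multc, simp, subst layer_cake[OF bounded_densityD(2)[OF f]], simp)
  also have "\<dots> = (\<integral>\<^sup>+h. (\<integral>\<^sup>+x. indicator {h. 0 < h \<and> h < f x} h * g x \<partial>lborel) \<partial>lborel)"
    by (rule lborel_pair.Fubini') (simp add: indicator_def split_beta')
  also have "\<dots> = (\<integral>\<^sup>+h. indicator {0<..} h * (\<integral>\<^sup>+x. g x * indicator {x. f x > h} x \<partial>lborel) \<partial>lborel)"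
    by (subst nn_integral_cmult[symmetric], simp) (intro nn_integral_cong, auto simp: indicator_def)
  finally show ?thesis .
qed

lemma nn_integral_rearrange:
  fixes f :: "'a::euclidean_space \<Rightarrow> real"
  assumes f: "bounded_density B R f" and [measurable]: "g \<in> borel_measurable borel"
  shows "(\<integral>\<^sup>+x. ennreal (rearrange f x) * g x \<partial>lborel) =
    (\<integral>\<^sup>+h. indicator {0<..} h * (\<integral>\<^sup>+x. g x * indicator {x.
       ennreal (unit_ball_vol DIM('a) * norm x ^ DIM('a)) < emeasure lborel {y. f y > h}} x \<partial>lborel) \<partial>lborel)"
proof -
  note [measurable] = bounded_densityD(1)[OF f]
  let ?P = "\<lambda>h x::'a. ennreal (unit_ball_vol DIM('a) * norm x ^ DIM('a)) < emeasure lborel {y. f y > h}"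
  have "(\<integral>\<^sup>+x. ennreal (rearrange f x) * g x \<partial>lborel) = (\<integral>\<^sup>+x. (\<integral>\<^sup>+h. indicator {h. 0 < h \<and> ?P h x} h * g x \<partial>lborel) \<partial>lborel)"
    unfolding rearrange_eq_emeasure(1)[OF f] by (intro nn_integral_cong, subst nn_integral_multc) simp_all
  also have "\<dots> = (\<integral>\<^sup>+h. (\<integral>\<^sup>+x. indicator {h. 0 < h \<and> ?P h x} h * g x \<partial>lborel) \<partial>lborel)"
    by (rule lborel_pair.Fubini') (simp add: indicator_def split_beta')
  also have "\<dots> = (\<integral>\<^sup>+h. indicator {0<..} h * (\<integral>\<^sup>+x. g x * indicator {x. ?P h x} x \<partial>lborel) \<partial>lborel)"
    by (subst nn_integral_cmult[symmetric], simp) (intro nn_integral_cong, auto simp: indicator_def)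
  finally show ?thesis .
qed

lemma nn_integral_rearrange_eq:
  fixes f :: "'a::euclidean_space \<Rightarrow> real"
  assumes f: "bounded_density B R f"
  shows "(\<integral>\<^sup>+x. ennreal (rearrange f x) \<partial>lborel) = (\<integral>\<^sup>+x. ennreal (f x) \<partial>lborel)"
proof -
  note [measurable] = bounded_densityD(1)[OF f]
  have "indicator {0<..} h * (\<integral>\<^sup>+x. 1 * indicator {x::'a.
       ennreal (unit_ball_vol DIM('a) * norm x ^ DIM('a)) < emeasure lborel {y. f y > h}} x \<partial>lborel) = 
    indicator {0<..} h * (\<integral>\<^sup>+x. 1 * indicator {x. f x > h} x \<partial>lborel)" for h :: real
    using emeasure_superlevel_finite[OF f, of h]
    by (cases "h > 0") (simp_all add: emeasure_ball_superlevel)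
  then show ?thesis
    using nn_integral_rearrange[OF f, of "\<lambda>_. 1"] nn_integral_layers[OF f, of "\<lambda>_. 1"] by simp
qed

lemma rearrange_mono:
  fixes f g :: "'a::euclidean_space \<Rightarrow> real"
  assumes f: "bounded_density B R f" and g: "bounded_density B R g" and le: "\<And>x. f x \<le> g x"
  shows "rearrange f x \<le> rearrange g x"
proof -
  note [measurable] = bounded_densityD(1)[OF f] bounded_densityD(1)[OF g]
  have mono: "emeasure lborel {y. f y > h} \<le> emeasure lborel {y. g y > h}" for h
    by (intro emeasure_mono Collect_mono) (auto intro: less_le_trans[OF _ le])
  have "ennreal (rearrange f x) \<le> ennreal (rearrange g x)"
    unfolding rearrange_eq_emeasure(1)[OF f] rearrange_eq_emeasure(1)[OF g]
    by (intro nn_integral_mono) (use less_le_trans[OF _ mono] in \<open>auto simp: indicator_def\<close>)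
  then show ?thesis using rearrange_eq_emeasure(2)[OF g] by (simp add: ennreal_le_iff)
qed

text \<open>The rearrangement of \<open>max f g\<close> dominates both rearrangements and all integrals are preserved.\<close>

lemma rearrange_contraction:
  fixes f g :: "'a::euclidean_space \<Rightarrow> real"
  assumes f: "bounded_density B R f" and g: "bounded_density B R g"
  shows "(\<integral>\<^sup>+x. ennreal \<bar>rearrange f x - rearrange g x\<bar> \<partial>lborel) \<le> (\<integral>\<^sup>+x. ennreal \<bar>f x - g x\<bar> \<partial>lborel)"
proof -
  define m where "m x = max (f x) (g x)" for x
  have m: "bounded_density B R m"
    using f g unfolding bounded_density_def m_def by (auto simp: le_max_iff_disj)
  note [measurable] = bounded_densityD(1)[OF f] bounded_densityD(1)[OF g] bounded_densityD(1)[OF m]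
    borel_measurable_rearrange[OF f] borel_measurable_rearrange[OF g] borel_measurable_rearrange[OF m]
  have fm: "rearrange f x \<le> rearrange m x" and gm: "rearrange g x \<le> rearrange m x" for x
    using rearrange_mono[OF f m] rearrange_mono[OF g m] by (auto simp: m_def)
  have fin: "(\<integral>\<^sup>+x. ennreal (f x) + ennreal (g x) \<partial>lborel) < \<infinity>"
  proof -
    have B: "0 \<le> B" using bounded_densityD(2,3)[OF f] order.trans by blast
    have "(\<integral>\<^sup>+x. ennreal (f x) + ennreal (g x) \<partial>lborel) \<le> (\<integral>\<^sup>+x. ennreal (B + B) * indicator (cball 0 R :: 'a set) x \<partial>lborel)"
    proof (intro nn_integral_mono)
      fix x
      have "f x + g x \<le> (B + B) * indicator (cball 0 R :: 'a set) x"
        using bounded_densityD(2,3,4)[OF f, of x] bounded_densityD(2,3,4)[OF g, of x] by (cases "R < norm x") auto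
      from ennreal_leI[OF this] show "ennreal (f x) + ennreal (g x) \<le> ennreal (B + B) * indicator (cball 0 R :: 'a set) x"
        using bounded_densityD(2)[OF f, of x] bounded_densityD(2)[OF g, of x] by (auto simp: indicator_def split: if_splits)
    qed
    also have "\<dots> < \<infinity>"
      using emeasure_lborel_cball_finite[of "0 :: 'a" R]
      by (subst nn_integral_cmult_indicator) (auto simp: ennreal_mult_less_top)
    finally show ?thesis .
  qed
  \<comment> \<open>The finite common mass of \<open>f\<close> and \<open>g\<close>, which
    rearrangement preserves, is added on both sides and cancelled at the end. With it,
    \<open>\<bar>a - b\<bar> + (a + b) = 2 * max a b\<close> turns the claim into a comparison with
    \<open>m\<close>.\<close>
  have "(\<integral>\<^sup>+x. ennreal \<bar>rearrange f x - rearrange g x\<bar> \<partial>lborel) + (\<integral>\<^sup>+x. ennreal (f x) + ennreal (g x) \<partial>lborel)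
    = (\<integral>\<^sup>+x. ennreal \<bar>rearrange f x - rearrange g x\<bar> \<partial>lborel) + (\<integral>\<^sup>+x. ennreal (rearrange f x) + ennreal (rearrange g x) \<partial>lborel)"
    by (simp add: nn_integral_add nn_integral_rearrange_eq[OF f] nn_integral_rearrange_eq[OF g])
  also have "\<dots> = (\<integral>\<^sup>+x. ennreal \<bar>rearrange f x - rearrange g x\<bar> + (ennreal (rearrange f x) + ennreal (rearrange g x)) \<partial>lborel)"
    by (rule nn_integral_add[symmetric]) auto
  also have "\<dots> \<le> (\<integral>\<^sup>+x. 2 * ennreal (rearrange m x) \<partial>lborel)"
  proof (intro nn_integral_mono)
    fix x
    have "\<bar>rearrange f x - rearrange g x\<bar> + (rearrange f x + rearrange g x) \<le> 2 * rearrange m x"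
      using fm[of x] gm[of x] by linarith
    from ennreal_leI[OF this]
    show "ennreal \<bar>rearrange f x - rearrange g x\<bar> + (ennreal (rearrange f x) + ennreal (rearrange g x)) \<le> 2 * ennreal (rearrange m x)"
      using rearrange_eq_emeasure(2)[OF f, of x] rearrange_eq_emeasure(2)[OF g, of x] rearrange_eq_emeasure(2)[OF m, of x]
      by (simp add: ennreal_mult)
  qed
  also have "\<dots> = (\<integral>\<^sup>+x. 2 * ennreal (m x) \<partial>lborel)"
    by (simp add: nn_integral_cmult nn_integral_rearrange_eq[OF m])
  also have "\<dots> = (\<integral>\<^sup>+x. ennreal \<bar>f x - g x\<bar> + (ennreal (f x) + ennreal (g x)) \<partial>lborel)"
  proof (intro nn_integral_cong)
    fix x
    have *: "2 * m x = \<bar>f x - g x\<bar> + (f x + g x)" by (auto simp: m_def max_def)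
    have "2 * ennreal (m x) = ennreal (2 * m x)" using bounded_densityD(2)[OF m, of x] by (simp add: ennreal_mult)
    then show "2 * ennreal (m x) = ennreal \<bar>f x - g x\<bar> + (ennreal (f x) + ennreal (g x))"
      unfolding * using bounded_densityD(2)[OF f, of x] bounded_densityD(2)[OF g, of x] by simp
  qed
  also have "\<dots> = (\<integral>\<^sup>+x. ennreal \<bar>f x - g x\<bar> \<partial>lborel) + (\<integral>\<^sup>+x. ennreal (f x) + ennreal (g x) \<partial>lborel)"
    by (rule nn_integral_add) auto
  finally have "a + c \<le> b + c" if "c = (\<integral>\<^sup>+x. ennreal (f x) + ennreal (g x) \<partial>lborel)"
    "a = (\<integral>\<^sup>+x. ennreal \<bar>rearrange f x - rearrange g x\<bar> \<partial>lborel)" "b = (\<integral>\<^sup>+x. ennreal \<bar>f x - g x\<bar> \<partial>lborel)" for a b c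
    using that by simp
  moreover have "a \<le> b" if "a + c \<le> b + c" "c < \<infinity>" for a b c :: ennreal
    using that ennreal_add_left_cancel_le[of c a b] by (simp only: add.commute[of _ c]) auto
  ultimately show ?thesis using fin by blast
qed

section \<open>The Riesz inequality, by approximation with continuous densities\<close>

lemma uniformly_continuous_compact_support:
  fixes f :: "'a::euclidean_space \<Rightarrow> real"
  assumes f: "continuous_on UNIV f" and R: "\<And>x. R < norm x \<Longrightarrow> f x = 0"
  shows "uniformly_continuous_on UNIV f"
proof -
  have uc: "uniformly_continuous_on (cball 0 (R + 1)) f"
    using f by (intro compact_uniformly_continuous) (auto intro: continuous_on_subset)
  show ?thesis
    unfolding uniformly_continuous_on_def
  proof (intro allI impI)
    fix e :: real assume "e > 0"
    then obtain d where d: "d > 0"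
      "\<And>x y. \<lbrakk>x \<in> cball 0 (R + 1); y \<in> cball 0 (R + 1); dist y x < d\<rbrakk> \<Longrightarrow> dist (f y) (f x) < e"
      using uc unfolding uniformly_continuous_on_def by metis
    have "dist (f y) (f x) < e" if "dist y x < min d 1" for x y
    proof (cases "x \<in> cball 0 (R + 1) \<and> y \<in> cball 0 (R + 1)")
      case False
      have "norm x \<le> norm y + dist y x" "norm y \<le> norm x + dist y x"
        using norm_triangle_ineq4[of y "y - x"] norm_triangle_ineq[of x "y - x"] by (simp_all add: dist_norm)
      then have "f x = 0" "f y = 0" using False that by (auto intro!: R)
      then show ?thesis using \<open>e > 0\<close> by simp
    qed (use d that in auto)
    then show "\<exists>d>0. \<forall>x\<in>UNIV. \<forall>x'\<in>UNIV. dist x' x < d \<longrightarrow> dist (f x') (f x) < e"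
      using d(1) by (intro exI[of _ "min d 1"]) auto
  qed
qed

lemma nn_energy_mono:
  assumes "\<And>x. f x \<le> g x"
  shows "nn_energy K f \<le> nn_energy K g"
  unfolding nn_energy_def
  by (intro nn_integral_mono mult_right_mono[OF mult_mono]) (simp_all add: ennreal_leI assms)

text \<open>If \<open>G x > h\<close>, continuity gives \<open>G > h\<close> at a point slightly
  farther out, hence on the whole open ball up to that point. So the superlevel set has strictly
  more volume than the ball of radius \<open>norm x\<close>, which is the strict inequality in the
  formula for the rearrangement; integration over \<open>h\<close> concludes.\<close>

lemma le_rearrange:
  fixes G f :: "'a::euclidean_space \<Rightarrow> real"
  assumes f: "bounded_density B R f" and G: "continuous_on UNIV G" "\<And>x. 0 \<le> G x"
    and dec: "\<And>x y. norm x < norm y \<Longrightarrow> G y \<le> G x"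
    and le: "\<And>h. h > 0 \<Longrightarrow> emeasure lborel {x. G x > h} \<le> emeasure lborel {x. f x > h}"
  shows "G x \<le> rearrange f x"
proof -
  let ?V = "unit_ball_vol DIM('a)" and ?n = "DIM('a)"
  have "ennreal (?V * norm x ^ ?n) < emeasure lborel {x. f x > h}" if h: "0 < h" "h < G x" for h
  proof -
    have "open {x. G x > h}" by (rule open_Collect_less[OF continuous_on_const G(1)])
    then obtain d where d: "d > 0" "ball x d \<subseteq> {x. G x > h}" using h by (metis openE mem_Collect_eq)
    \<comment> \<open>A unit vector that points outwards from \<open>x\<close>; at the origin every
      direction does, and some basis vector is taken.\<close>
    obtain u :: 'a where u: "norm u = 1" "norm (x + (d / 2) *\<^sub>R u) = norm x + d / 2"
    proof (cases "x = 0")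
      case True
      then show ?thesis using that[of "SOME b. b \<in> Basis"] d(1) by (simp add: SOME_Basis norm_Basis)
    next
      case False
      have "norm x *\<^sub>R sgn x = x" using False by (simp add: sgn_div_norm)
      then have "x + (d / 2) *\<^sub>R sgn x = (norm x + d / 2) *\<^sub>R sgn x"
        by (simp add: scaleR_add_left)
      then have "norm (x + (d / 2) *\<^sub>R sgn x) = norm x + d / 2"
        using False d(1) by (simp add: norm_sgn)
      then show ?thesis using that[of "sgn x"] False by (simp add: norm_sgn)
    qed
    define y where "y = x + (d / 2) *\<^sub>R u"
    have "y \<in> ball x d" using d(1) u(1) by (simp add: y_def dist_norm)
    then have y: "G y > h" using d(2) by auto
    have ny: "norm y > norm x" using u(2) d(1) by (simp add: y_def)
    have "ball 0 (norm y) \<subseteq> {x. G x > h}" using dec y by (force simp: less_le_trans)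
    then have "emeasure lborel (ball (0::'a) (norm y)) \<le> emeasure lborel {x. G x > h}"
      using \<open>open {x. G x > h}\<close> by (intro emeasure_mono) auto
    also have "\<dots> \<le> emeasure lborel {x. f x > h}" using le h by simp
    finally have 1: "emeasure lborel (ball (0::'a) (norm y)) \<le> emeasure lborel {x. f x > h}" .
    have "?V * norm x ^ ?n < ?V * norm y ^ ?n"
      using ny by (intro mult_strict_left_mono power_strict_mono) auto
    then have "ennreal (?V * norm x ^ ?n) < emeasure lborel (ball (0::'a) (norm y))"
      by (simp add: emeasure_ball ennreal_less_iff)
    then show ?thesis using 1 by (rule less_le_trans)
  qed
  then have "ennreal (G x) \<le> ennreal (rearrange f x)"
    unfolding rearrange_eq_emeasure(1)[OF f] layer_cake[OF G(2)[of x]]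
    by (intro nn_integral_mono) (auto simp: indicator_def)
  then show ?thesis using rearrange_eq_emeasure(2)[OF f] by simp
qed

text \<open>For continuous \<open>p\<close> the symmetric decreasing member of the class lies below
  the rearrangement of \<open>p\<close>, and the energy is monotone. A general \<open>f\<close> is
  an \<open>L^1\<close> limit of such functions, and both energy and rearrangement are continuous in
  \<open>L^1\<close> under a common bound.\<close>

theorem riesz_rearrangement:
  fixes f :: "'a::euclidean_space \<Rightarrow> real"
  assumes f: "bounded_density B R f" and R: "R \<ge> 0"
    and K [measurable]: "K \<in> borel_measurable borel" and Kmono: "\<And>x y. norm x \<le> norm y \<Longrightarrow> K y \<le> K x"
    and Kfin: "(\<integral>\<^sup>+x. K x \<partial>lborel) < \<infinity>"
  shows "nn_energy K f \<le> nn_energy K (rearrange f)"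
proof -
  have cont: "nn_energy K p \<le> nn_energy K (rearrange p)"
    if p: "bounded_density B S p" and S: "S \<ge> 0" and pc: "continuous_on UNIV p" for p :: "'a \<Rightarrow> real" and S
  proof -
    have uc: "uniformly_continuous_on UNIV p"
      using uniformly_continuous_compact_support[OF pc] bounded_densityD(4)[OF p] by blast
    obtain G where G: "G \<in> riesz_class K S B p" "\<And>x y. norm x < norm y \<Longrightarrow> G y \<le> G x"
      using riesz_class_symmetric_decreasing[OF uc bounded_densityD(2,3,4)[OF p] S K Kmono Kfin] by blast
    have "nn_energy K p \<le> nn_energy K G" using G(1) by (simp add: riesz_class_def)
    also have "\<dots> \<le> nn_energy K (rearrange p)"
      using G(1) by (intro nn_energy_mono le_rearrange[OF p riesz_class_continuous[OF G(1) uc] _ G(2)])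
        (auto simp: riesz_class_def)
    finally show ?thesis .
  qed
  note [measurable] = bounded_densityD(1)[OF f]
  have B: "0 \<le> B" using bounded_densityD(2,3)[OF f] order.trans by blast
  have fR: "bounded_density B (R + 1) f" using f by (auto simp: bounded_density_def)
  \<comment> \<open>This notion of measurability supplies continuous functions that converge to
    \<open>f\<close> off a negligible set.\<close>
  have "f measurable_on UNIV"
    by (intro lebesgue_measurable_imp_measurable_on) (auto intro: measurable_completion)
  then obtain N g where N: "negligible N" "\<And>n::nat. continuous_on UNIV (g n)" "\<And>x. x \<notin> N \<Longrightarrow> (\<lambda>n. g n x) \<longlonglongrightarrow> f x"
    unfolding measurable_on_def by auto
  \<comment> \<open>Clamping to \<open>[0, B]\<close> restores the bounds; the cutoff is 1 on the
    ball of radius \<open>R\<close>, where \<open>f\<close> lives, and 0 beyond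
    \<open>R + 1\<close>. Neither changes the limit.\<close>
  define p where "p n x = max 0 (min B (g n x)) * max 0 (min 1 (R + 1 - norm x))" for n x
  have pc: "continuous_on UNIV (p n)" for n
    unfolding p_def by (intro continuous_intros N)
  have p: "bounded_density B (R + 1) (p n)" for n
  proof -
    have "p n x \<le> B * 1" for x unfolding p_def using B by (intro mult_mono) auto
    then show ?thesis
      unfolding bounded_density_def using borel_measurable_continuous_onI[OF pc] B by (auto simp: p_def)
  qed
  note [measurable] = bounded_densityD(1)[OF p]
  have plim: "(\<lambda>n. p n x) \<longlonglongrightarrow> f x" if "x \<notin> N" for x
  proof -
    have "(\<lambda>n. p n x) \<longlonglongrightarrow> max 0 (min B (f x)) * max 0 (min 1 (R + 1 - norm x))"
      unfolding p_def by (intro tendsto_intros N(3) that)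
    also have "max 0 (min B (f x)) * max 0 (min 1 (R + 1 - norm x)) = f x"
      using bounded_densityD(2,3,4)[OF f, of x] by (cases "R < norm x") auto
    finally show ?thesis .
  qed
  define d where "d n = (\<integral>\<^sup>+x. ennreal \<bar>p n x - f x\<bar> \<partial>lborel)" for n
  have "d \<longlonglongrightarrow> (\<integral>\<^sup>+x. 0 \<partial>(lborel :: 'a measure))"
    unfolding d_def
  proof (rule nn_integral_dominated_convergence[where w="\<lambda>x. ennreal B * indicator (cball 0 (R + 1) :: 'a set) x"])
    show "AE x in lborel. ennreal \<bar>p n x - f x\<bar> \<le> ennreal B * indicator (cball 0 (R + 1)) x" for n
    proof (rule AE_I2)
      fix x
      show "ennreal \<bar>p n x - f x\<bar> \<le> ennreal B * indicator (cball 0 (R + 1)) x"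
        using bounded_densityD(2,3,4)[OF fR, of x] bounded_densityD(2,3,4)[OF p[of n], of x]
        by (cases "R + 1 < norm x") (auto simp: indicator_def intro!: ennreal_leI)
    qed
    show "(\<integral>\<^sup>+x. ennreal B * indicator (cball 0 (R + 1) :: 'a set) x \<partial>lborel) < \<infinity>"
      using emeasure_lborel_cball_finite[of "0 :: 'a" "R + 1"]
      by (subst nn_integral_cmult_indicator) (auto simp: ennreal_mult_less_top)
    have "AE x in lebesgue. x \<notin> N" using N(1) by (auto simp: negligible_iff_null_sets intro: AE_not_in)
    then have "AE x in lborel. x \<notin> N" by (simp add: AE_completion_iff)
    then show "AE x in lborel. (\<lambda>n. ennreal \<bar>p n x - f x\<bar>) \<longlonglongrightarrow> 0"
    proof eventually_elim
      case (elim x)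
      have "(\<lambda>n. ennreal \<bar>p n x - f x\<bar>) \<longlonglongrightarrow> ennreal \<bar>f x - f x\<bar>"
        by (intro tendsto_ennrealI tendsto_intros plim elim)
      then show ?case by simp
    qed
    show "(\<lambda>x. ennreal B * indicator (cball 0 (R + 1) :: 'a set) x) \<in> borel_measurable lborel"
    proof -
      have [measurable]: "(\<lambda>x. indicator (cball 0 (R + 1) :: 'a set) x :: ennreal) \<in> borel_measurable borel"
        by (intro borel_measurable_indicator) simp
      show ?thesis by measurable
    qed
  qed auto
  then have d: "d \<longlonglongrightarrow> 0" by simp
  define C where "C = 2 * ennreal B * (\<integral>\<^sup>+x. K x \<partial>lborel)"
  have C: "C < \<infinity>" using Kfin by (simp add: C_def ennreal_mult_less_top)
  have le: "nn_energy K f \<le> nn_energy K (rearrange f) + (C * d n + C * d n)" for n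
  proof -
    note rr = bounded_density_rearrange[OF p[of n]] bounded_density_rearrange[OF fR]
    have R1: "R + 1 \<ge> 0" using R by simp
    have "nn_energy K f \<le> nn_energy K (p n) + C * (\<integral>\<^sup>+x. ennreal \<bar>f x - p n x\<bar> \<partial>lborel)"
      unfolding C_def using bounded_densityD(1,2,3)[OF f] bounded_densityD(1,2,3)[OF p[of n]]
      by (intro nn_energy_le_add) auto
    also have "(\<integral>\<^sup>+x. ennreal \<bar>f x - p n x\<bar> \<partial>lborel) = d n"
      by (simp add: d_def abs_minus_commute)
    also have "nn_energy K (p n) \<le> nn_energy K (rearrange (p n))" by (rule cont[OF p R1 pc])
    also have "\<dots> \<le> nn_energy K (rearrange f) + C * (\<integral>\<^sup>+x. ennreal \<bar>rearrange (p n) x - rearrange f x\<bar> \<partial>lborel)"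
      unfolding C_def using bounded_densityD(1,2,3)[OF rr(1)[OF R1]] bounded_densityD(1,2,3)[OF rr(2)[OF R1]]
      by (intro nn_energy_le_add) auto
    also have "\<dots> \<le> nn_energy K (rearrange f) + C * d n"
      unfolding d_def by (intro add_left_mono mult_left_mono rearrange_contraction[OF p fR]) auto
    finally show ?thesis by (simp add: add.assoc add_right_mono)
  qed
  have "(\<lambda>n. nn_energy K (rearrange f) + (C * d n + C * d n)) \<longlonglongrightarrow> nn_energy K (rearrange f) + (C * 0 + C * 0)"
    using C by (intro tendsto_add tendsto_const ennreal_tendsto_cmult d) auto
  then show ?thesis using le by (intro LIMSEQ_le_const) auto
qed


section \<open>Quantile transport to the marginals of a ball\<close>

text \<open>The generalized inverse of the distribution function. Outside the open unit interval the
  infimum may be over a set that is empty or unbounded below, and 0 is put instead.\<close>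

definition quantile :: "real measure \<Rightarrow> real \<Rightarrow> real" where
  "quantile N u = (if 0 < u \<and> u < 1 then Inf {x. u \<le> cdf N x} else 0)"

abbreviation unif :: "real measure" where
  "unif \<equiv> uniform_measure lborel {0<..<1}"

lemma prob_space_unif: "prob_space unif"
  by (rule prob_space_uniform_measure) auto

lemma AE_unif: "AE u in unif. 0 < u \<and> u < 1"
  by (rule AE_uniform_measureI) auto

lemma quantile_le_iff:
  assumes "real_distribution N" "0 < u" "u < 1"
  shows "quantile N u \<le> x \<longleftrightarrow> u \<le> cdf N x"
proof -
  interpret cdf_distribution N using assms(1) by (simp add: cdf_distribution_def)
  show ?thesis using pseudoinverse[of u x] assms by (simp add: quantile_def)
qed

lemma borel_measurable_quantile [measurable]:
  assumes "real_distribution N"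
  shows "quantile N \<in> borel_measurable borel"
proof -
  interpret cdf_distribution N using assms by (simp add: cdf_distribution_def)
  have [measurable]: "cdf N \<in> borel_measurable borel" by (rule measurable_C)
  have "(\<lambda>u. if 0 < u \<and> u < 1 then Inf {x. u \<le> cdf N x} else 0) \<in> borel_measurable borel"
    unfolding borel_measurable_iff_le
  proof
    fix x
    have "{u. (if 0 < u \<and> u < 1 then Inf {x. u \<le> cdf N x} else 0) \<le> x} =
      {u. 0 < u \<and> u < 1 \<and> u \<le> cdf N x \<or> \<not> (0 < u \<and> u < 1) \<and> 0 \<le> x}"
      using pseudoinverse[of _ x] by auto
    also have "\<dots> \<in> sets borel" by measurable
    finally show "{w \<in> space borel. (if 0 < w \<and> w < 1 then Inf {x. w \<le> cdf N x} else 0) \<le> x} \<in> sets borel"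
      by simp
  qed
  then show ?thesis by (simp add: quantile_def[abs_def])
qed

lemma distr_quantile:
  assumes N: "real_distribution N"
  shows "distr unif borel (quantile N) = N"
proof -
  interpret cdf_distribution N using assms by (simp add: cdf_distribution_def)
  note [measurable] = borel_measurable_quantile[OF N]
  have "distr (restrict_space lborel {0<..<1}) borel (quantile N) = distr unif borel (quantile N)"
  proof (rule measure_eqI)
    fix A assume "A \<in> sets (distr (restrict_space lborel {0<..<1}) borel (quantile N))"
    then have [measurable]: "A \<in> sets borel" by simp
    have m: "quantile N -` A \<in> sets borel" using measurable_sets[OF borel_measurable_quantile[OF N], of A] by simp
    have "quantile N \<in> restrict_space lborel {0<..<1} \<rightarrow>\<^sub>M borel"
      by (rule measurable_restrict_space1) measurable
    then show "emeasure (distr (restrict_space lborel {0<..<1}) borel (quantile N)) A = emeasure (distr unif borel (quantile N)) A"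
      using m by (simp add: emeasure_distr emeasure_restrict_space space_restrict_space emeasure_uniform_measure Int_commute divide_ennreal_def)
  qed simp
  moreover have "distr (restrict_space lborel {0<..<1}) borel (quantile N) = distr (restrict_space lborel {0<..<1}) borel I"
    by (rule distr_cong) (auto simp: quantile_def space_restrict_space)
  ultimately show ?thesis using distr_I_eq_M by simp
qed

lemma nn_integral_quantile:
  assumes N: "real_distribution N" and [measurable]: "f \<in> borel_measurable borel"
  shows "(\<integral>\<^sup>+u. f (quantile N u) \<partial>unif) = (\<integral>\<^sup>+x. f x \<partial>N)"
  by (subst (2) distr_quantile[OF N, symmetric], subst nn_integral_distr)
    (use borel_measurable_quantile[OF N] in auto)

lemma integral_quantile:
  fixes f :: "real \<Rightarrow> real"
  assumes N: "real_distribution N" and [measurable]: "f \<in> borel_measurable borel"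
  shows "(\<integral>u. f (quantile N u) \<partial>unif) = (\<integral>x. f x \<partial>N)"
  by (subst (2) distr_quantile[OF N, symmetric], subst integral_distr)
    (use borel_measurable_quantile[OF N] in auto)

lemma AE_quantile:
  assumes N: "real_distribution N" and "AE x in N. P x"
  shows "AE u in unif. P (quantile N u)"
  using assms(2) by (subst (asm) distr_quantile[OF N, symmetric], intro AE_distrD[of "quantile N" unif borel])
    (use borel_measurable_quantile[OF N] in auto)

text \<open>Without atoms the distribution function is continuous, so it cannot jump over
  \<open>u\<close> at the quantile. This makes \<open>u\<close> recoverable from the transported
  point.\<close>

lemma cdf_quantile:
  assumes N: "real_distribution N" "\<And>x. measure N {x} = 0" and u: "0 < u" "u < 1"
  shows "cdf N (quantile N u) = u"
proof -
  interpret real_distribution N by fact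
  let ?q = "quantile N u"
  have "u \<le> cdf N ?q" using quantile_le_iff[OF N(1) u, of ?q] by simp
  moreover have "cdf N ?q \<le> u"
  proof (rule tendsto_upperbound)
    show "(cdf N \<longlongrightarrow> cdf N ?q) (at_left ?q)"
      using isCont_cdf[of ?q] N(2) by (simp add: isCont_def filterlim_at_split)
    show "\<forall>\<^sub>F x in at_left ?q. cdf N x \<le> u"
      using quantile_le_iff[OF N(1) u] by (auto simp: eventually_at_filter not_le[symmetric])
  qed simp
  ultimately show ?thesis by simp
qed

text \<open>The law of one coordinate of a uniform point of the unit ball in dimension
  \<open>m + 1\<close>: the slice at height \<open>b\<close> is an \<open>m\<close>-dimensional ball
  of radius \<open>sqrt (1 - b\<^sup>2)\<close>, and the Beta value is the quotient of the volumes
  of the unit balls in dimensions \<open>m + 1\<close> and \<open>m\<close>.\<close>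

definition cap_measure :: "nat \<Rightarrow> real measure" where
  "cap_measure m = density lborel (\<lambda>b. ennreal (indicator {-1..1} b * sqrt (1 - b\<^sup>2) ^ m / Beta (1 / 2) (real m / 2 + 1)))"

lemma Beta_pos: "Beta (1 / 2) (real m / 2 + 1) > 0"
  by (auto simp: Beta_def intro!: divide_pos_pos mult_pos_pos Gamma_real_pos add_nonneg_pos)

lemma real_distribution_cap: "real_distribution (cap_measure m)"
proof -
  have "emeasure (cap_measure m) UNIV =
      (\<integral>\<^sup>+b. ennreal (indicator {-1..1} b * sqrt (1 - b\<^sup>2) ^ m) / ennreal (Beta (1 / 2) (real m / 2 + 1)) \<partial>lborel)"
    unfolding cap_measure_def
    by (subst emeasure_density)
      (auto intro!: nn_integral_cong divide_ennreal[symmetric] Beta_pos simp: indicator_def abs_square_le_1 abs_le_iff)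
  also have "\<dots> = (\<integral>\<^sup>+b. ennreal (indicator {-1..1} b * sqrt (1 - b\<^sup>2) ^ m) \<partial>lborel) / ennreal (Beta (1 / 2) (real m / 2 + 1))"
    by (rule nn_integral_divide) measurable
  also have "\<dots> = 1"
    unfolding emeasure_cball_aux_integral using Beta_pos[of m] by (subst divide_ennreal) auto
  finally have "emeasure (cap_measure m) UNIV = 1" .
  then have "prob_space (cap_measure m)" by (intro prob_spaceI) (simp add: cap_measure_def)
  then show ?thesis by (simp add: real_distribution_def real_distribution_axioms_def cap_measure_def)
qed

lemma cap_measure_singleton: "measure (cap_measure m) {x} = 0"
proof -
  have "emeasure (cap_measure m) {x} = 0"
    unfolding cap_measure_def by (subst emeasure_density) (auto simp: nn_integral_0_iff_AE intro!: AE_I'[of "{x}"])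
  then show ?thesis by (simp add: measure_def)
qed

abbreviation cap_quantile :: "nat \<Rightarrow> real \<Rightarrow> real" where
  "cap_quantile m \<equiv> quantile (cap_measure m)"

lemma AE_cap_measure: "AE b in cap_measure m. -1 < b \<and> b < 1"
proof -
  have "AE b in lborel. 0 < ennreal (indicator {-1..1} b * sqrt (1 - b\<^sup>2) ^ m / Beta (1 / 2) (real m / 2 + 1)) \<longrightarrow> -1 < b \<and> b < 1"
    using AE_lborel_singleton[of "1::real"] AE_lborel_singleton[of "-1::real"]
  proof eventually_elim
    case (elim b)
    then show ?case by (cases "b \<in> {-1..1}") auto
  qed
  then show ?thesis
    unfolding cap_measure_def by (subst AE_density) auto
qed

lemma cap_quantile_bounds:
  assumes "0 < u" "u < 1" shows "-1 \<le> cap_quantile m u" "cap_quantile m u \<le> 1"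
proof -
  interpret real_distribution "cap_measure m" by (rule real_distribution_cap)
  have "AE b in cap_measure m. b \<in> {..1} \<longleftrightarrow> b \<in> UNIV"
    using AE_cap_measure[of m] by eventually_elim auto
  then have "prob {..1} = prob UNIV" by (rule finite_measure_eq_AE) auto
  then have "cdf (cap_measure m) 1 = 1" using prob_space by (simp add: cdf_def)
  then show "cap_quantile m u \<le> 1" using quantile_le_iff[OF real_distribution_cap assms, of m 1] assms by simp
  have "cdf (cap_measure m) x = 0" if "x < -1" for x
  proof -
    have "AE b in cap_measure m. b \<in> {..x} \<longleftrightarrow> b \<in> {}"
      using AE_cap_measure[of m] by eventually_elim (use that in auto)
    then have "prob {..x} = prob {}" by (rule finite_measure_eq_AE) auto
    then show ?thesis by (simp add: cdf_def)
  qed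
  then have "\<not> cap_quantile m u \<le> x" if "x < -1" for x
    using that quantile_le_iff[OF real_distribution_cap assms, of m x] assms by simp
  then show "-1 \<le> cap_quantile m u" by (meson dense not_le order.strict_trans less_imp_le)
qed

lemma AE_cap_quantile: "AE u in unif. -1 < cap_quantile m u \<and> cap_quantile m u < 1"
  by (rule AE_quantile[OF real_distribution_cap AE_cap_measure])

text \<open>The weight times \<open>b\<close> is an exact derivative, so the first moment of a tail
  is a power of the slice radius at its edge. This explicit value replaces the integration by parts
  in the transport estimate.\<close>

lemma integral_cap_tail:
  assumes "-1 \<le> x" "x \<le> 1"
  shows "(\<integral>b. b * indicator {x<..} b \<partial>cap_measure m) = sqrt (1 - x\<^sup>2) ^ (m + 2) / (real (m + 2) * Beta (1 / 2) (real m / 2 + 1))"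
proof -
  let ?B = "Beta (1 / 2) (real m / 2 + 1)"
  let ?F = "\<lambda>b. - (sqrt (1 - b\<^sup>2) ^ (m + 2) / (real (m + 2) * ?B))"
  let ?f = "\<lambda>b. b * sqrt (1 - b\<^sup>2) ^ m / ?B"
  \<comment> \<open>The antiderivative is continuous on the closed interval but differentiated only
    in the interior, since the square root has no derivative at 0.\<close>
  have F: "(?f has_integral (?F 1 - ?F x)) {x..1}"
  proof (rule fundamental_theorem_of_calculus_interior)
    show "x \<le> 1" by fact
    show "continuous_on {x..1} ?F" by (intro continuous_intros) (simp add: less_imp_neq[OF Beta_pos, symmetric])
    fix b assume b: "b \<in> {x<..<1}"
    then have p: "1 - b\<^sup>2 > 0" using assms by (auto simp: abs_square_less_1 abs_less_iff)
    have B: "?B \<noteq> 0" using Beta_pos[of m] by simp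
    have "(?F has_real_derivative - (real (m + 2) * sqrt (1 - b\<^sup>2) ^ (m + 1) * (inverse (sqrt (1 - b\<^sup>2)) / 2 * (- (2 * b))) / (real (m + 2) * ?B))) (at b)"
      using p B by (auto intro!: derivative_eq_intros simp: power_Suc[symmetric] simp del: power_Suc)
    also have "- (real (m + 2) * sqrt (1 - b\<^sup>2) ^ (m + 1) * (inverse (sqrt (1 - b\<^sup>2)) / 2 * (- (2 * b))) / (real (m + 2) * ?B)) = ?f b"
    proof -
      have "- (k * r ^ (m + 1) * (inverse r / 2 * (- (2 * b))) / (k * \<beta>)) = b * r ^ m / \<beta>"
        if "k > 0" "r > 0" "\<beta> \<noteq> 0" for k r \<beta> :: real
        using that by (simp add: field_simps)
      then show ?thesis using p B by simp
    qed
    finally show "(?F has_vector_derivative ?f b) (at b)" by (simp add: has_real_derivative_iff_has_vector_derivative)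
  qed
  have "(\<integral>b. b * indicator {x<..} b \<partial>cap_measure m) =
    (\<integral>b. (indicator {-1..1} b * sqrt (1 - b\<^sup>2) ^ m / ?B) * (b * indicator {x<..} b) \<partial>lborel)"
    unfolding cap_measure_def using Beta_pos[of m]
    by (subst integral_density) (auto intro!: AE_I2 divide_nonneg_pos simp: indicator_def abs_square_le_1 abs_le_iff)
  also have "\<dots> = (\<integral>b. indicator {x..1} b * ?f b \<partial>lborel)"
    using AE_lborel_singleton[of x] assms by (intro integral_cong_AE) (auto elim!: eventually_mono simp: indicator_def)
  also have "\<dots> = set_lebesgue_integral lborel {x..1} ?f" by (simp add: set_lebesgue_integral_def)
  also have "\<dots> = integral {x..1} ?f"
    by (intro set_borel_integral_eq_integral borel_integrable_atLeastAtMost')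
      (intro continuous_intros, simp add: less_imp_neq[OF Beta_pos, symmetric])
  also have "\<dots> = ?F 1 - ?F x" using F by (rule integral_unique)
  finally show ?thesis by simp
qed

text \<open>The factor \<open>1 - b\<^sup>2\<close> raises the exponent by two, so the integral is
  the quotient of the normalizing constants for \<open>m + 2\<close> and \<open>m\<close>, evaluated
  by the functional equation of Gamma.\<close>

lemma integral_cap_height_sq:
  "(\<integral>b. 1 - b\<^sup>2 \<partial>cap_measure m) = real (m + 2) / real (m + 3)"
proof -
  let ?B = "\<lambda>m. Beta (1 / 2) (real m / 2 + 1)"
  have "(\<integral>b. 1 - b\<^sup>2 \<partial>cap_measure m) = (\<integral>b. (indicator {-1..1} b * sqrt (1 - b\<^sup>2) ^ m / ?B m) * (1 - b\<^sup>2) \<partial>lborel)"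
    unfolding cap_measure_def using Beta_pos[of m]
    by (subst integral_density) (auto intro!: AE_I2 divide_nonneg_pos simp: indicator_def abs_square_le_1 abs_le_iff)
  also have "\<dots> = (\<integral>b. (indicator {-1..1} b * sqrt (1 - b\<^sup>2) ^ (m + 2)) / ?B m \<partial>lborel)"
    by (intro Bochner_Integration.integral_cong) (auto simp: indicator_def power_add abs_square_le_1 abs_le_iff)
  also have "\<dots> = (\<integral>b. (indicator {-1..1} b * sqrt (1 - b\<^sup>2) ^ (m + 2)) \<partial>lborel) / ?B m" by simp
  also have "(\<integral>b. (indicator {-1..1} b * sqrt (1 - b\<^sup>2) ^ (m + 2)) \<partial>lborel) = ?B (m + 2)"
  proof (subst integral_eq_nn_integral)
    show "AE b in lborel. 0 \<le> indicator {-1..1} b * sqrt (1 - b\<^sup>2) ^ (m + 2)"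
      by (auto simp: indicator_def abs_square_le_1 abs_le_iff)
    show "enn2real (\<integral>\<^sup>+b. ennreal (indicator {-1..1} b * sqrt (1 - b\<^sup>2) ^ (m + 2)) \<partial>lborel) = ?B (m + 2)"
      unfolding emeasure_cball_aux_integral using Beta_pos[of "m + 2"] by simp
  qed measurable
  also have "?B (m + 2) / ?B m = real (m + 2) / real (m + 3)"
  proof -
    have e: "real (m + 2) / 2 + 1 = (real m / 2 + 1) + 1" by (simp add: field_simps)
    have "Gamma (real m / 2 + 1 + 1) = (real m / 2 + 1) * Gamma (real m / 2 + 1)"
      by (intro Gamma_plus1) (auto simp: nonpos_Ints_def)
    moreover have "Gamma (1 / 2 + (real m / 2 + 1) + 1) = (1 / 2 + (real m / 2 + 1)) * Gamma (1 / 2 + (real m / 2 + 1))"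
      by (intro Gamma_plus1) (auto simp: nonpos_Ints_def)
    moreover have "Gamma (real m / 2 + 1) > 0" "Gamma (1 / 2 + (real m / 2 + 1)) > 0" "Gamma (1/2 :: real) > 0"
      by (auto intro!: Gamma_real_pos)
    moreover have "g * (x * a) / (y * b) / (g * a / b) = x / y"
      if "g > 0" "a > 0" "b > 0" "y > 0" for g a b x y :: real
      using that by (simp add: field_simps)
    moreover have "(real m / 2 + 1) / (1 / 2 + (real m / 2 + 1)) = real (m + 2) / real (m + 3)"
      by (simp add: field_simps)
    ultimately show ?thesis unfolding e Beta_def by (simp only: add.assoc[symmetric])
  qed
  finally show ?thesis .
qed

text \<open>The radius of the slice of the unit ball at the height reached by the parameter
  \<open>u\<close>; the induction is applied to this smaller ball. At \<open>u = 0\<close> and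
  \<open>u = 1\<close> the value 0 is the true one, for the slices at the poles.\<close>

definition cap_height :: "nat \<Rightarrow> real \<Rightarrow> real" where
  "cap_height m u = (if 0 < u \<and> u < 1 then sqrt (1 - (cap_quantile m u)\<^sup>2) else 0)"

lemma borel_measurable_cap_quantile [measurable]: "cap_quantile m \<in> borel_measurable borel"
  by (rule borel_measurable_quantile[OF real_distribution_cap])

lemma borel_measurable_cap_height [measurable]: "cap_height m \<in> borel_measurable borel"
  unfolding cap_height_def by measurable

lemma cap_height_bounds: "0 \<le> cap_height m u" "cap_height m u \<le> 1"
proof -
  have "(cap_quantile m u)\<^sup>2 \<le> 1" if "0 < u" "u < 1"
    using cap_quantile_bounds[OF that, of m] by (simp add: abs_square_le_1 abs_le_iff)
  then show "0 \<le> cap_height m u" "cap_height m u \<le> 1" by (auto simp: cap_height_def)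
qed

lemma abs_cap_quantile_le: "\<bar>cap_quantile m u\<bar> \<le> 1"
  using cap_quantile_bounds[of u m] by (cases "0 < u \<and> u < 1") (auto simp: quantile_def abs_le_iff)

lemma integrable_unif_bounded:
  fixes f :: "real \<Rightarrow> real"
  assumes [measurable]: "f \<in> borel_measurable borel" and "\<And>u. \<bar>f u\<bar> \<le> C"
  shows "integrable unif f"
proof -
  interpret prob_space unif by (rule prob_space_unif)
  show ?thesis by (rule integrable_const_bound[where B=C]) (use assms(2) in auto)
qed

text \<open>Tails in the parameter correspond to tails in the height because the law has no atoms.
  The endpoints of the unit interval, where the quantile has its default value, are matched by hand
  with the poles \<open>-1\<close> and \<open>1\<close>.\<close>

lemma integral_cap_quantile_tail:
  assumes u: "0 \<le> u" "u \<le> 1"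
  shows "(\<integral>w. cap_quantile m w * indicator {u<..} w \<partial>unif) =
    cap_height m u ^ (m + 2) / (real (m + 2) * Beta (1 / 2) (real m / 2 + 1))"
proof -
  let ?q = "cap_quantile m"
  note N = real_distribution_cap[of m]
  have tail: "(\<integral>w. ?q w * indicator {x<..} (?q w) \<partial>unif) = sqrt (1 - x\<^sup>2) ^ (m + 2) / (real (m + 2) * Beta (1 / 2) (real m / 2 + 1))"
    if "-1 \<le> x" "x \<le> 1" for x
    by (subst integral_quantile[OF N, of "\<lambda>b. b * indicator {x<..} b"]) (use integral_cap_tail[OF that] in auto)
  have "\<exists>x. -1 \<le> x \<and> x \<le> 1 \<and> sqrt (1 - x\<^sup>2) = cap_height m u \<and> (AE w in unif. u < w \<longleftrightarrow> x < ?q w)"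
  proof -
    consider "0 < u" "u < 1" | "u = 0" | "u = 1" using u by linarith
    then show ?thesis
    proof cases
      case 1
      have "AE b in cap_measure m. b \<noteq> ?q u"
      proof -
        interpret real_distribution "cap_measure m" by (rule N)
        show ?thesis using cap_measure_singleton[of m "?q u"]
          by (intro AE_I[of _ _ "{?q u}"]) (auto simp: emeasure_eq_measure)
      qed
      from AE_quantile[OF N this] AE_unif
      have "AE w in unif. u < w \<longleftrightarrow> ?q u < ?q w"
      proof eventually_elim
        case (elim w)
        have iff: "?q w \<le> ?q u \<longleftrightarrow> w \<le> u"
          using elim quantile_le_iff[OF N, of w "?q u"] cdf_quantile[OF N cap_measure_singleton 1] by simp
        then show ?case using elim by linarith
      qed
      then show ?thesis using 1 cap_quantile_bounds[OF 1, of m] by (intro exI[of _ "?q u"]) (auto simp: cap_height_def)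
    next
      case 2
      have "AE w in unif. u < w \<longleftrightarrow> -1 < ?q w"
        using AE_unif AE_cap_quantile[of m] by eventually_elim (use 2 in auto)
      then show ?thesis using 2 by (intro exI[of _ "-1"]) (auto simp: cap_height_def)
    next
      case 3
      have "AE w in unif. u < w \<longleftrightarrow> 1 < ?q w"
        using AE_unif AE_cap_quantile[of m] by eventually_elim (use 3 in auto)
      then show ?thesis using 3 by (intro exI[of _ "1"]) (auto simp: cap_height_def)
    qed
  qed
  then obtain x where x: "-1 \<le> x" "x \<le> 1" "sqrt (1 - x\<^sup>2) = cap_height m u" "AE w in unif. u < w \<longleftrightarrow> x < ?q w"
    by blast
  have "(\<integral>w. ?q w * indicator {u<..} w \<partial>unif) = (\<integral>w. ?q w * indicator {x<..} (?q w) \<partial>unif)"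
    using x(4) by (intro integral_cong_AE) (auto elim!: eventually_mono simp: indicator_def)
  then show ?thesis using tail[OF x(1,2)] x(3) by simp
qed

lemma integral_cap_height_unif: "(\<integral>u. (cap_height m u)\<^sup>2 \<partial>unif) = real (m + 2) / real (m + 3)"
proof -
  have "(\<integral>u. (cap_height m u)\<^sup>2 \<partial>unif) = (\<integral>u. 1 - (cap_quantile m u)\<^sup>2 \<partial>unif)"
  proof (rule integral_cong_AE)
    show "AE u in unif. (cap_height m u)\<^sup>2 = 1 - (cap_quantile m u)\<^sup>2"
      using AE_unif
    proof eventually_elim
      case (elim u)
      have "(cap_quantile m u)\<^sup>2 \<le> 1" using abs_cap_quantile_le[of m u] by (simp add: abs_square_le_1)
      then show ?case using elim by (simp add: cap_height_def)
    qed
  qed measurable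
  also have "\<dots> = (\<integral>b. 1 - b\<^sup>2 \<partial>cap_measure m)"
    by (rule integral_quantile[OF real_distribution_cap]) measurable
  finally show ?thesis by (simp add: integral_cap_height_sq)
qed

section \<open>The one-dimensional transport estimate\<close>

lemma AE_abs_quantile_le:
  fixes g :: "real \<Rightarrow> real"
  assumes N: "N = density lborel (\<lambda>a. ennreal (g a))" "real_distribution N"
    and [measurable]: "g \<in> borel_measurable borel" and g: "\<And>a. M < \<bar>a\<bar> \<Longrightarrow> g a = 0"
  shows "AE u in unif. \<bar>quantile N u\<bar> \<le> M"
proof (rule AE_quantile[OF N(2)])
  have "AE x in lborel. 0 < ennreal (g x) \<longrightarrow> \<bar>x\<bar> \<le> M" using g by (intro AE_I2) (force simp: not_le[symmetric])
  then show "AE x in N. \<bar>x\<bar> \<le> M" unfolding N(1) by (subst AE_density) auto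
qed

lemma integrable_quantile_mult_cap:
  assumes N: "real_distribution N" and aM: "AE u in unif. \<bar>quantile N u\<bar> \<le> M"
  shows "integrable unif (\<lambda>u. quantile N u * cap_quantile m u)"
proof -
  interpret prob_space unif by (rule prob_space_unif)
  note [measurable] = borel_measurable_quantile[OF N]
  show ?thesis
  proof (rule integrable_const_bound[where B=M])
    show "AE u in unif. norm (quantile N u * cap_quantile m u) \<le> M"
      using aM
    proof eventually_elim
      case (elim u)
      then have M: "0 \<le> M" by (meson abs_ge_zero order.trans)
      have "\<bar>quantile N u\<bar> * \<bar>cap_quantile m u\<bar> \<le> M * 1"
        using elim abs_cap_quantile_le[of m u] M by (intro mult_mono) auto
      then show ?case by (simp add: abs_mult)
    qed
  qed measurable
qed

text \<open>Weighted AM-GM for \<open>m\<close> copies of \<open>x ^ (m + 1)\<close> and one of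
  \<open>y ^ (m + 1)\<close>: it is Bernoulli's inequality for \<open>y / x\<close>, multiplied by
  \<open>x ^ (m + 1)\<close>.\<close>

lemma bernoulli_two_variables:
  fixes x y :: real
  assumes "0 \<le> x" "0 \<le> y"
  shows "real (m + 1) * x ^ m * y \<le> y ^ (m + 1) + real m * x ^ (m + 1)"
proof (cases "x = 0")
  case True
  then show ?thesis using assms by (cases m) auto
next
  case False
  then have x: "x > 0" using assms by simp
  have "1 + real (m + 1) * (y / x - 1) \<le> (1 + (y / x - 1)) ^ (m + 1)"
    using assms x by (intro Bernoulli_inequality) simp
  then have "(1 + real (m + 1) * (y / x - 1)) * x ^ (m + 1) \<le> (y / x) ^ (m + 1) * x ^ (m + 1)"
    using x by (intro mult_right_mono) auto
  also have "(y / x) ^ (m + 1) * x ^ (m + 1) = y ^ (m + 1)"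
    using x by (simp add: power_divide)
  also have "(1 + real (m + 1) * (y / x - 1)) * x ^ (m + 1) = real (m + 1) * x ^ m * y - real m * x ^ (m + 1)"
    using x by (simp add: field_simps)
  finally show ?thesis by simp
qed

text \<open>
  One step of the Knothe map, from a marginal of \<open>D\<close> to a marginal of the ball. The layer-cake formula in \<open>\<alpha>\<close> replaces the
  derivative of the transport map, so that weighted AM-GM applies pointwise.
\<close>

lemma knothe_step:
  fixes g t :: "real \<Rightarrow> real" and T M :: real
  assumes N: "N = density lborel (\<lambda>a. ennreal (g a))" "real_distribution N"
    and [measurable]: "g \<in> borel_measurable borel" "t \<in> borel_measurable borel"
    and g: "\<And>a. 0 \<le> g a" "\<And>a. M < \<bar>a\<bar> \<Longrightarrow> g a = 0"
    and t: "\<And>a. 0 \<le> t a" "\<And>a. t a \<le> C" and T: "T > 0"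
    and gt: "\<And>a. g a > 0 \<Longrightarrow> g a * Beta (1 / 2) (real m / 2 + 1) = t a ^ m / T ^ (m + 1)"
  shows "real (m + 1) / real (m + 3) * T \<le>
    (\<integral>u. quantile N u * cap_quantile m u \<partial>unif) + real m / real (m + 2) * (\<integral>u. t (quantile N u) * cap_height m u \<partial>unif)"
proof -
  interpret real_distribution N by (rule N(2))
  interpret U: prob_space unif by (rule prob_space_unif)
  let ?a = "quantile N" and ?q = "cap_quantile m" and ?h = "cap_height m" and ?G = "cdf N"
  let ?\<beta> = "Beta (1 / 2) (real m / 2 + 1)"
  have \<beta>: "?\<beta> > 0" by (rule Beta_pos)
  have G01: "0 \<le> ?G x" "?G x \<le> 1" for x using cdf_nonneg cdf_bounded_prob by auto
  have [measurable]: "?a \<in> borel_measurable borel" by (rule borel_measurable_quantile[OF N(2)])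
  have [measurable]: "?G \<in> borel_measurable borel"
    by (rule borel_measurable_mono) (auto intro: monoI cdf_nondecreasing)
  have sing: "measure N {x} = 0" for x
  proof -
    have "emeasure N {x} = 0"
      unfolding N(1) by (subst emeasure_density) (auto simp: nn_integral_0_iff_AE intro!: AE_I'[of "{x}"])
    then show ?thesis by (simp add: measure_def)
  qed
  have Ga: "AE u in unif. ?G (?a u) = u"
    using AE_unif by eventually_elim (auto intro: cdf_quantile[OF N(2) sing])
  have aM: "AE u in unif. \<bar>?a u\<bar> \<le> M"
    by (rule AE_abs_quantile_le[OF N assms(3) g(2)])
  have M: "0 \<le> M"
  proof (rule ccontr)
    assume neg: "\<not> 0 \<le> M"
    from aM have "AE u in unif. False"
    proof eventually_elim
      case (elim u)
      have "0 \<le> \<bar>?a u\<bar>" by simp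
      with elim neg show ?case by linarith
    qed
    then show False using U.AE_False by simp
  qed
  have Eq: "(\<integral>u. ?q u \<partial>unif) = 0"
  proof -
    have "(\<integral>u. ?q u \<partial>unif) = (\<integral>u. ?q u * indicator {0<..} u \<partial>unif)"
      using AE_unif by (intro integral_cong_AE) (auto elim!: eventually_mono)
    then show ?thesis using integral_cap_quantile_tail[of 0 m] by (simp add: cap_height_def)
  qed
  have lay: "(\<integral>u. ?a u * ?q u \<partial>unif) = (\<integral>\<alpha>. indicator {-M..M} \<alpha> * (?h (?G \<alpha>) ^ (m + 2) / (real (m + 2) * ?\<beta>)) \<partial>lborel)"
  proof -
    interpret P: pair_sigma_finite unif lborel
      by (intro pair_sigma_finite.intro U.sigma_finite_measure_axioms sigma_finite_lborel)
    let ?f = "\<lambda>u \<alpha>. ?q u * (indicator {-M..M} \<alpha> * indicator {..<?a u} \<alpha>)"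
    have intf: "integrable (unif \<Otimes>\<^sub>M lborel) (\<lambda>(u, \<alpha>). ?f u \<alpha>)"
    proof (rule Bochner_Integration.integrable_bound)
      have "integrable (unif \<Otimes>\<^sub>M lborel) (\<lambda>x. indicator (space unif \<times> {-M..M}) x :: real)"
        by (rule integrable_real_indicator) (use M in \<open>auto simp: lborel.emeasure_pair_measure_Times ennreal_mult_less_top U.emeasure_space_1[simplified]\<close>)
      then show "integrable (unif \<Otimes>\<^sub>M lborel) (\<lambda>x. indicator (UNIV \<times> {-M..M}) x :: real)" by simp
      show "AE x in unif \<Otimes>\<^sub>M lborel. norm (case x of (u, \<alpha>) \<Rightarrow> ?f u \<alpha>) \<le> norm (indicator (UNIV \<times> {-M..M}) x :: real)"
        using abs_cap_quantile_le[of m] by (intro AE_I2) (auto simp: indicator_def)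
      show "(\<lambda>(u, \<alpha>). ?f u \<alpha>) \<in> borel_measurable (unif \<Otimes>\<^sub>M lborel)"
        by (simp add: indicator_def split_beta')
    qed
    \<comment> \<open>Since \<open>?q\<close> has mean zero, \<open>?a\<close> may be shifted by
      \<open>M\<close>. The shifted value is the length of the set of levels \<open>\<alpha>\<close>
      in \<open>{-M..M}\<close> below \<open>?a u\<close>, which is the layer-cake formula.\<close>
    have "(\<integral>u. ?a u * ?q u \<partial>unif) = (\<integral>u. (?a u + M) * ?q u \<partial>unif)"
    proof -
      have "integrable unif (\<lambda>u. ?a u * ?q u)"
        by (rule integrable_quantile_mult_cap[OF N(2) aM])
      moreover have "integrable unif (\<lambda>u. M * ?q u)"
        by (intro integrable_mult_right integrable_unif_bounded[where C=1] abs_cap_quantile_le) measurable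
      ultimately have "(\<integral>u. ?a u * ?q u + M * ?q u \<partial>unif) = (\<integral>u. ?a u * ?q u \<partial>unif) + (\<integral>u. M * ?q u \<partial>unif)"
        by (rule Bochner_Integration.integral_add)
      then show ?thesis by (simp add: Eq distrib_right)
    qed
    also have "\<dots> = (\<integral>u. (\<integral>\<alpha>. ?f u \<alpha> \<partial>lborel) \<partial>unif)"
    proof (rule integral_cong_AE)
      show "AE u in unif. (?a u + M) * ?q u = (\<integral>\<alpha>. ?f u \<alpha> \<partial>lborel)"
        using aM
      proof eventually_elim
        case (elim u)
        have "(\<integral>\<alpha>. indicator {-M..M} \<alpha> * indicator {..<?a u} \<alpha> \<partial>lborel) = (\<integral>\<alpha>. (indicator {-M..<?a u} \<alpha> :: real) \<partial>lborel)"
          using elim by (intro Bochner_Integration.integral_cong) (auto simp: indicator_def)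
        also have "\<dots> = ?a u + M" using elim by (simp add: abs_le_iff)
        finally show ?case by simp
      qed
      show "(\<lambda>u. \<integral>\<alpha>. ?f u \<alpha> \<partial>lborel) \<in> borel_measurable unif"
        by (rule sigma_finite_measure.borel_measurable_lebesgue_integral[OF sigma_finite_lborel]) (simp add: indicator_def split_beta')
    qed measurable
    also have "\<dots> = (\<integral>\<alpha>. (\<integral>u. ?f u \<alpha> \<partial>unif) \<partial>lborel)"
      by (rule P.Fubini_integral[OF intf, symmetric])
    also have "\<dots> = (\<integral>\<alpha>. indicator {-M..M} \<alpha> * (?h (?G \<alpha>) ^ (m + 2) / (real (m + 2) * ?\<beta>)) \<partial>lborel)"
    proof (intro Bochner_Integration.integral_cong refl)
      fix \<alpha>
      \<comment> \<open>The event \<open>\<alpha> < ?a u\<close> is \<open>?G \<alpha> < u\<close>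
        by the Galois property of the quantile, so the inner integral is a tail moment of the ball
        marginal.\<close>
      have "(\<integral>u. ?f u \<alpha> \<partial>unif) = (\<integral>u. indicator {-M..M} \<alpha> * (?q u * indicator {?G \<alpha><..} u) \<partial>unif)"
      proof (rule integral_cong_AE)
        show "AE u in unif. ?f u \<alpha> = indicator {-M..M} \<alpha> * (?q u * indicator {?G \<alpha><..} u)"
          using AE_unif
        proof eventually_elim
          case (elim u)
          then have "\<alpha> < ?a u \<longleftrightarrow> ?G \<alpha> < u" using quantile_le_iff[OF N(2), of u \<alpha>] by auto
          then show ?case by (simp add: indicator_def)
        qed
      qed (simp_all add: indicator_def)
      then show "(\<integral>u. ?f u \<alpha> \<partial>unif) = indicator {-M..M} \<alpha> * (?h (?G \<alpha>) ^ (m + 2) / (real (m + 2) * ?\<beta>))"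
        using integral_cap_quantile_tail[OF G01(1)[of \<alpha>] G01(2)[of \<alpha>], of m] by simp
    qed
    finally show ?thesis .
  qed
  \<comment> \<open>The change of variables \<open>u = ?G \<alpha>\<close> for expectations, with
    \<open>g\<close> as its Jacobian. All terms become integrals over \<open>\<alpha>\<close> and
    can be compared pointwise.\<close>
  have dens: "(\<integral>u. f (?a u) u \<partial>unif) = (\<integral>\<alpha>. indicator {-M..M} \<alpha> * (g \<alpha> * f \<alpha> (?G \<alpha>)) \<partial>lborel)"
    if [measurable]: "(\<lambda>(a, u). f a u) \<in> borel_measurable (borel \<Otimes>\<^sub>M borel)" for f :: "real \<Rightarrow> real \<Rightarrow> real"
  proof -
    have "(\<integral>u. f (?a u) u \<partial>unif) = (\<integral>u. f (?a u) (?G (?a u)) \<partial>unif)"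
      using Ga by (intro integral_cong_AE) (auto elim!: eventually_mono)
    also have "\<dots> = (\<integral>\<alpha>. f \<alpha> (?G \<alpha>) \<partial>N)"
      by (rule integral_quantile[OF N(2)]) measurable
    also have "\<dots> = (\<integral>\<alpha>. g \<alpha> * f \<alpha> (?G \<alpha>) \<partial>lborel)"
      unfolding N(1) by (subst integral_density) (auto simp: g N(1)[symmetric])
    also have "\<dots> = (\<integral>\<alpha>. indicator {-M..M} \<alpha> * (g \<alpha> * f \<alpha> (?G \<alpha>)) \<partial>lborel)"
    proof (intro Bochner_Integration.integral_cong refl)
      fix \<alpha>
      have "\<alpha> \<in> {-M..M}" if "g \<alpha> \<noteq> 0" using g(2)[of \<alpha>] that by (cases "M < \<bar>\<alpha>\<bar>") auto
      then show "g \<alpha> * f \<alpha> (?G \<alpha>) = indicator {-M..M} \<alpha> * (g \<alpha> * f \<alpha> (?G \<alpha>))"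
        by (cases "g \<alpha> = 0") simp_all
    qed
    finally show ?thesis .
  qed
  have pt: "indicator {-M..M} \<alpha> * (real (m + 1) / real (m + 2) * T * (g \<alpha> * (?h (?G \<alpha>))\<^sup>2))
     \<le> indicator {-M..M} \<alpha> * (?h (?G \<alpha>) ^ (m + 2) / (real (m + 2) * ?\<beta>) + real m / real (m + 2) * (g \<alpha> * (t \<alpha> * ?h (?G \<alpha>))))" for \<alpha>
  proof (intro mult_left_mono)
    define y where "y = ?h (?G \<alpha>)"
    have y: "0 \<le> y" using cap_height_bounds by (simp add: y_def)
    show "real (m + 1) / real (m + 2) * T * (g \<alpha> * y\<^sup>2) \<le> y ^ (m + 2) / (real (m + 2) * ?\<beta>) + real m / real (m + 2) * (g \<alpha> * (t \<alpha> * y))"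
    proof (cases "g \<alpha> > 0")
      case False
      then have "g \<alpha> = 0" using g(1)[of \<alpha>] by simp
      then show ?thesis using y \<beta> by simp
    next
      case True
      \<comment> \<open>The slice radius relative to the volume radius of the whole set. For a ball
        it coincides with \<open>y\<close>, the case of equality in AM-GM.\<close>
      define x where "x = t \<alpha> / T"
      have x: "0 \<le> x" using t T by (simp add: x_def)
      have gx: "g \<alpha> = x ^ m / (T * ?\<beta>)" using gt[OF True] T \<beta> by (simp add: x_def power_divide field_simps)
      have tx: "t \<alpha> = x * T" using T by (simp add: x_def)
      have "real (m + 1) * x ^ m * y * y \<le> (y ^ (m + 1) + real m * x ^ (m + 1)) * y"
        by (intro mult_right_mono bernoulli_two_variables x y)
      then have le: "real (m + 1) * x ^ m * y * y / (real (m + 2) * ?\<beta>) \<le> (y ^ (m + 1) + real m * x ^ (m + 1)) * y / (real (m + 2) * ?\<beta>)"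
        using \<beta> by (intro divide_right_mono) auto
      have alg: "L / K * T * (X / (T * \<beta>) * y\<^sup>2) = L * X * y * y / (K * \<beta>)"
        "Y * y / (K * \<beta>) + k / K * (X / (T * \<beta>) * (x * T * y)) = (Y + k * (X * x)) * y / (K * \<beta>)"
        if "\<beta> > 0" "K > 0" for \<beta> K L k X Y :: real
        using that T by (simp_all add: field_simps power2_eq_square)
      have p: "y ^ (m + 2) = y ^ (m + 1) * y" "x ^ (m + 1) = x ^ m * x" and K: "real (m + 2) > 0" by simp_all
      show ?thesis
        unfolding gx tx p(1) alg(1)[OF \<beta> K] alg(2)[OF \<beta> K] using le unfolding p(2) .
    qed
  qed simp
  have hb: "\<bar>?h x ^ k\<bar> \<le> 1" for x k using cap_height_bounds[of m x] by (auto intro: power_le_one)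
  have int1: "integrable lborel (\<lambda>\<alpha>. indicator {-M..M} \<alpha> * (?h (?G \<alpha>) ^ (m + 2) / (real (m + 2) * ?\<beta>)))"
  proof (rule Bochner_Integration.integrable_bound)
    show "integrable lborel (\<lambda>\<alpha>. indicator {-M..M} \<alpha> * (1 / (real (m + 2) * ?\<beta>)))"
      by (intro integrable_mult_left integrable_real_indicator) (use M in auto)
    show "AE \<alpha> in lborel. norm (indicator {-M..M} \<alpha> * (?h (?G \<alpha>) ^ (m + 2) / (real (m + 2) * ?\<beta>))) \<le> norm (indicator {-M..M} \<alpha> * (1 / (real (m + 2) * ?\<beta>)))"
      using hb \<beta> by (intro AE_I2) (auto simp: abs_mult indicator_def intro!: divide_right_mono simp del: power_Suc)
  qed measurable
  have gint: "integrable lborel g"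
  proof -
    have "emeasure N UNIV = 1" using emeasure_space_1 by simp
    then have "(\<integral>\<^sup>+x. ennreal (g x) \<partial>lborel) = 1" by (simp add: N(1) emeasure_density)
    then show ?thesis using g(1) by (intro integrableI_bounded) auto
  qed
  have intg: "integrable lborel (\<lambda>\<alpha>. indicator {-M..M} \<alpha> * (g \<alpha> * f \<alpha>))"
    if [measurable]: "f \<in> borel_measurable borel" and f: "\<And>\<alpha>. \<bar>f \<alpha>\<bar> \<le> D" for f D
  proof (rule Bochner_Integration.integrable_bound)
    show "integrable lborel (\<lambda>\<alpha>. g \<alpha> * D)" using gint by simp
    show "AE \<alpha> in lborel. norm (indicator {-M..M} \<alpha> * (g \<alpha> * f \<alpha>)) \<le> norm (g \<alpha> * D)"
    proof (rule AE_I2)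
      fix \<alpha>
      have "\<bar>f \<alpha>\<bar> \<le> \<bar>D\<bar>" using f[of \<alpha>] by linarith
      then show "norm (indicator {-M..M} \<alpha> * (g \<alpha> * f \<alpha>)) \<le> norm (g \<alpha> * D)"
        using g(1)[of \<alpha>] by (auto simp: abs_mult indicator_def intro!: mult_left_mono)
    qed
  qed measurable
  have th: "\<bar>t \<alpha> * ?h (?G \<alpha>)\<bar> \<le> C" for \<alpha>
  proof -
    have "t \<alpha> * ?h (?G \<alpha>) \<le> C * 1" using t[of \<alpha>] cap_height_bounds[of m "?G \<alpha>"] by (intro mult_mono) auto
    then show ?thesis using t[of \<alpha>] cap_height_bounds[of m "?G \<alpha>"] by simp
  qed
  have int2: "integrable lborel (\<lambda>\<alpha>. indicator {-M..M} \<alpha> * (g \<alpha> * (t \<alpha> * ?h (?G \<alpha>))))"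
    by (rule intg[OF _ th]) measurable
  have int3: "integrable lborel (\<lambda>\<alpha>. indicator {-M..M} \<alpha> * (g \<alpha> * (?h (?G \<alpha>))\<^sup>2))"
    by (rule intg[OF _ hb]) measurable
  \<comment> \<open>The constant is \<open>(m + 1) / (m + 2)\<close>, the coefficient in the
    pointwise inequality, times the mean \<open>(m + 2) / (m + 3)\<close> of the squared slice
    radius.\<close>
  have "real (m + 1) / real (m + 3) * T = real (m + 1) / real (m + 2) * T * (\<integral>u. (?h u)\<^sup>2 \<partial>unif)"
    unfolding integral_cap_height_unif by simp
  also have "\<dots> = real (m + 1) / real (m + 2) * T * (\<integral>\<alpha>. indicator {-M..M} \<alpha> * (g \<alpha> * (?h (?G \<alpha>))\<^sup>2) \<partial>lborel)"
    by (subst dens[of "\<lambda>a u. (?h u)\<^sup>2"]) auto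
  also have "\<dots> = (\<integral>\<alpha>. indicator {-M..M} \<alpha> * (real (m + 1) / real (m + 2) * T * (g \<alpha> * (?h (?G \<alpha>))\<^sup>2)) \<partial>lborel)"
    by (subst integral_mult_right_zero[symmetric]) (simp add: mult.left_commute)
  also have "\<dots> \<le> (\<integral>\<alpha>. indicator {-M..M} \<alpha> * (?h (?G \<alpha>) ^ (m + 2) / (real (m + 2) * ?\<beta>)) + 
      real m / real (m + 2) * (indicator {-M..M} \<alpha> * (g \<alpha> * (t \<alpha> * ?h (?G \<alpha>)))) \<partial>lborel)"
  proof (rule integral_mono)
    show "integrable lborel (\<lambda>\<alpha>. indicator {-M..M} \<alpha> * (real (m + 1) / real (m + 2) * T * (g \<alpha> * (?h (?G \<alpha>))\<^sup>2)))"
      using integrable_mult_right[OF int3, of "real (m + 1) / real (m + 2) * T"] by (simp add: mult.left_commute)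
    show "integrable lborel (\<lambda>\<alpha>. indicator {-M..M} \<alpha> * (?h (?G \<alpha>) ^ (m + 2) / (real (m + 2) * ?\<beta>)) + 
      real m / real (m + 2) * (indicator {-M..M} \<alpha> * (g \<alpha> * (t \<alpha> * ?h (?G \<alpha>)))))"
      by (intro Bochner_Integration.integrable_add int1 integrable_mult_right int2)
  qed (use pt in \<open>simp only: distrib_left mult.left_commute\<close>)
  also have "\<dots> = (\<integral>\<alpha>. indicator {-M..M} \<alpha> * (?h (?G \<alpha>) ^ (m + 2) / (real (m + 2) * ?\<beta>)) \<partial>lborel) +
      real m / real (m + 2) * (\<integral>\<alpha>. indicator {-M..M} \<alpha> * (g \<alpha> * (t \<alpha> * ?h (?G \<alpha>))) \<partial>lborel)"
    by (subst Bochner_Integration.integral_add[OF int1 integrable_mult_right[OF int2]]) simp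
  also have "\<dots> = (\<integral>u. ?a u * ?q u \<partial>unif) + real m / real (m + 2) * (\<integral>u. t (?a u) * ?h u \<partial>unif)"
    unfolding lay by (subst dens[of "\<lambda>a u. t a * ?h u"]) auto
  finally show ?thesis .
qed

text \<open>Twice the scalar product is traded for a squared distance by expanding the square, and
  every term is kept on a side where it is added, as suits \<open>ennreal\<close>. The last term on
  the right has the form of the gain that the lower-dimensional estimate yields for a slice of
  volume radius \<open>t\<close> against a ball of radius \<open>s * cap_height m u\<close>.\<close>

lemma knothe_step_cost:
  fixes g t :: "real \<Rightarrow> real" and T M s :: real
  assumes N: "N = density lborel (\<lambda>a. ennreal (g a))" "real_distribution N"
    and [measurable]: "g \<in> borel_measurable borel" "t \<in> borel_measurable borel"
    and g: "\<And>a. 0 \<le> g a" "\<And>a. M < \<bar>a\<bar> \<Longrightarrow> g a = 0"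
    and t: "\<And>a. 0 \<le> t a" "\<And>a. t a \<le> C" and T: "T > 0" and s: "s > 0"
    and gt: "\<And>a. g a > 0 \<Longrightarrow> g a * Beta (1 / 2) (real m / 2 + 1) = t a ^ m / T ^ (m + 1)"
  shows "(\<integral>\<^sup>+u. ennreal ((quantile N u - s * cap_quantile m u)\<^sup>2) \<partial>unif) + ennreal (2 * (real (m + 1) / real (m + 3)) * T * s) \<le>
    (\<integral>\<^sup>+u. ennreal ((quantile N u)\<^sup>2) \<partial>unif) + (\<integral>\<^sup>+u. ennreal ((s * cap_quantile m u)\<^sup>2) \<partial>unif) +
    (\<integral>\<^sup>+u. ennreal (2 * (real m / real (m + 2)) * t (quantile N u) * (s * cap_height m u)) \<partial>unif)"
proof -
  interpret U: prob_space unif by (rule prob_space_unif)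
  let ?a = "quantile N" and ?q = "cap_quantile m" and ?h = "cap_height m"
  have [measurable]: "?a \<in> borel_measurable borel" by (rule borel_measurable_quantile[OF N(2)])
  have aM: "AE u in unif. \<bar>?a u\<bar> \<le> M"
    by (rule AE_abs_quantile_le[OF N assms(3) g(2)])
  have ia: "integrable unif (\<lambda>u. (?a u)\<^sup>2)"
  proof (rule U.integrable_const_bound[where B="M\<^sup>2"])
    show "AE u in unif. norm ((?a u)\<^sup>2) \<le> M\<^sup>2" using aM
    proof eventually_elim
      case (elim u)
      then show ?case using power_mono[of "\<bar>?a u\<bar>" M 2] by simp
    qed
  qed measurable
  have iq: "integrable unif (\<lambda>u. (s * ?q u)\<^sup>2)"
  proof (rule integrable_unif_bounded[where C="s\<^sup>2"])
    fix u
    have "(?q u)\<^sup>2 \<le> 1" using abs_cap_quantile_le[of m u] by (simp add: abs_square_le_1)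
    then show "\<bar>(s * ?q u)\<^sup>2\<bar> \<le> s\<^sup>2" by (simp add: power_mult_distrib mult_left_le)
  qed measurable
  note iaq = integrable_quantile_mult_cap[OF N(2) aM]
  have th: "0 \<le> t (?a u) * ?h u" "t (?a u) * ?h u \<le> C" for u
  proof -
    have "t (?a u) * ?h u \<le> C * 1" using t[of "?a u"] cap_height_bounds[of m u] by (intro mult_mono) auto
    then show "0 \<le> t (?a u) * ?h u" "t (?a u) * ?h u \<le> C" using t[of "?a u"] cap_height_bounds[of m u] by simp_all
  qed
  have ith: "integrable unif (\<lambda>u. t (?a u) * ?h u)"
    by (rule integrable_unif_bounded[where C=C]) (use th in auto)
  let ?k = "2 * (real m / real (m + 2))"
  have k: "0 \<le> ?k" by simp
  define Eaq Eth where "Eaq = (\<integral>u. ?a u * ?q u \<partial>unif)" and "Eth = (\<integral>u. t (?a u) * ?h u \<partial>unif)"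
  define A Q where "A = (\<integral>u. (?a u)\<^sup>2 \<partial>unif)" and "Q = (\<integral>u. (s * ?q u)\<^sup>2 \<partial>unif)"
  have sq: "(?a u - s * ?q u)\<^sup>2 = (?a u)\<^sup>2 + (s * ?q u)\<^sup>2 - 2 * s * (?a u * ?q u)" for u
    by (simp add: power2_diff algebra_simps)
  have id: "integrable unif (\<lambda>u. (?a u - s * ?q u)\<^sup>2)"
    unfolding sq by (intro Bochner_Integration.integrable_diff Bochner_Integration.integrable_add ia iq integrable_mult_right iaq)
  have Ed: "(\<integral>u. (?a u - s * ?q u)\<^sup>2 \<partial>unif) = A + Q - 2 * s * Eaq"
    unfolding sq A_def Q_def Eaq_def using ia iq iaq by simp
  have d0: "0 \<le> A + Q - 2 * s * Eaq" unfolding Ed[symmetric] by simp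
  have Eth0: "0 \<le> Eth" unfolding Eth_def using th by simp
  have AQ0: "0 \<le> A" "0 \<le> Q" by (simp_all add: A_def Q_def)
  have key: "real (m + 1) / real (m + 3) * T \<le> Eaq + real m / real (m + 2) * Eth"
    unfolding Eaq_def Eth_def by (rule knothe_step[OF N assms(3,4) g t T gt]) 
  have "A + Q - 2 * s * Eaq + 2 * (real (m + 1) / real (m + 3)) * T * s \<le> A + Q + s * (?k * Eth)"
    using mult_left_mono[OF key, of "2 * s"] s by (simp add: algebra_simps)
  then have main: "ennreal (A + Q - 2 * s * Eaq) + ennreal (2 * (real (m + 1) / real (m + 3)) * T * s) \<le> ennreal A + ennreal Q + ennreal (s * (?k * Eth))"
    using d0 AQ0 Eth0 s T by (simp add: ennreal_plus[symmetric] del: ennreal_plus)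
  have 1: "(\<integral>\<^sup>+u. ennreal ((?a u - s * ?q u)\<^sup>2) \<partial>unif) = ennreal (A + Q - 2 * s * Eaq)"
    using nn_integral_eq_integral[OF id] Ed by simp
  have 2: "(\<integral>\<^sup>+u. ennreal ((?a u)\<^sup>2) \<partial>unif) = ennreal A" "(\<integral>\<^sup>+u. ennreal ((s * ?q u)\<^sup>2) \<partial>unif) = ennreal Q"
    using nn_integral_eq_integral[OF ia] nn_integral_eq_integral[OF iq] by (simp_all add: A_def Q_def)
  have 3: "(\<integral>\<^sup>+u. ennreal (?k * t (?a u) * (s * ?h u)) \<partial>unif) = ennreal (s * (?k * Eth))"
  proof -
    have "(\<integral>\<^sup>+u. ennreal (?k * t (?a u) * (s * ?h u)) \<partial>unif) = (\<integral>\<^sup>+u. ennreal (s * ?k * (t (?a u) * ?h u)) \<partial>unif)"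
      by (simp add: mult_ac)
    also have "\<dots> = ennreal (\<integral>u. s * ?k * (t (?a u) * ?h u) \<partial>unif)"
      using th s k by (intro nn_integral_eq_integral integrable_mult_right ith) (auto intro!: AE_I2 mult_nonneg_nonneg)
    also have "(\<integral>u. s * ?k * (t (?a u) * ?h u) \<partial>unif) = s * (?k * Eth)"
      by (simp add: Eth_def)
    finally show ?thesis .
  qed
  show ?thesis unfolding 1 2 3 by (rule main)
qed


section \<open>The Knothe coupling with a ball\<close>

abbreviation Leb :: "'i set \<Rightarrow> ('i \<Rightarrow> real) measure" where
  "Leb I \<equiv> Pi\<^sub>M I (\<lambda>_. lborel)"

text \<open>Parameters and the randomness consumed so far are stored in a sequence.\<close>

abbreviation Par :: "(nat \<Rightarrow> real) measure" where
  "Par \<equiv> Pi\<^sub>M UNIV (\<lambda>_. borel)"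

definition sball :: "'i set \<Rightarrow> real \<Rightarrow> ('i \<Rightarrow> real) set" where
  "sball I s = {y \<in> space (Leb I). (\<Sum>i\<in>I. (y i)\<^sup>2) \<le> s\<^sup>2}"

lemma sets_sball [measurable]: "sball I s \<in> sets (Leb I)"
proof (cases "finite I")
  case True
  then show ?thesis unfolding sball_def by measurable
next
  case False
  then show ?thesis unfolding sball_def by simp
qed

lemma emeasure_sball:
  assumes "finite I" "s > 0"
  shows "emeasure (Leb I) (sball I s) = ennreal (unit_ball_vol (real (card I)) * s ^ card I)"
proof -
  have "sball I s = {f. sqrt (\<Sum>i\<in>I. (f i)\<^sup>2) \<le> s} \<inter> space (Leb I)"
    using assms(2) by (auto simp: sball_def real_sqrt_le_iff' sum_nonneg)
  then show ?thesis using emeasure_cball_aux[OF assms] by simp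
qed

lemma sigma_finite_Leb: "finite I \<Longrightarrow> sigma_finite_measure (Leb I)"
proof -
  assume "finite I"
  interpret product_sigma_finite "\<lambda>_. lborel :: real measure" by standard
  show ?thesis using sigma_finite[OF \<open>finite I\<close>] .
qed

lemma nn_integral_Leb_insert:
  assumes "finite I" "i \<notin> I" "f \<in> borel_measurable (Leb (insert i I))"
  shows "(\<integral>\<^sup>+x. f x \<partial>Leb (insert i I)) = (\<integral>\<^sup>+a. (\<integral>\<^sup>+x. f (x(i := a)) \<partial>Leb I) \<partial>lborel)"
proof -
  interpret product_sigma_finite "\<lambda>_. lborel :: real measure" by standard
  show ?thesis using assms by (rule product_nn_integral_insert_rev)
qed

text \<open>The volume of a ball as the integral over its slices; this identifies the normalization
  of \<open>cap_measure\<close> with a quotient of ball volumes.\<close>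

lemma unit_ball_vol_Suc: "unit_ball_vol (real (Suc m)) = unit_ball_vol (real m) * Beta (1 / 2) (real m / 2 + 1)"
proof -
  have "Gamma (real m / 2 + 1) > 0" by (intro Gamma_real_pos add_nonneg_pos) auto
  then have "Gamma (real m / 2 + 1) \<noteq> 0" by linarith
  moreover have "pi powr ((1 + real m) / 2) = pi powr (real m / 2) * sqrt pi"
    by (simp add: powr_add add_divide_distrib powr_half_sqrt mult.commute)
  ultimately show ?thesis
    by (simp add: unit_ball_vol_def Beta_def Gamma_one_half_real field_simps)
qed

definition slice :: "('z \<times> 'x) set \<Rightarrow> 'z \<Rightarrow> 'x set" where
  "slice D z = {x. (z, x) \<in> D}"

lemma slice_eq: "slice D z = Pair z -` D" by (auto simp: slice_def)

lemma sets_slice [measurable]: "D \<in> sets (M \<Otimes>\<^sub>M N) \<Longrightarrow> slice D z \<in> sets N"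
  unfolding slice_eq by (rule sets_Pair1)

text \<open>
  The third clause is \<open>E[x \<bullet> y] \<ge> m / (m + 2) * T * s\<close> in terms of the transport cost. There \<open>m\<close> is the
  dimension and \<open>T\<close> the volume radius of the slice; a ball of radius \<open>T\<close> gives equality.
\<close>

definition knothe_kernel :: "'i set \<Rightarrow> ((nat \<Rightarrow> real) \<times> ('i \<Rightarrow> real)) set \<Rightarrow> real \<Rightarrow> (nat \<Rightarrow> real) \<Rightarrow>
    (('i \<Rightarrow> real) \<times> ('i \<Rightarrow> real)) measure \<Rightarrow> bool" where
  "knothe_kernel I D s z \<kappa> \<longleftrightarrow>
    (\<forall>f\<in>borel_measurable (Leb I). (\<integral>\<^sup>+p. f (fst p) \<partial>\<kappa>) =
       (\<integral>\<^sup>+x. f x * indicator (slice D z) x \<partial>Leb I) / emeasure (Leb I) (slice D z)) \<and>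
    (\<forall>f\<in>borel_measurable (Leb I). (\<integral>\<^sup>+p. f (snd p) \<partial>\<kappa>) =
       (\<integral>\<^sup>+y. f y * indicator (sball I s) y \<partial>Leb I) / emeasure (Leb I) (sball I s)) \<and>
    (\<forall>T>0. emeasure (Leb I) (slice D z) = ennreal (unit_ball_vol (real (card I)) * T ^ card I) \<longrightarrow>
       (\<integral>\<^sup>+p. ennreal (\<Sum>i\<in>I. (fst p i - snd p i)\<^sup>2) \<partial>\<kappa>) + ennreal (2 * (real (card I) / real (card I + 2)) * T * s) \<le>
       (\<integral>\<^sup>+p. ennreal (\<Sum>i\<in>I. (fst p i)\<^sup>2) \<partial>\<kappa>) + (\<integral>\<^sup>+p. ennreal (\<Sum>i\<in>I. (snd p i)\<^sup>2) \<partial>\<kappa>))"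

lemma knothe_kernelD:
  assumes "knothe_kernel I D s z \<kappa>"
  shows "f \<in> borel_measurable (Leb I) \<Longrightarrow> (\<integral>\<^sup>+p. f (fst p) \<partial>\<kappa>) =
       (\<integral>\<^sup>+x. f x * indicator (slice D z) x \<partial>Leb I) / emeasure (Leb I) (slice D z)"
    and "f \<in> borel_measurable (Leb I) \<Longrightarrow> (\<integral>\<^sup>+p. f (snd p) \<partial>\<kappa>) =
       (\<integral>\<^sup>+y. f y * indicator (sball I s) y \<partial>Leb I) / emeasure (Leb I) (sball I s)"
    and "T > 0 \<Longrightarrow> emeasure (Leb I) (slice D z) = ennreal (unit_ball_vol (real (card I)) * T ^ card I) \<Longrightarrow>
       (\<integral>\<^sup>+p. ennreal (\<Sum>i\<in>I. (fst p i - snd p i)\<^sup>2) \<partial>\<kappa>) + ennreal (2 * (real (card I) / real (card I + 2)) * T * s) \<le>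
       (\<integral>\<^sup>+p. ennreal (\<Sum>i\<in>I. (fst p i)\<^sup>2) \<partial>\<kappa>) + (\<integral>\<^sup>+p. ennreal (\<Sum>i\<in>I. (snd p i)\<^sup>2) \<partial>\<kappa>)"
  using assms unfolding knothe_kernel_def by blast+

text \<open>In dimension zero the space has the single point \<open>\<lambda>_. undefined\<close>, a
  slice of nonzero measure is all of it, and the gain has the factor 0.\<close>

lemma knothe_kernel_empty:
  fixes D :: "((nat \<Rightarrow> real) \<times> ('i \<Rightarrow> real)) set"
  assumes s: "s > 0" and D: "emeasure (Leb {}) (slice D z) \<noteq> 0"
  shows "knothe_kernel {} D s z (return (Leb {} \<Otimes>\<^sub>M Leb {}) ((\<lambda>_. undefined), (\<lambda>_. undefined)))"
proof -
  have "slice D z \<inter> {\<lambda>_. undefined} \<noteq> {}"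
  proof
    assume *: "slice D z \<inter> {\<lambda>_. undefined} = {}"
    show False
    proof (cases "slice D z \<in> sets (Leb {})")
      case True
      then have "slice D z \<subseteq> {\<lambda>_. undefined}" using sets.sets_into_space[OF True] by (simp add: space_PiM)
      with * have "slice D z = {}" by blast
      with D show False by simp
    qed (use D in \<open>simp add: emeasure_notin_sets\<close>)
  qed
  then have u: "(\<lambda>_. undefined) \<in> slice D z" by blast
  have "slice D z \<in> sets (Leb {})" using D emeasure_notin_sets by blast
  then have "slice D z \<subseteq> {\<lambda>_. undefined}" using sets.sets_into_space by (fastforce simp: space_PiM)
  with u have S: "slice D z = {\<lambda>_. undefined}" by blast
  have B: "sball {} s = {\<lambda>_. undefined}" by (auto simp: sball_def space_PiM)
  have [simp]: "((\<lambda>_. undefined), (\<lambda>_. undefined)) \<in> space (Leb {} \<Otimes>\<^sub>M Leb {})"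
    by (simp add: space_pair_measure space_PiM)
  let ?r = "return (Leb {} \<Otimes>\<^sub>M Leb {}) ((\<lambda>_. undefined :: real) :: 'i \<Rightarrow> real, (\<lambda>_. undefined :: real) :: 'i \<Rightarrow> real)"
  have m1: "emeasure (Leb {}) {\<lambda>_::'i. undefined :: real} = 1" by (simp add: PiM_empty)
  have i1: "(\<integral>\<^sup>+x. f x * indicator {\<lambda>_. undefined} x \<partial>Leb {}) = f (\<lambda>_. undefined)" for f :: "('i \<Rightarrow> real) \<Rightarrow> ennreal"
    by (simp add: PiM_empty nn_integral_count_space_finite)
  have "(\<integral>\<^sup>+p. f (fst p) \<partial>?r) = f (\<lambda>_. undefined)" "(\<integral>\<^sup>+p. f (snd p) \<partial>?r) = f (\<lambda>_. undefined)"
    if [measurable]: "f \<in> borel_measurable (Leb {})" for f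
    by (subst nn_integral_return; simp)+
  then show ?thesis
    unfolding knothe_kernel_def S B m1 i1 by (simp add: divide_ennreal_def)
qed

lemma divide_ennreal_eq_mult: "0 < k \<Longrightarrow> x / ennreal k = x * ennreal (1 / k)"
  by (simp add: divide_ennreal_def inverse_ennreal inverse_eq_divide)

text \<open>For a uniform \<open>u\<close>, coordinate \<open>i\<close> is placed at the
  \<open>u\<close>-quantiles of the two marginals, and the remaining coordinates are drawn from the
  kernel for the two slices through these points. Slice and radius depend on \<open>u\<close> and on
  the old parameters; this is why the induction hypothesis covers all sets and all radius functions
  at once.\<close>

lemma knothe_kernel_insert:
  fixes I :: "'i set" and D :: "((nat \<Rightarrow> real) \<times> ('i \<Rightarrow> real)) set" and s :: "(nat \<Rightarrow> real) \<Rightarrow> real"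
  assumes I: "finite I" "i \<notin> I"
    and IH: "\<And>D' s'. D' \<in> sets (Par \<Otimes>\<^sub>M Leb I) \<Longrightarrow> s' \<in> borel_measurable Par \<Longrightarrow>
      (\<forall>p\<in>D'. \<forall>j\<in>I. \<bar>snd p j\<bar> \<le> M) \<Longrightarrow>
      \<exists>\<kappa>\<in>Par \<rightarrow>\<^sub>M prob_algebra (Leb I \<Otimes>\<^sub>M Leb I). \<forall>z. s' z > 0 \<longrightarrow> emeasure (Leb I) (slice D' z) \<noteq> 0 \<longrightarrow>
         knothe_kernel I D' (s' z) z (\<kappa> z)"
    and D [measurable]: "D \<in> sets (Par \<Otimes>\<^sub>M Leb (insert i I))" and s [measurable]: "s \<in> borel_measurable Par"
    and DM: "\<forall>p\<in>D. \<forall>j\<in>insert i I. \<bar>snd p j\<bar> \<le> M"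
  shows "\<exists>\<kappa>\<in>Par \<rightarrow>\<^sub>M prob_algebra (Leb (insert i I) \<Otimes>\<^sub>M Leb (insert i I)). \<forall>z. s z > 0 \<longrightarrow>
     emeasure (Leb (insert i I)) (slice D z) \<noteq> 0 \<longrightarrow> knothe_kernel (insert i I) D (s z) z (\<kappa> z)"
proof -
  let ?J = "insert i I" and ?m = "card I"
  interpret LI: sigma_finite_measure "Leb I" by (rule sigma_finite_Leb[OF I(1)])
  have spZ [simp]: "space Par = UNIV" by (simp add: space_PiM)
  have spaceJ: "x(i := a) \<in> space (Leb ?J)" if "x \<in> space (Leb I)" for x a
    using that by (auto simp: space_PiM PiE_def extensional_def)
  have upd [measurable]: "(\<lambda>(x, a). x(i := a)) \<in> Leb I \<Otimes>\<^sub>M borel \<rightarrow>\<^sub>M Leb ?J"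
    using measurable_add_dim[of i I "\<lambda>_. lborel :: real measure"] by (simp cong: measurable_cong_sets)
  \<comment> \<open>The section of \<open>slice D z\<close> where coordinate \<open>i\<close> equals
    \<open>a\<close>. Its volume \<open>g z a\<close>, divided by \<open>v z\<close>, is the density
    of the marginal of that coordinate.\<close>
  define Da where "Da z a = {x \<in> space (Leb I). (z, x(i := a)) \<in> D}" for z a
  define g where "g z a = emeasure (Leb I) (Da z a)" for z a
  define v where "v z = emeasure (Leb ?J) (slice D z)" for z
  have mDa: "{p \<in> space ((Par \<Otimes>\<^sub>M borel) \<Otimes>\<^sub>M Leb I). (fst (fst p), (snd p)(i := snd (fst p))) \<in> D} \<in> sets ((Par \<Otimes>\<^sub>M borel) \<Otimes>\<^sub>M Leb I)"
  proof -
    have "(\<lambda>p. (fst (fst p), (snd p)(i := snd (fst p)))) \<in> (Par \<Otimes>\<^sub>M borel) \<Otimes>\<^sub>M Leb I \<rightarrow>\<^sub>M Par \<Otimes>\<^sub>M Leb ?J"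
      using upd by (intro measurable_Pair) (auto intro: measurable_compose[of "\<lambda>p. (snd p, snd (fst p))", OF _ upd, simplified])
    from measurable_sets[OF this D] show ?thesis by (simp add: vimage_def Int_def conj_commute)
  qed
  have g_meas: "(\<lambda>(z, a). g z a) \<in> borel_measurable (Par \<Otimes>\<^sub>M borel)"
  proof -
    have "(\<lambda>q. emeasure (Leb I) (Pair q -` {p \<in> space ((Par \<Otimes>\<^sub>M borel) \<Otimes>\<^sub>M Leb I). (fst (fst p), (snd p)(i := snd (fst p))) \<in> D}))
      \<in> borel_measurable (Par \<Otimes>\<^sub>M borel)"
      by (rule LI.measurable_emeasure_Pair[OF mDa])
    also have "(\<lambda>q. emeasure (Leb I) (Pair q -` {p \<in> space ((Par \<Otimes>\<^sub>M borel) \<Otimes>\<^sub>M Leb I). (fst (fst p), (snd p)(i := snd (fst p))) \<in> D}))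
      = (\<lambda>(z, a). g z a)"
      by (auto simp: fun_eq_iff g_def Da_def space_pair_measure intro!: arg_cong[where f="emeasure (Leb I)"])
    finally show ?thesis .
  qed
  have gz [measurable]: "g z \<in> borel_measurable borel" for z
    using measurable_compose[OF measurable_Pair1'[of z Par borel] g_meas] by simp
  have Da_meas [measurable]: "Da z a \<in> sets (Leb I)" for z a
    using sets_Pair1[OF mDa, of "(z, a)"] by (simp add: vimage_def Da_def space_pair_measure)
  \<comment> \<open>The volume of a cube that contains every section. The absolute value covers a
    negative \<open>M\<close>, for which \<open>D\<close> is empty.\<close>
  define C where "C = (2 * \<bar>M\<bar>) ^ ?m"
  have C0: "0 \<le> C" by (simp add: C_def)
  have g_le: "g z a \<le> ennreal C" for z a
  proof -
    interpret product_sigma_finite "\<lambda>_. lborel :: real measure" by standard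
    have "g z a \<le> emeasure (Leb I) (\<Pi>\<^sub>E j\<in>I. {- \<bar>M\<bar>..\<bar>M\<bar>})"
      unfolding g_def
    proof (rule emeasure_mono)
      show "Da z a \<subseteq> (\<Pi>\<^sub>E j\<in>I. {- \<bar>M\<bar>..\<bar>M\<bar>})"
      proof
        fix x assume x: "x \<in> Da z a"
        have "\<bar>x j\<bar> \<le> M" if "j \<in> I" for j
          using x DM[rule_format, of "(z, x(i := a))" j] that I(2) by (auto simp: Da_def split: if_splits)
        then show "x \<in> (\<Pi>\<^sub>E j\<in>I. {- \<bar>M\<bar>..\<bar>M\<bar>})" using x by (force simp: Da_def space_PiM PiE_iff abs_le_iff)
      qed
      show "(\<Pi>\<^sub>E j\<in>I. {- \<bar>M\<bar>..\<bar>M\<bar>}) \<in> sets (Leb I)" by (intro sets_PiM_I_finite I) auto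
    qed
    also have "\<dots> = (\<Prod>j\<in>I. emeasure lborel {- \<bar>M\<bar>..\<bar>M\<bar>})" by (rule emeasure_PiM[OF I(1)]) auto
    also have "\<dots> = ennreal C" by (simp add: C_def ennreal_power)
    finally show ?thesis .
  qed
  have g_M: "g z a = 0" if "\<bar>M\<bar> < \<bar>a\<bar>" for z a
  proof -
    have "Da z a = {}" using DM that by (force simp: Da_def)
    then show ?thesis by (simp add: g_def)
  qed
  have v_eq: "v z = (\<integral>\<^sup>+a. g z a \<partial>lborel)" for z
  proof -
    have "v z = (\<integral>\<^sup>+x. indicator (slice D z) x \<partial>Leb ?J)" using D by (simp add: v_def sets_slice)
    also have "\<dots> = (\<integral>\<^sup>+a. (\<integral>\<^sup>+x. indicator (slice D z) (x(i := a)) \<partial>Leb I) \<partial>lborel)"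
      by (rule nn_integral_Leb_insert[OF I]) (use D in measurable)
    also have "\<dots> = (\<integral>\<^sup>+a. g z a \<partial>lborel)"
    proof (rule nn_integral_cong)
      fix a
      have "(\<integral>\<^sup>+x. indicator (slice D z) (x(i := a)) \<partial>Leb I) = (\<integral>\<^sup>+x. indicator (Da z a) x \<partial>Leb I)"
        by (intro nn_integral_cong) (auto simp: Da_def slice_def indicator_def)
      then show "(\<integral>\<^sup>+x. indicator (slice D z) (x(i := a)) \<partial>Leb I) = g z a" by (simp add: g_def)
    qed
    finally show ?thesis .
  qed
  have v_meas [measurable]: "v \<in> borel_measurable Par"
    unfolding v_eq[abs_def] by (rule lborel.borel_measurable_nn_integral) (use g_meas in \<open>simp cong: measurable_cong_sets\<close>)
  have v_fin: "v z < \<infinity>" for z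
  proof -
    have "v z \<le> (\<integral>\<^sup>+a. ennreal C * indicator {-\<bar>M\<bar>..\<bar>M\<bar>} a \<partial>lborel)"
      unfolding v_eq using g_le g_M by (intro nn_integral_mono) (auto simp: indicator_def not_le abs_le_iff)
    also have "\<dots> < \<infinity>" by (subst nn_integral_cmult_indicator) (auto simp: ennreal_mult_less_top)
    finally show ?thesis .
  qed
  define V where "V = unit_ball_vol (real ?m)"
  have V: "V > 0" by (simp add: V_def)
  define G where "G z a = enn2real (g z a) / enn2real (v z)" for z a
  have G0: "0 \<le> G z a" for z a by (simp add: G_def)
  have G_meas [measurable]: "(\<lambda>(z, a). G z a) \<in> borel_measurable (Par \<Otimes>\<^sub>M borel)"
    unfolding G_def using g_meas by measurable
  have Gz [measurable]: "G z \<in> borel_measurable borel" for z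
    unfolding G_def by measurable
  have Gg: "ennreal (G z a) = g z a / v z" if "v z \<noteq> 0" for z a
  proof -
    obtain r where r: "g z a = ennreal r" "r \<ge> 0" using g_le[of z a] by (cases "g z a") (auto simp: top_unique)
    obtain w where w: "v z = ennreal w" "w \<ge> 0" using v_fin[of z] by (cases "v z") auto
    moreover have "w > 0" using w that by (cases "w = 0") auto
    ultimately show ?thesis using r by (simp add: G_def divide_ennreal)
  qed
  define N where "N z = density lborel (\<lambda>a. ennreal (G z a))" for z
  have Nd: "real_distribution (N z)" if vz: "v z \<noteq> 0" for z
  proof -
    have "emeasure (N z) UNIV = (\<integral>\<^sup>+a. g z a / v z \<partial>lborel)"
      by (simp add: N_def emeasure_density Gg[OF vz])
    also have "\<dots> = v z / v z" by (simp add: nn_integral_divide v_eq[symmetric])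
    also have "\<dots> = 1" using vz v_fin[of z] by (intro ennreal_divide_self) auto
    finally have "prob_space (N z)" by (intro prob_spaceI) (simp add: N_def)
    then show ?thesis by (simp add: real_distribution_def real_distribution_axioms_def N_def)
  qed
  \<comment> \<open>Where the slice is null, \<open>N z\<close> is no probability measure; the value
    0 is put there so that \<open>A\<close> is measurable on the whole parameter space.\<close>
  define A where "A z u = (if v z \<noteq> 0 then quantile (N z) u else 0)" for z u
  have A_meas [measurable]: "(\<lambda>(z, u). A z u) \<in> borel_measurable (Par \<Otimes>\<^sub>M borel)"
    unfolding borel_measurable_iff_le
  proof
    fix x
    \<comment> \<open>The distribution function of \<open>N z\<close> at the fixed point
      \<open>x\<close>, measurable in \<open>z\<close> by Fubini. Sublevel sets of \<open>A\<close>
      are comparisons of \<open>u\<close> with it, which gives joint measurability.\<close>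
    define H where "H z = enn2real (\<integral>\<^sup>+a. ennreal (G z a) * indicator {..x} a \<partial>lborel)" for z
    have [measurable]: "H \<in> borel_measurable Par"
    proof -
      have "(\<lambda>z. \<integral>\<^sup>+a. ennreal (G z a) * indicator {..x} a \<partial>lborel) \<in> borel_measurable Par"
        by (rule lborel.borel_measurable_nn_integral) (use G_meas in \<open>simp add: split_beta' cong: measurable_cong_sets\<close>)
      then show ?thesis by (simp add: H_def[abs_def])
    qed
    have "cdf (N z) x = H z" for z
      by (simp add: cdf_def measure_def N_def emeasure_density H_def)
    then have "A z u \<le> x \<longleftrightarrow> (if v z \<noteq> 0 \<and> 0 < u \<and> u < 1 then u \<le> H z else 0 \<le> x)" for z u
      using quantile_le_iff[OF Nd, of z u x] by (auto simp: A_def quantile_def)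
    then have "{w \<in> space (Par \<Otimes>\<^sub>M borel). (case w of (z, u) \<Rightarrow> A z u) \<le> x} =
       {w \<in> space (Par \<Otimes>\<^sub>M borel). if v (fst w) \<noteq> 0 \<and> 0 < snd w \<and> snd w < 1 then snd w \<le> H (fst w) else 0 \<le> x}"
      by (auto simp: split_beta')
    also have "\<dots> \<in> sets (Par \<Otimes>\<^sub>M borel)" by measurable
    finally show "{w \<in> space (Par \<Otimes>\<^sub>M borel). (case w of (z, u) \<Rightarrow> A z u) \<le> x} \<in> sets (Par \<Otimes>\<^sub>M borel)" .
  qed
  have Az [measurable]: "A z \<in> borel_measurable borel" for z
    using measurable_compose[OF measurable_Pair1'[of z Par borel] A_meas] by simp
  let ?q = "cap_quantile ?m" and ?h = "cap_height ?m"
  \<comment> \<open>A parameter sequence for the lower dimension carries \<open>u\<close> in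
    position 0 and the old sequence behind it; the shift recovers the old one.\<close>
  define sh :: "(nat \<Rightarrow> real) \<Rightarrow> nat \<Rightarrow> real" where "sh \<zeta> = (\<lambda>n. \<zeta> (Suc n))" for \<zeta>
  have sh_meas [measurable]: "sh \<in> Par \<rightarrow>\<^sub>M Par"
    unfolding sh_def by (rule measurable_PiM_single') auto
  have c0 [measurable]: "(\<lambda>\<zeta>. \<zeta> 0) \<in> borel_measurable Par" by simp
  \<comment> \<open>At the sequence \<open>case_nat u z\<close> with \<open>0 < u < 1\<close>, the
    slice of \<open>D'\<close> is the section \<open>Da z (A z u)\<close>, and \<open>s'\<close> is
    the radius of the slice of the ball of radius \<open>s z\<close> at height
    \<open>s z * ?q u\<close>.\<close>
  define D' where "D' = {p \<in> space (Par \<Otimes>\<^sub>M Leb I). (sh (fst p), (snd p)(i := A (sh (fst p)) (fst p 0))) \<in> D}"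
  define s' where "s' \<zeta> = s (sh \<zeta>) * ?h (\<zeta> 0)" for \<zeta>
  have A_sh [measurable]: "(\<lambda>\<zeta>. A (sh \<zeta>) (\<zeta> 0)) \<in> borel_measurable Par"
    using measurable_compose[OF measurable_Pair[OF sh_meas c0] A_meas] by simp
  have D'_meas: "D' \<in> sets (Par \<Otimes>\<^sub>M Leb I)"
  proof -
    have "(\<lambda>p. (snd p)(i := A (sh (fst p)) (fst p 0))) \<in> Par \<Otimes>\<^sub>M Leb I \<rightarrow>\<^sub>M Leb ?J"
      using measurable_compose[OF measurable_Pair[of snd "Par \<Otimes>\<^sub>M Leb I" "Leb I" "\<lambda>p. A (sh (fst p)) (fst p 0)" borel] upd]
        measurable_compose[OF measurable_fst A_sh] by (simp add: split_beta')
    then have "(\<lambda>p. (sh (fst p), (snd p)(i := A (sh (fst p)) (fst p 0)))) \<in> Par \<Otimes>\<^sub>M Leb I \<rightarrow>\<^sub>M Par \<Otimes>\<^sub>M Leb ?J"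
      by (intro measurable_Pair) (simp_all add: comp_def)
    from measurable_sets[OF this D] show ?thesis by (simp add: vimage_def Int_def conj_commute D'_def)
  qed
  have s'_meas: "s' \<in> borel_measurable Par" unfolding s'_def by measurable
  have D'M: "\<forall>p\<in>D'. \<forall>j\<in>I. \<bar>snd p j\<bar> \<le> M"
  proof (intro ballI)
    fix p j assume p: "p \<in> D'" and j: "j \<in> I"
    then have "\<bar>((snd p)(i := A (sh (fst p)) (fst p 0))) j\<bar> \<le> M"
      using DM[rule_format, of "(sh (fst p), (snd p)(i := A (sh (fst p)) (fst p 0)))" j] by (auto simp: D'_def)
    then show "\<bar>snd p j\<bar> \<le> M" using j I(2) by (auto split: if_splits)
  qed
  obtain \<kappa>0 where \<kappa>0 [measurable]: "\<kappa>0 \<in> Par \<rightarrow>\<^sub>M prob_algebra (Leb I \<Otimes>\<^sub>M Leb I)"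
    and \<kappa>0K: "\<And>\<zeta>. s' \<zeta> > 0 \<Longrightarrow> emeasure (Leb I) (slice D' \<zeta>) \<noteq> 0 \<Longrightarrow> knothe_kernel I D' (s' \<zeta>) \<zeta> (\<kappa>0 \<zeta>)"
    using IH[OF D'_meas s'_meas D'M] by blast
  define pr where "pr z u p = ((fst p)(i := A z u), (snd p)(i := s z * ?q u))" for z u and p :: "('i \<Rightarrow> real) \<times> ('i \<Rightarrow> real)"
  let ?L2 = "Leb I \<Otimes>\<^sub>M Leb I" and ?J2 = "Leb ?J \<Otimes>\<^sub>M Leb ?J"
  have pr_meas [measurable]: "(\<lambda>(w, p). pr (fst w) (snd w) p) \<in> (Par \<Otimes>\<^sub>M borel) \<Otimes>\<^sub>M ?L2 \<rightarrow>\<^sub>M ?J2"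
  proof -
    have A': "(\<lambda>x. A (fst (fst x)) (snd (fst x))) \<in> borel_measurable ((Par \<Otimes>\<^sub>M borel) \<Otimes>\<^sub>M ?L2)"
      using measurable_compose[OF measurable_fst A_meas] by (simp add: split_beta')
    have 1: "(\<lambda>x. (fst (snd x))(i := A (fst (fst x)) (snd (fst x)))) \<in> (Par \<Otimes>\<^sub>M borel) \<Otimes>\<^sub>M ?L2 \<rightarrow>\<^sub>M Leb ?J"
      using measurable_compose[OF measurable_Pair[OF _ A', of "\<lambda>x. fst (snd x)"] upd] by simp
    have S': "(\<lambda>x. s (fst (fst x)) * ?q (snd (fst x))) \<in> borel_measurable ((Par \<Otimes>\<^sub>M borel) \<Otimes>\<^sub>M ?L2)"
      by measurable
    have 2: "(\<lambda>x. (snd (snd x))(i := s (fst (fst x)) * ?q (snd (fst x)))) \<in> (Par \<Otimes>\<^sub>M borel) \<Otimes>\<^sub>M ?L2 \<rightarrow>\<^sub>M Leb ?J"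
      using measurable_compose[OF measurable_Pair[OF _ S', of "\<lambda>x. snd (snd x)"] upd] by simp
    show ?thesis unfolding pr_def split_beta' by (intro measurable_Pair 1 2)
  qed
  have cn [measurable]: "(\<lambda>w. case_nat (snd w) (fst w)) \<in> Par \<Otimes>\<^sub>M borel \<rightarrow>\<^sub>M Par"
    by (rule measurable_case_nat') auto
  define k where "k z u = distr (\<kappa>0 (case_nat u z)) ?J2 (pr z u)" for z u
  have k_meas: "(\<lambda>(z, u). k z u) \<in> Par \<Otimes>\<^sub>M borel \<rightarrow>\<^sub>M prob_algebra ?J2"
    unfolding k_def split_beta'
    by (rule measurable_distr_prob_space2[OF measurable_compose[OF cn \<kappa>0]]) (use pr_meas in \<open>simp add: split_beta'\<close>)
  define \<kappa> where "\<kappa> z = unif \<bind> k z" for z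
  have \<kappa>_meas: "\<kappa> \<in> Par \<rightarrow>\<^sub>M prob_algebra ?J2"
    unfolding \<kappa>_def
  proof (rule measurable_bind_prob_space2[OF _ k_meas])
    show "(\<lambda>z. unif) \<in> Par \<rightarrow>\<^sub>M prob_algebra borel"
      by (rule measurable_const) (simp add: space_prob_algebra prob_space_unif)
  qed
  have kz: "k z \<in> borel \<rightarrow>\<^sub>M prob_algebra ?J2" for z
    using measurable_compose[OF measurable_Pair1'[of z Par borel] k_meas] by simp
  have cnz [measurable]: "(\<lambda>u. case_nat u z) \<in> borel \<rightarrow>\<^sub>M Par" for z
    using measurable_compose[OF measurable_Pair1'[of z Par borel] cn] by simp
  have \<kappa>0s: "sets (\<kappa>0 \<zeta>) = sets ?L2" "prob_space (\<kappa>0 \<zeta>)" for \<zeta>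
    using measurable_space[OF \<kappa>0, of \<zeta>] by (simp_all add: space_prob_algebra)
  have prz: "pr z u \<in> ?L2 \<rightarrow>\<^sub>M ?J2" for z u
    using measurable_compose[OF measurable_Pair1'[of "(z, u)" "Par \<Otimes>\<^sub>M borel" ?L2] pr_meas] by (simp add: space_pair_measure)
  have prz2: "(\<lambda>(u, p). pr z u p) \<in> borel \<Otimes>\<^sub>M ?L2 \<rightarrow>\<^sub>M ?J2" for z
  proof -
    have "(\<lambda>w. ((z, fst w), snd w)) \<in> borel \<Otimes>\<^sub>M ?L2 \<rightarrow>\<^sub>M (Par \<Otimes>\<^sub>M borel) \<Otimes>\<^sub>M ?L2" by simp
    from measurable_compose[OF this pr_meas] show ?thesis by (simp add: split_beta')
  qed
  have int\<kappa>: "(\<integral>\<^sup>+p. F p \<partial>\<kappa> z) = (\<integral>\<^sup>+u. (\<integral>\<^sup>+p. F (pr z u p) \<partial>\<kappa>0 (case_nat u z)) \<partial>unif)"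
    if F: "F \<in> borel_measurable ?J2" for F z
  proof -
    have "(\<integral>\<^sup>+p. F p \<partial>\<kappa> z) = (\<integral>\<^sup>+u. (\<integral>\<^sup>+p. F p \<partial>k z u) \<partial>unif)"
      unfolding \<kappa>_def by (rule nn_integral_bind[OF F]) (use measurable_prob_algebraD[OF kz] in \<open>simp cong: measurable_cong_sets\<close>)
    also have "\<dots> = (\<integral>\<^sup>+u. (\<integral>\<^sup>+p. F (pr z u p) \<partial>\<kappa>0 (case_nat u z)) \<partial>unif)"
      unfolding k_def using prz F by (intro nn_integral_cong nn_integral_distr) (simp_all cong: measurable_cong_sets add: \<kappa>0s)
    finally show ?thesis .
  qed
  have main: "knothe_kernel ?J D (s z) z (\<kappa> z)" if sz: "s z > 0" and vz0: "emeasure (Leb ?J) (slice D z) \<noteq> 0" for z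
  proof -
    have vz: "v z \<noteq> 0" using vz0 by (simp add: v_def)
    note Nz = Nd[OF vz]
    have Aq: "A z = quantile (N z)" by (simp add: A_def vz fun_eq_iff)
    define K where "K u = \<kappa>0 (case_nat u z)" for u
    have sh_case: "sh (case_nat u z) = z" for u by (simp add: sh_def)
    have slD': "slice D' (case_nat u z) = Da z (A z u)" for u
      by (auto simp: slice_def D'_def Da_def sh_case space_pair_measure)
    have s'c: "s' (case_nat u z) = s z * ?h u" for u by (simp add: s'_def sh_case)
    \<comment> \<open>For almost every \<open>u\<close> the section is not null and the slice of the
      ball has positive radius, so that the induction hypothesis applies.\<close>
    have kk: "AE u in unif. 0 < u \<and> u < 1 \<and> g z (A z u) \<noteq> 0 \<and> ?h u > 0 \<and> knothe_kernel I D' (s z * ?h u) (case_nat u z) (K u)"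
    proof -
      have "AE a in N z. g z a \<noteq> 0"
        unfolding N_def by (subst AE_density) (auto simp: G_def)
      from AE_quantile[OF Nz this] AE_unif AE_cap_quantile[of ?m]
      show ?thesis
      proof eventually_elim
        case (elim u)
        have "(?q u)\<^sup>2 < 1" using elim by (simp add: abs_square_less_1 abs_less_iff)
        then have h: "?h u > 0" using elim by (simp add: cap_height_def)
        have "knothe_kernel I D' (s' (case_nat u z)) (case_nat u z) (\<kappa>0 (case_nat u z))"
          by (rule \<kappa>0K) (use elim h sz in \<open>simp_all add: s'c slD' Aq g_def[symmetric]\<close>)
        then show ?case using elim h by (simp add: K_def s'c Aq)
      qed
    qed
    have fstK: "(\<integral>\<^sup>+p. f (fst p) \<partial>\<kappa> z) = (\<integral>\<^sup>+x. f x * indicator (slice D z) x \<partial>Leb ?J) / emeasure (Leb ?J) (slice D z)"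
      if f [measurable]: "f \<in> borel_measurable (Leb ?J)" for f
    proof -
      define \<Phi> where "\<Phi> a = (\<integral>\<^sup>+x. f (x(i := a)) * indicator (Da z a) x \<partial>Leb I)" for a
      have sl: "f (x(i := a)) * indicator (slice D z) (x(i := a)) = f (x(i := a)) * indicator (Da z a) x" if "x \<in> space (Leb I)" for x a
        using that by (auto simp: indicator_def slice_def Da_def)
      have \<Phi>_eq: "\<Phi> a = (\<integral>\<^sup>+x. f (x(i := a)) * indicator (slice D z) (x(i := a)) \<partial>Leb I)" for a
        unfolding \<Phi>_def by (intro nn_integral_cong) (simp add: sl)
      have upd2: "(\<lambda>(a, x). x(i := a)) \<in> borel \<Otimes>\<^sub>M Leb I \<rightarrow>\<^sub>M Leb ?J"
        using measurable_compose[OF measurable_Pair[OF measurable_snd measurable_fst] upd] by (simp add: split_beta')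
      have fi: "(\<lambda>x. f x * indicator (slice D z) x) \<in> borel_measurable (Leb ?J)" using D by measurable
      have \<Phi>m [measurable]: "\<Phi> \<in> borel_measurable borel"
        unfolding \<Phi>_eq[abs_def]
        by (rule LI.borel_measurable_nn_integral) (use measurable_compose[OF upd2 fi] in \<open>simp add: split_beta'\<close>)
      \<comment> \<open>The average over a null section is a quotient by zero; this makes both sides
        of the cancellation below vanish there.\<close>
      have \<Phi>0: "\<Phi> a = 0" if "g z a = 0" for a
      proof -
        have "AE x in Leb I. x \<notin> Da z a" using that Da_meas[of z a] by (intro AE_not_in) (simp add: g_def null_sets_def)
        then have "\<Phi> a = (\<integral>\<^sup>+x. 0 \<partial>Leb I)" unfolding \<Phi>_def
          by (intro nn_integral_cong_AE) (auto elim!: eventually_mono)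
        then show ?thesis by simp
      qed
      have "(\<integral>\<^sup>+p. f (fst p) \<partial>\<kappa> z) = (\<integral>\<^sup>+u. (\<integral>\<^sup>+p. f ((fst p)(i := A z u)) \<partial>K u) \<partial>unif)"
        unfolding K_def by (subst int\<kappa>) (simp_all add: pr_def)
      also have "\<dots> = (\<integral>\<^sup>+u. \<Phi> (A z u) / g z (A z u) \<partial>unif)"
        using kk
      proof (intro nn_integral_cong_AE, eventually_elim)
        case (elim u)
        have "(\<lambda>x. f (x(i := A z u))) \<in> borel_measurable (Leb I)"
          using measurable_compose[OF measurable_Pair1'[of "A z u" borel "Leb I"] measurable_compose[OF upd2 f]] by simp
        moreover have "knothe_kernel I D' (s z * ?h u) (case_nat u z) (K u)" using elim by simp
        ultimately show ?case
          using knothe_kernelD(1)[of I D' _ _ "K u" "\<lambda>x. f (x(i := A z u))"] by (simp only: slD' \<Phi>_def g_def)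
      qed
      also have "\<dots> = (\<integral>\<^sup>+a. \<Phi> a / g z a \<partial>N z)"
        unfolding Aq by (rule nn_integral_quantile[OF Nz]) simp
      also have "\<dots> = (\<integral>\<^sup>+a. ennreal (G z a) * (\<Phi> a / g z a) \<partial>lborel)"
        unfolding N_def by (subst nn_integral_density) simp_all
      \<comment> \<open>Averages over sections are weighted by the density \<open>g / v\<close>; the
        normalization \<open>g\<close> cancels, and Fubini for \<open>slice D z\<close> is
        left.\<close>
      also have "\<dots> = (\<integral>\<^sup>+a. \<Phi> a / v z \<partial>lborel)"
      proof (rule nn_integral_cong)
        fix a
        show "ennreal (G z a) * (\<Phi> a / g z a) = \<Phi> a / v z"
        proof (cases "g z a = 0")
          case True
          then show ?thesis using \<Phi>0[OF True] by simp
        next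
          case False
          have "g z a * inverse (g z a) = 1"
            using ennreal_divide_self[of "g z a"] False le_less_trans[OF g_le[of z a] ennreal_less_top]
            by (simp add: divide_ennreal_def)
          moreover have "ennreal (G z a) * (\<Phi> a / g z a) = (g z a * inverse (g z a)) * (\<Phi> a / v z)"
            by (simp add: Gg[OF vz] divide_ennreal_def mult_ac)
          ultimately show ?thesis by simp
        qed
      qed
      also have "\<dots> = (\<integral>\<^sup>+a. \<Phi> a \<partial>lborel) / v z" by (simp add: nn_integral_divide)
      also have "(\<integral>\<^sup>+a. \<Phi> a \<partial>lborel) = (\<integral>\<^sup>+x. f x * indicator (slice D z) x \<partial>Leb ?J)"
        unfolding \<Phi>_eq by (rule nn_integral_Leb_insert[OF I fi, symmetric])
      finally show ?thesis by (simp add: v_def)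
    qed
    have sndK: "(\<integral>\<^sup>+p. f (snd p) \<partial>\<kappa> z) = (\<integral>\<^sup>+y. f y * indicator (sball ?J (s z)) y \<partial>Leb ?J) / emeasure (Leb ?J) (sball ?J (s z))"
      if f [measurable]: "f \<in> borel_measurable (Leb ?J)" for f
    proof -
      define \<Psi> where "\<Psi> b = (\<integral>\<^sup>+y. f (y(i := b)) * indicator (sball ?J (s z)) (y(i := b)) \<partial>Leb I)" for b
      have upd2: "(\<lambda>(a, x). x(i := a)) \<in> borel \<Otimes>\<^sub>M Leb I \<rightarrow>\<^sub>M Leb ?J"
        using measurable_compose[OF measurable_Pair[OF measurable_snd measurable_fst] upd] by (simp add: split_beta')
      have fi: "(\<lambda>x. f x * indicator (sball ?J (s z)) x) \<in> borel_measurable (Leb ?J)" by measurable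
      have \<Psi>m [measurable]: "\<Psi> \<in> borel_measurable borel"
        unfolding \<Psi>_def[abs_def]
        by (rule LI.borel_measurable_nn_integral) (use measurable_compose[OF upd2 fi] in \<open>simp add: split_beta'\<close>)
      have in_ball: "y(i := b) \<in> sball ?J (s z) \<longleftrightarrow> b\<^sup>2 + (\<Sum>j\<in>I. (y j)\<^sup>2) \<le> (s z)\<^sup>2" if "y \<in> space (Leb I)" for y b
      proof -
        have "(\<Sum>j\<in>I. ((y(i := b)) j)\<^sup>2) = (\<Sum>j\<in>I. (y j)\<^sup>2)" using I(2) by (intro sum.cong) auto
        then show ?thesis using I spaceJ[OF that, of b] by (simp add: sball_def)
      qed
      have \<Psi>0: "\<Psi> b = 0" if "s z < \<bar>b\<bar>" for b
      proof -
        have "(s z)\<^sup>2 < b\<^sup>2" using that sz power_strict_mono[of "s z" "\<bar>b\<bar>" 2] by simp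
        then have "y(i := b) \<notin> sball ?J (s z)" if "y \<in> space (Leb I)" for y
          using in_ball[OF that, of b] sum_nonneg[of I "\<lambda>j. (y j)\<^sup>2"] by auto
        then have "\<Psi> b = (\<integral>\<^sup>+y. 0 \<partial>Leb I)" unfolding \<Psi>_def by (intro nn_integral_cong) simp
        then show ?thesis by simp
      qed
      \<comment> \<open>The average of \<open>f\<close> over the slice of the ball at height
        \<open>s z * x\<close>, with the slice volume written out.\<close>
      define \<Theta> where "\<Theta> x = \<Psi> (s z * x) * ennreal (1 / (V * (s z * sqrt (1 - x\<^sup>2)) ^ ?m))" for x
      have \<Theta>m [measurable]: "\<Theta> \<in> borel_measurable borel" unfolding \<Theta>_def by measurable
      have "(\<integral>\<^sup>+p. f (snd p) \<partial>\<kappa> z) = (\<integral>\<^sup>+u. (\<integral>\<^sup>+p. f ((snd p)(i := s z * ?q u)) \<partial>K u) \<partial>unif)"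
        unfolding K_def by (subst int\<kappa>) (simp_all add: pr_def)
      also have "\<dots> = (\<integral>\<^sup>+u. \<Theta> (?q u) \<partial>unif)"
        using kk
      proof (intro nn_integral_cong_AE, eventually_elim)
        case (elim u)
        have fm: "(\<lambda>x. f (x(i := s z * ?q u))) \<in> borel_measurable (Leb I)"
          using measurable_compose[OF measurable_Pair1'[of "s z * ?q u" borel "Leb I"] measurable_compose[OF upd2 f]] by simp
        have u: "0 < u" "u < 1" and hp: "?h u > 0" using elim by auto
        have h: "?h u = sqrt (1 - (?q u)\<^sup>2)" using u by (simp add: cap_height_def)
        have q1: "(?q u)\<^sup>2 \<le> 1" using abs_cap_quantile_le[of ?m u] by (simp add: abs_square_le_1)
        have sq: "(s z * ?h u)\<^sup>2 = (s z)\<^sup>2 - (s z * ?q u)\<^sup>2"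
          unfolding h power_mult_distrib using q1 by (simp add: algebra_simps)
        have "y(i := s z * ?q u) \<in> sball ?J (s z) \<longleftrightarrow> y \<in> sball I (s z * ?h u)" if "y \<in> space (Leb I)" for y
          using that unfolding in_ball[OF that] by (auto simp: sball_def sq)
        then have "(\<integral>\<^sup>+y. f (y(i := s z * ?q u)) * indicator (sball I (s z * ?h u)) y \<partial>Leb I) = \<Psi> (s z * ?q u)"
          unfolding \<Psi>_def by (intro nn_integral_cong) (simp add: indicator_def)
        moreover have "(\<integral>\<^sup>+p. f ((snd p)(i := s z * ?q u)) \<partial>K u) =
          (\<integral>\<^sup>+y. f (y(i := s z * ?q u)) * indicator (sball I (s z * ?h u)) y \<partial>Leb I) / emeasure (Leb I) (sball I (s z * ?h u))"
        proof -
          have "knothe_kernel I D' (s z * ?h u) (case_nat u z) (K u)" using elim by simp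
          from knothe_kernelD(2)[OF this fm] show ?thesis .
        qed
        moreover have "emeasure (Leb I) (sball I (s z * ?h u)) = ennreal (V * (s z * ?h u) ^ ?m)"
          using hp sz unfolding V_def by (intro emeasure_sball I) simp
        moreover have "V * (s z * ?h u) ^ ?m > 0" using hp sz V by simp
        ultimately show ?case by (simp add: \<Theta>_def divide_ennreal_eq_mult h)
      qed
      also have "\<dots> = (\<integral>\<^sup>+x. \<Theta> x \<partial>cap_measure ?m)"
        by (rule nn_integral_quantile[OF real_distribution_cap \<Theta>m])
      also have "\<dots> = (\<integral>\<^sup>+x. ennreal (indicator {-1..1} x * sqrt (1 - x\<^sup>2) ^ ?m / Beta (1 / 2) (real ?m / 2 + 1)) * \<Theta> x \<partial>lborel)"
        unfolding cap_measure_def by (rule nn_integral_density) simp_all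
      \<comment> \<open>The density of the height is proportional to the slice volume, so all powers
        of \<open>sqrt (1 - x\<^sup>2)\<close> cancel. The poles, where this volume may vanish, are
        excluded as a null set.\<close>
      also have "\<dots> = (\<integral>\<^sup>+x. ennreal (1 / (Beta (1 / 2) (real ?m / 2 + 1) * V * s z ^ ?m)) * \<Psi> (0 + s z * x) \<partial>lborel)"
      proof (rule nn_integral_cong_AE)
        show "AE x in lborel. ennreal (indicator {-1..1} x * sqrt (1 - x\<^sup>2) ^ ?m / Beta (1 / 2) (real ?m / 2 + 1)) * \<Theta> x =
          ennreal (1 / (Beta (1 / 2) (real ?m / 2 + 1) * V * s z ^ ?m)) * \<Psi> (0 + s z * x)"
          using AE_lborel_singleton[of "1::real"] AE_lborel_singleton[of "-1::real"]
        proof eventually_elim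
          case (elim x)
          show ?case
          proof (cases "x \<in> {-1..1}")
            case False
            then have "s z < \<bar>s z * x\<bar>" using sz by (auto simp: abs_mult)
            then show ?thesis using \<Psi>0 False by simp
          next
            case True
            then have r: "sqrt (1 - x\<^sup>2) > 0" using elim by (auto simp: abs_square_less_1 abs_less_iff)
            have "\<Theta> x = ennreal (1 / (V * (s z * sqrt (1 - x\<^sup>2)) ^ ?m)) * \<Psi> (0 + s z * x)"
              by (simp add: \<Theta>_def mult.commute)
            moreover have "ennreal (r ^ ?m / \<beta>) * (ennreal (1 / (V * (s z * r) ^ ?m)) * y) = ennreal (1 / (\<beta> * V * s z ^ ?m)) * y"
              if "r > 0" "\<beta> > 0" for r \<beta> :: real and y
            proof -
              have "ennreal (r ^ ?m / \<beta>) * ennreal (1 / (V * (s z * r) ^ ?m)) = ennreal (r ^ ?m / \<beta> * (1 / (V * (s z * r) ^ ?m)))"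
                using that V sz by (intro ennreal_mult[symmetric]) auto
              also have "r ^ ?m / \<beta> * (1 / (V * (s z * r) ^ ?m)) = 1 / (\<beta> * V * s z ^ ?m)"
                using that V sz by (simp add: field_simps)
              finally show ?thesis by (simp add: mult.assoc[symmetric])
            qed
            ultimately show ?thesis using True r Beta_pos[of ?m] by simp
          qed
        qed
      qed
      also have "\<dots> = ennreal (1 / (Beta (1 / 2) (real ?m / 2 + 1) * V * s z ^ ?m)) * (\<integral>\<^sup>+x. \<Psi> (0 + s z * x) \<partial>lborel)"
        by (rule nn_integral_cmult) simp
      also have "\<dots> = (ennreal \<bar>s z\<bar> * (\<integral>\<^sup>+x. \<Psi> (0 + s z * x) \<partial>lborel)) * ennreal (1 / (V * Beta (1 / 2) (real ?m / 2 + 1) * s z ^ Suc ?m))"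
      proof -
        have "ennreal (1 / (\<beta> * V * s z ^ ?m)) * y = (ennreal \<bar>s z\<bar> * y) * ennreal (1 / (V * \<beta> * s z ^ Suc ?m))" if "\<beta> > 0" for \<beta> :: real and y
        proof -
          have "1 / (\<beta> * V * s z ^ ?m) = \<bar>s z\<bar> * (1 / (V * \<beta> * s z ^ Suc ?m))" using sz V that by (simp add: field_simps)
          also have "ennreal \<dots> = ennreal \<bar>s z\<bar> * ennreal (1 / (V * \<beta> * s z ^ Suc ?m))"
            by (rule ennreal_mult) (use sz V that in auto)
          finally show ?thesis by (simp add: mult_ac)
        qed
        then show ?thesis using Beta_pos by blast
      qed
      also have "ennreal \<bar>s z\<bar> * (\<integral>\<^sup>+x. \<Psi> (0 + s z * x) \<partial>lborel) = (\<integral>\<^sup>+x. \<Psi> x \<partial>lborel)"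
        by (rule nn_integral_real_affine[symmetric]) (use sz in auto)
      also have "(\<integral>\<^sup>+x. \<Psi> x \<partial>lborel) = (\<integral>\<^sup>+y. f y * indicator (sball ?J (s z)) y \<partial>Leb ?J)"
        unfolding \<Psi>_def by (rule nn_integral_Leb_insert[OF I fi, symmetric])
      finally show ?thesis
        using sz V Beta_pos[of ?m] I
        by (subst emeasure_sball) (simp_all add: divide_ennreal_eq_mult unit_ball_vol_Suc V_def del: of_nat_Suc power_Suc)
    qed
    \<comment> \<open>A cost that is a sum over coordinates splits into the part of coordinate
      \<open>i\<close> and the cost of the lower-dimensional kernel. It is used for the squared
      distance and for the two second moments.\<close>
    have sumK: "(\<integral>\<^sup>+p. ennreal (\<Sum>j\<in>?J. w (fst p j) (snd p j)) \<partial>\<kappa> z) =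
        (\<integral>\<^sup>+u. ennreal (w (A z u) (s z * ?q u)) \<partial>unif) + (\<integral>\<^sup>+u. (\<integral>\<^sup>+p. ennreal (\<Sum>j\<in>I. w (fst p j) (snd p j)) \<partial>K u) \<partial>unif)"
      "(\<lambda>u. \<integral>\<^sup>+p. ennreal (\<Sum>j\<in>I. w (fst p j) (snd p j)) \<partial>K u) \<in> borel_measurable unif"
      if w [measurable]: "(\<lambda>(a, b). w a b) \<in> borel_measurable (borel \<Otimes>\<^sub>M borel)" and w0: "\<And>a b. 0 \<le> w a b" for w :: "real \<Rightarrow> real \<Rightarrow> real"
    proof -
      have Km: "K \<in> unif \<rightarrow>\<^sub>M subprob_algebra ?L2"
        unfolding K_def using measurable_prob_algebraD[OF measurable_compose[OF cnz \<kappa>0]] by (simp cong: measurable_cong_sets)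
      have wm: "(\<lambda>p. ennreal (\<Sum>j\<in>L. w (fst p j) (snd p j))) \<in> borel_measurable (Leb L \<Otimes>\<^sub>M Leb L)" for L :: "'i set"
      proof (intro measurable_compose[OF _ measurable_ennreal] borel_measurable_sum)
        fix j assume j: "j \<in> L"
        have "(\<lambda>p. (fst p j, snd p j)) \<in> Leb L \<Otimes>\<^sub>M Leb L \<rightarrow>\<^sub>M borel \<Otimes>\<^sub>M borel"
          using j by (intro measurable_Pair) (auto intro: measurable_compose[OF measurable_fst] measurable_compose[OF measurable_snd])
        from measurable_compose[OF this w] show "(\<lambda>p. w (fst p j) (snd p j)) \<in> borel_measurable (Leb L \<Otimes>\<^sub>M Leb L)" by simp
      qed
      show m2: "(\<lambda>u. \<integral>\<^sup>+p. ennreal (\<Sum>j\<in>I. w (fst p j) (snd p j)) \<partial>K u) \<in> borel_measurable unif"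
        by (rule nn_integral_measurable_subprob_algebra2[OF _ Km]) (use wm[of I] in \<open>simp add: split_beta'\<close>)
      have m1: "(\<lambda>u. ennreal (w (A z u) (s z * ?q u))) \<in> borel_measurable unif"
      proof -
        have "(\<lambda>u. (A z u, s z * ?q u)) \<in> borel \<rightarrow>\<^sub>M borel \<Otimes>\<^sub>M borel" by measurable
        from measurable_compose[OF this w] have [measurable]: "(\<lambda>u. w (A z u) (s z * ?q u)) \<in> borel_measurable borel" by simp
        have "(\<lambda>u. ennreal (w (A z u) (s z * ?q u))) \<in> borel_measurable borel" by measurable
        then show ?thesis by (simp cong: measurable_cong_sets)
      qed
      have "(\<integral>\<^sup>+p. ennreal (\<Sum>j\<in>?J. w (fst p j) (snd p j)) \<partial>\<kappa> z) =
         (\<integral>\<^sup>+u. (\<integral>\<^sup>+p. ennreal (\<Sum>j\<in>?J. w (fst (pr z u p) j) (snd (pr z u p) j)) \<partial>K u) \<partial>unif)"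
        unfolding K_def by (rule int\<kappa>[OF wm])
      also have "\<dots> = (\<integral>\<^sup>+u. ennreal (w (A z u) (s z * ?q u)) + (\<integral>\<^sup>+p. ennreal (\<Sum>j\<in>I. w (fst p j) (snd p j)) \<partial>K u) \<partial>unif)"
      proof (rule nn_integral_cong)
        fix u
        interpret Ku: prob_space "K u" using \<kappa>0s(2) by (simp add: K_def)
        have "(\<Sum>j\<in>?J. w (fst (pr z u p) j) (snd (pr z u p) j)) = w (A z u) (s z * ?q u) + (\<Sum>j\<in>I. w (fst p j) (snd p j))" for p
        proof -
          have "(\<Sum>j\<in>I. w (fst (pr z u p) j) (snd (pr z u p) j)) = (\<Sum>j\<in>I. w (fst p j) (snd p j))"
            using I(2) by (intro sum.cong) (auto simp: pr_def)
          then show ?thesis using I by (simp add: pr_def)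
        qed
        then have "(\<integral>\<^sup>+p. ennreal (\<Sum>j\<in>?J. w (fst (pr z u p) j) (snd (pr z u p) j)) \<partial>K u) =
          (\<integral>\<^sup>+p. ennreal (w (A z u) (s z * ?q u)) + ennreal (\<Sum>j\<in>I. w (fst p j) (snd p j)) \<partial>K u)"
          using w0 by (simp add: sum_nonneg)
        also have "\<dots> = (\<integral>\<^sup>+p. ennreal (w (A z u) (s z * ?q u)) \<partial>K u) + (\<integral>\<^sup>+p. ennreal (\<Sum>j\<in>I. w (fst p j) (snd p j)) \<partial>K u)"
          by (rule nn_integral_add) (use wm[of I] \<kappa>0s(1) in \<open>simp_all add: K_def cong: measurable_cong_sets\<close>)
        finally show "(\<integral>\<^sup>+p. ennreal (\<Sum>j\<in>?J. w (fst (pr z u p) j) (snd (pr z u p) j)) \<partial>K u) =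
          ennreal (w (A z u) (s z * ?q u)) + (\<integral>\<^sup>+p. ennreal (\<Sum>j\<in>I. w (fst p j) (snd p j)) \<partial>K u)"
          by (simp add: Ku.emeasure_space_1)
      qed
      also have "\<dots> = (\<integral>\<^sup>+u. ennreal (w (A z u) (s z * ?q u)) \<partial>unif) + (\<integral>\<^sup>+u. (\<integral>\<^sup>+p. ennreal (\<Sum>j\<in>I. w (fst p j) (snd p j)) \<partial>K u) \<partial>unif)"
        by (rule nn_integral_add[OF m1 m2])
      finally show "(\<integral>\<^sup>+p. ennreal (\<Sum>j\<in>?J. w (fst p j) (snd p j)) \<partial>\<kappa> z) = \<dots>" .
    qed
    have cost: "(\<integral>\<^sup>+p. ennreal (\<Sum>j\<in>?J. (fst p j - snd p j)\<^sup>2) \<partial>\<kappa> z) + ennreal (2 * (real (card ?J) / real (card ?J + 2)) * T * s z) \<le>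
       (\<integral>\<^sup>+p. ennreal (\<Sum>j\<in>?J. (fst p j)\<^sup>2) \<partial>\<kappa> z) + (\<integral>\<^sup>+p. ennreal (\<Sum>j\<in>?J. (snd p j)\<^sup>2) \<partial>\<kappa> z)"
      if T: "T > 0" and vT: "emeasure (Leb ?J) (slice D z) = ennreal (unit_ball_vol (real (card ?J)) * T ^ card ?J)" for T
    proof -
      \<comment> \<open>The volume radius of the section. In dimension zero a section of positive
        measure has volume 1 for every radius, and 1 is chosen because the estimate asks for a
        positive one.\<close>
      define t where "t a = (if ?m = 0 then 1 else root ?m (enn2real (g z a) / V))" for a
      have [measurable]: "t \<in> borel_measurable borel" unfolding t_def by measurable
      have t0: "0 \<le> t a" for a using V by (simp add: t_def)
      have tC: "t a \<le> max 1 (root ?m (C / V))" for a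
      proof -
        have "enn2real (g z a) \<le> C" using g_le[of z a] C0 by (intro enn2real_leI) auto
        then have "root ?m (enn2real (g z a) / V) \<le> root ?m (C / V)" if "?m \<noteq> 0"
          using V that by (intro real_root_le_mono divide_right_mono) auto
        then show ?thesis by (cases "?m = 0") (simp_all add: t_def le_max_iff_disj)
      qed
      have gV: "g z a = ennreal (V * t a ^ ?m)" "t a > 0" if ga: "g z a \<noteq> 0" for a
      proof -
        obtain r where r: "g z a = ennreal r" "r \<ge> 0" using g_le[of z a] by (cases "g z a") (auto simp: top_unique)
        have "r > 0" using r ga by (cases "r = 0") auto
        have "g z a = ennreal (V * t a ^ ?m) \<and> t a > 0"
        proof (cases "?m = 0")
          case True
          then have I0: "I = {}" using I(1) by simp
          have "Da z a \<subseteq> {\<lambda>_. undefined}" unfolding Da_def I0 by (auto simp: space_PiM)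
          moreover have "Da z a \<noteq> {}" using ga by (auto simp: g_def)
          ultimately have "Da z a = {\<lambda>_. undefined}" by blast
          then have "g z a = 1" unfolding g_def I0 by (simp add: PiM_empty)
          then show ?thesis using True by (simp add: t_def V_def)
        next
          case False
          then show ?thesis using r V \<open>r > 0\<close> by (simp add: t_def)
        qed
        then show "g z a = ennreal (V * t a ^ ?m)" "t a > 0" by simp_all
      qed
      have cJ: "card ?J = Suc ?m" using I by simp
      have vr: "enn2real (v z) = V * Beta (1 / 2) (real ?m / 2 + 1) * T ^ Suc ?m"
        using vT V T Beta_pos[of ?m] unfolding v_def cJ unit_ball_vol_Suc V_def by simp
      have gt: "G z a * Beta (1 / 2) (real ?m / 2 + 1) = t a ^ ?m / T ^ (?m + 1)" if "G z a > 0" for a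
      proof -
        have "g z a \<noteq> 0" using that by (auto simp: G_def)
        then have "enn2real (g z a) = V * t a ^ ?m" using gV(1)[of a] V t0[of a] by simp
        moreover have "V * x / (V * \<beta> * y) * \<beta> = x / y" if "\<beta> > 0" for x y \<beta> :: real using that V by (simp add: field_simps)
        ultimately show ?thesis unfolding G_def vr using Beta_pos[of ?m] by simp
      qed
      have GM: "G z a = 0" if "\<bar>M\<bar> < \<bar>a\<bar>" for a using g_M[OF that] by (simp add: G_def)
      let ?kt = "\<lambda>u. ennreal (2 * (real ?m / real (?m + 2)) * t (A z u) * (s z * ?h u))"
      let ?CI = "\<lambda>u. (\<integral>\<^sup>+p. ennreal (\<Sum>j\<in>I. (fst p j - snd p j)\<^sup>2) \<partial>K u)"
      let ?XI = "\<lambda>u. (\<integral>\<^sup>+p. ennreal (\<Sum>j\<in>I. (fst p j)\<^sup>2) \<partial>K u)"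
      let ?YI = "\<lambda>u. (\<integral>\<^sup>+p. ennreal (\<Sum>j\<in>I. (snd p j)\<^sup>2) \<partial>K u)"
      have key: "(\<integral>\<^sup>+u. ennreal ((A z u - s z * ?q u)\<^sup>2) \<partial>unif) + ennreal (2 * (real (?m + 1) / real (?m + 3)) * T * s z) \<le>
        (\<integral>\<^sup>+u. ennreal ((A z u)\<^sup>2) \<partial>unif) + (\<integral>\<^sup>+u. ennreal ((s z * ?q u)\<^sup>2) \<partial>unif) + (\<integral>\<^sup>+u. ?kt u \<partial>unif)"
        unfolding Aq
        by (rule knothe_step_cost[OF N_def Nz _ _ G0 GM t0 tC T sz gt]) measurable
      note sC = sumK[of "\<lambda>a b. (a - b)\<^sup>2"] and sX = sumK[of "\<lambda>a b. a\<^sup>2"] and sY = sumK[of "\<lambda>a b. b\<^sup>2"]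
      have ktm: "?kt \<in> borel_measurable unif"
      proof -
        have "?kt \<in> borel_measurable borel" by measurable
        then show ?thesis by (simp cong: measurable_cong_sets)
      qed
      have "(\<integral>\<^sup>+u. ?CI u \<partial>unif) + (\<integral>\<^sup>+u. ?kt u \<partial>unif) = (\<integral>\<^sup>+u. ?CI u + ?kt u \<partial>unif)"
        by (rule nn_integral_add[symmetric]) (use sC(2) ktm in simp_all)
      also have "\<dots> \<le> (\<integral>\<^sup>+u. ?XI u + ?YI u \<partial>unif)"
        using kk
      proof (intro nn_integral_mono_AE, eventually_elim)
        case (elim u)
        then have gu: "g z (A z u) \<noteq> 0" and kn: "knothe_kernel I D' (s z * ?h u) (case_nat u z) (K u)" by auto
        have "emeasure (Leb I) (slice D' (case_nat u z)) = ennreal (unit_ball_vol (real ?m) * t (A z u) ^ ?m)"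
          using gV(1)[OF gu] by (simp add: slD' g_def V_def)
        from knothe_kernelD(3)[OF kn gV(2)[OF gu] this] show ?case .
      qed
      also have "\<dots> = (\<integral>\<^sup>+u. ?XI u \<partial>unif) + (\<integral>\<^sup>+u. ?YI u \<partial>unif)"
        by (rule nn_integral_add) (use sX(2) sY(2) in simp_all)
      finally have ih: "(\<integral>\<^sup>+u. ?CI u \<partial>unif) + (\<integral>\<^sup>+u. ?kt u \<partial>unif) \<le> (\<integral>\<^sup>+u. ?XI u \<partial>unif) + (\<integral>\<^sup>+u. ?YI u \<partial>unif)" .
      \<comment> \<open>The term \<open>kt\<close> stands on the right in the estimate for
        coordinate \<open>i\<close> and on the left in the one for the slices. Chaining the two
        removes it without any subtraction.\<close>
      have comb: "(d + ci) + e \<le> (a + xi) + (b + yi)" if "d + e \<le> a + b + kt" "ci + kt \<le> xi + yi" for d e a b kt ci xi yi :: ennreal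
      proof -
        have "(d + ci) + e = (d + e) + ci" by (simp add: add_ac)
        also have "\<dots> \<le> (a + b + kt) + ci" by (intro add_right_mono that)
        also have "\<dots> = (a + b) + (ci + kt)" by (simp add: add_ac)
        also have "\<dots> \<le> (a + b) + (xi + yi)" by (intro add_left_mono that)
        finally show ?thesis by (simp add: add_ac)
      qed
      have ce: "real (card ?J) / real (card ?J + 2) = real (?m + 1) / real (?m + 3)" unfolding cJ by simp
      show ?thesis
        unfolding ce using comb[OF key ih] sC(1) sX(1) sY(1) by simp
    qed
    show ?thesis unfolding knothe_kernel_def using fstK sndK cost by blast
  qed
  show ?thesis using \<kappa>_meas main by blast
qed

text \<open>Each coordinate consumes one uniform variable. Degenerate parameters receive some
  probability measure, so that the kernel is total and can be averaged with
  \<open>bind\<close>.\<close>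

theorem knothe_kernel_exists:
  fixes I :: "'i set"
  assumes "finite I" "D \<in> sets (Par \<Otimes>\<^sub>M Leb I)" "s \<in> borel_measurable Par" "\<forall>p\<in>D. \<forall>j\<in>I. \<bar>snd p j\<bar> \<le> M"
  shows "\<exists>\<kappa>\<in>Par \<rightarrow>\<^sub>M prob_algebra (Leb I \<Otimes>\<^sub>M Leb I). \<forall>z. s z > 0 \<longrightarrow> emeasure (Leb I) (slice D z) \<noteq> 0 \<longrightarrow>
     knothe_kernel I D (s z) z (\<kappa> z)"
  using assms
proof (induction I arbitrary: D s rule: finite_induct)
  case empty
  have "(\<lambda>_. return (Leb {} \<Otimes>\<^sub>M Leb {}) ((\<lambda>_. undefined), (\<lambda>_. undefined))) \<in> Par \<rightarrow>\<^sub>M prob_algebra (Leb {} \<Otimes>\<^sub>M Leb ({} :: 'i set))"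
    by (rule measurable_const) (auto simp: space_prob_algebra space_pair_measure space_PiM intro!: prob_space_return)
  then show ?case
    by (rule bexI[rotated]) (intro allI impI knothe_kernel_empty)
next
  case (insert i I)
  show ?case by (rule knothe_kernel_insert[OF insert(1,2) insert(3) insert(4,5,6)])
qed


section \<open>Coupling a density with its rearrangement\<close>

text \<open>Layer cake with \<open>(norm y)\<^sup>2\<close> as the integral of \<open>2 * r\<close>
  up to \<open>norm y\<close>: what remains is the volume of shells, a polynomial in
  \<open>r\<close>. The factor \<open>n / (n + 2)\<close> is the one in the transport gain, so the
  two match exactly later.\<close>

lemma nn_integral_ball_moment:
  assumes T: "0 \<le> T"
  shows "(\<integral>\<^sup>+y. ennreal ((norm y)\<^sup>2) * indicator (cball 0 T) y \<partial>(lborel :: 'a::euclidean_space measure)) =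
    ennreal (real DIM('a) / real (DIM('a) + 2) * (unit_ball_vol (real DIM('a)) * T ^ DIM('a)) * T\<^sup>2)"
proof -
  let ?n = "DIM('a)" and ?V = "unit_ball_vol (real DIM('a))"
  have V: "0 < ?V" by simp
  have sq: "ennreal (a\<^sup>2) = (\<integral>\<^sup>+r. ennreal (2 * r) * indicator {0..a} r \<partial>lborel)" if "0 \<le> a" for a :: real
    using that by (subst nn_integral_FTC_Icc[where F="\<lambda>r. r\<^sup>2"]) (auto intro!: derivative_eq_intros)
  have mb [measurable]: "(\<lambda>y. indicator (cball 0 T :: 'a set) y :: ennreal) \<in> borel_measurable borel"
    by (intro borel_measurable_indicator) simp
  have "(\<integral>\<^sup>+y. ennreal ((norm y)\<^sup>2) * indicator (cball 0 T :: 'a set) y \<partial>lborel) =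
    (\<integral>\<^sup>+y. (\<integral>\<^sup>+r. ennreal (2 * r) * indicator {r. 0 \<le> r \<and> r \<le> norm y} r * indicator (cball 0 T :: 'a set) y \<partial>lborel) \<partial>lborel)"
    by (intro nn_integral_cong, subst nn_integral_multc) (simp_all add: sq atLeastAtMost_def atLeast_def atMost_def Collect_conj_eq)
  also have "\<dots> = (\<integral>\<^sup>+r. (\<integral>\<^sup>+y. ennreal (2 * r) * indicator {r. 0 \<le> r \<and> r \<le> norm y} r * indicator (cball 0 T :: 'a set) y \<partial>lborel) \<partial>lborel)"
  proof (rule lborel_pair.Fubini')
    have [measurable]: "(\<lambda>x. indicator (cball 0 T :: 'a set) (snd x) :: ennreal) \<in> borel_measurable ((borel :: real measure) \<Otimes>\<^sub>M borel)"
      by (rule measurable_compose[OF measurable_snd mb])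
    have [measurable]: "(\<lambda>x. indicator {r. 0 \<le> r \<and> r \<le> norm (snd x)} (fst x) :: ennreal) \<in> borel_measurable ((borel :: real measure) \<Otimes>\<^sub>M (borel :: 'a measure))"
      unfolding indicator_def by simp
    have "(\<lambda>x. ennreal (2 * fst x) * indicator {r. 0 \<le> r \<and> r \<le> norm (snd x)} (fst x) * indicator (cball 0 T :: 'a set) (snd x))
      \<in> borel_measurable ((borel :: real measure) \<Otimes>\<^sub>M borel)"
      by measurable
    then show "(\<lambda>(r, y). ennreal (2 * r) * indicator {r. 0 \<le> r \<and> r \<le> norm y} r * indicator (cball 0 T :: 'a set) y) \<in> borel_measurable (lborel \<Otimes>\<^sub>M lborel)"
      by (simp add: split_beta' cong: measurable_cong_sets)
  qed
  also have "\<dots> = (\<integral>\<^sup>+r. ennreal (2 * r * (?V * (T ^ ?n - r ^ ?n))) * indicator {0..T} r \<partial>lborel)"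
  proof (rule nn_integral_cong)
    fix r :: real
    show "(\<integral>\<^sup>+y. ennreal (2 * r) * indicator {r. 0 \<le> r \<and> r \<le> norm y} r * indicator (cball 0 T :: 'a set) y \<partial>lborel) =
      ennreal (2 * r * (?V * (T ^ ?n - r ^ ?n))) * indicator {0..T} r"
    proof (cases "0 \<le> r \<and> r \<le> T")
      case True
      have "(\<integral>\<^sup>+y. ennreal (2 * r) * indicator {r. 0 \<le> r \<and> r \<le> norm y} r * indicator (cball 0 T :: 'a set) y \<partial>lborel) =
        (\<integral>\<^sup>+y. ennreal (2 * r) * indicator (cball 0 T - ball 0 r :: 'a set) y \<partial>lborel)"
        using True by (intro nn_integral_cong) (auto simp: indicator_def)
      also have "\<dots> = ennreal (2 * r) * emeasure lborel (cball 0 T - ball 0 r :: 'a set)"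
        by (rule nn_integral_cmult_indicator) auto
      also have "emeasure lborel (cball 0 T - ball 0 r :: 'a set) = ennreal (?V * (T ^ ?n - r ^ ?n))"
      proof (subst emeasure_Diff)
        show "ball (0::'a) r \<subseteq> cball 0 T" using True by auto
        show "emeasure lborel (cball (0::'a) T) - emeasure lborel (ball (0::'a) r) = ennreal (?V * (T ^ ?n - r ^ ?n))"
          using True by (simp add: emeasure_cball emeasure_ball ennreal_minus[symmetric] right_diff_distrib)
      qed (use True in \<open>auto simp: emeasure_ball\<close>)
      also have "ennreal (2 * r) * ennreal (?V * (T ^ ?n - r ^ ?n)) = ennreal (2 * r * (?V * (T ^ ?n - r ^ ?n)))"
        using True V by (intro ennreal_mult[symmetric]) (auto intro!: mult_nonneg_nonneg power_mono)
      finally show ?thesis using True by simp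
    next
      case False
      have "ennreal (2 * r) * indicator {r. 0 \<le> r \<and> r \<le> norm y} r * indicator (cball 0 T :: 'a set) y = 0" for y :: 'a
        using False by (auto simp: indicator_def)
      then have "(\<integral>\<^sup>+y. ennreal (2 * r) * indicator {r. 0 \<le> r \<and> r \<le> norm y} r * indicator (cball 0 T :: 'a set) y \<partial>lborel) =
        (\<integral>\<^sup>+y. 0 \<partial>(lborel :: 'a measure))"
        by (simp only:)
      then show ?thesis using False by simp
    qed
  qed
  also have "\<dots> = ennreal (?V * (T ^ ?n * T\<^sup>2 - 2 / real (?n + 2) * T ^ (?n + 2)) - ?V * (T ^ ?n * 0\<^sup>2 - 2 / real (?n + 2) * 0 ^ (?n + 2)))"
  proof (rule nn_integral_FTC_Icc[where F="\<lambda>r. ?V * (T ^ ?n * r\<^sup>2 - 2 / real (?n + 2) * r ^ (?n + 2))"])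
    fix r :: real assume r: "r \<in> {0..T}"
    have "((\<lambda>r. ?V * (T ^ ?n * r\<^sup>2 - 2 / real (?n + 2) * r ^ (?n + 2))) has_real_derivative
      ?V * (T ^ ?n * (2 * r) - 2 / real (?n + 2) * (real (?n + 2) * r ^ (?n + 1)))) (at r)"
    proof -
      have d: "((\<lambda>r. r ^ (?n + 2)) has_real_derivative real (?n + 2) * r ^ (?n + 1)) (at r)"
        using DERIV_pow[of "?n + 2" r] by simp
      have d2: "((\<lambda>r. r\<^sup>2) has_real_derivative 2 * r) (at r)" by (auto intro!: derivative_eq_intros)
      show ?thesis by (intro DERIV_cmult DERIV_diff d d2)
    qed
    also have "?V * (T ^ ?n * (2 * r) - 2 / real (?n + 2) * (real (?n + 2) * r ^ (?n + 1))) = 2 * r * (?V * (T ^ ?n - r ^ ?n))"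
      by (simp add: field_simps)
    finally show "((\<lambda>r. ?V * (T ^ ?n * r\<^sup>2 - 2 / real (?n + 2) * r ^ (?n + 2))) has_real_derivative 2 * r * (?V * (T ^ ?n - r ^ ?n))) (at r)" .
    show "0 \<le> 2 * r * (?V * (T ^ ?n - r ^ ?n))" using r V by (auto intro!: mult_nonneg_nonneg power_mono)
  qed (use T in auto)
  also have "?V * (T ^ ?n * T\<^sup>2 - 2 / real (?n + 2) * T ^ (?n + 2)) - ?V * (T ^ ?n * 0\<^sup>2 - 2 / real (?n + 2) * 0 ^ (?n + 2))
     = real ?n / real (?n + 2) * (?V * T ^ ?n) * T\<^sup>2"
    by (simp add: power_add field_simps power2_eq_square)
  finally show ?thesis .
qed

section \<open>Euclidean vectors and their coordinate functions\<close>

definition of_coords :: "('a::euclidean_space \<Rightarrow> real) \<Rightarrow> 'a" where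
  "of_coords f = (\<Sum>b\<in>Basis. f b *\<^sub>R b)"

lemma of_coords_inner: "b \<in> Basis \<Longrightarrow> of_coords f \<bullet> b = f b"
  by (simp add: of_coords_def)

lemma norm_of_coords: "(norm (of_coords f))\<^sup>2 = (\<Sum>b\<in>Basis. (f b)\<^sup>2)"
  unfolding power2_norm_eq_inner
  by (subst euclidean_inner) (simp add: of_coords_inner power2_eq_square)

lemma dist_of_coords: "(dist (of_coords f) (of_coords g))\<^sup>2 = (\<Sum>b\<in>Basis. (f b - g b)\<^sup>2)"
proof -
  have "of_coords f - of_coords g = of_coords (\<lambda>b. f b - g b)"
    by (simp add: of_coords_def sum_subtractf scaleR_diff_left)
  then show ?thesis by (simp add: dist_norm norm_of_coords)
qed

lemma measurable_of_coords [measurable]: "of_coords \<in> borel_measurable (Leb Basis)"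
  unfolding of_coords_def by measurable

lemma nn_integral_of_coords:
  assumes [measurable]: "f \<in> borel_measurable borel"
  shows "(\<integral>\<^sup>+x. f (of_coords x) \<partial>Leb Basis) = (\<integral>\<^sup>+x. f x \<partial>lborel)"
proof -
  have "(\<integral>\<^sup>+x. f x \<partial>lborel) = (\<integral>\<^sup>+x. f x \<partial>distr (Leb Basis) borel of_coords)"
    unfolding of_coords_def[abs_def] by (subst lborel_eq) simp
  then show ?thesis by (simp add: nn_integral_distr)
qed

text \<open>
  The superlevel sets of \<open>\<rho>\<close> and of its rearrangement are coupled level by level; the level is
  the initial parameter of the Knothe kernel.
\<close>

theorem layered_coupling:
  fixes \<rho> :: "'a::euclidean_space \<Rightarrow> real"
  assumes \<rho>: "bounded_density B R \<rho>" and mass: "(\<integral>\<^sup>+x. ennreal (\<rho> x) \<partial>lborel) = 1"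
  obtains P where "P \<in> couplings (density_measure \<rho>) (density_measure (rearrange \<rho>))"
    "(\<integral>\<^sup>+p. ennreal ((dist (fst p) (snd p))\<^sup>2) \<partial>P) + (\<integral>\<^sup>+y. ennreal (rearrange \<rho> y) * ennreal ((norm y)\<^sup>2) \<partial>lborel)
      \<le> (\<integral>\<^sup>+x. ennreal (\<rho> x) * ennreal ((norm x)\<^sup>2) \<partial>lborel)"
proof -
  let ?n = "DIM('a)" and ?I = "Basis :: 'a set" and ?V = "unit_ball_vol (real DIM('a))"
  have V: "0 < ?V" by simp
  note [measurable] = bounded_densityD(1)[OF \<rho>] borel_measurable_rearrange[OF \<rho>]
  let ?c = "of_coords :: ('a \<Rightarrow> real) \<Rightarrow> 'a"
  define \<mu> where "\<mu> h = emeasure lborel {x. \<rho> x > h}" for h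
  have \<mu>m [measurable]: "\<mu> \<in> borel_measurable borel" unfolding \<mu>_def[abs_def] by measurable
  have \<mu>fin: "\<mu> h < \<infinity>" if "h > 0" for h using emeasure_superlevel_finite[OF \<rho> that] by (simp add: \<mu>_def)
  have \<mu>int: "(\<integral>\<^sup>+h. indicator {0<..} h * \<mu> h \<partial>lborel) = 1"
    using nn_integral_layers[OF \<rho>, of "\<lambda>_. 1"] mass by (simp add: \<mu>_def)
  define T where "T h = root ?n (enn2real (\<mu> h) / ?V)" for h
  have [measurable]: "T \<in> borel_measurable borel" unfolding T_def by measurable
  have T: "\<mu> h = ennreal (?V * T h ^ ?n)" "T h > 0" if hp: "h > 0" and h0: "\<mu> h \<noteq> 0" for h
  proof -
    obtain r where r: "\<mu> h = ennreal r" "r \<ge> 0" using \<mu>fin[OF hp] by (cases "\<mu> h") auto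
    have "r > 0" using r h0 by (cases "r = 0") auto
    then show "T h > 0" using r V by (simp add: T_def)
    have Tn: "T h ^ ?n = r / ?V" using r V by (simp add: T_def)
    have "?V * T h ^ ?n = r" unfolding Tn using V by (metis less_irrefl nonzero_mult_div_cancel_left times_divide_eq_right)
    then show "\<mu> h = ennreal (?V * T h ^ ?n)" using r(1) by (simp only:)
  qed
  \<comment> \<open>The level is stored in position 0 of the parameter sequence, so one measurable
    set carries all superlevel sets and one kernel couples them simultaneously.\<close>
  define D where "D = {p \<in> space (Par \<Otimes>\<^sub>M Leb ?I). 0 < fst p 0 \<and> fst p 0 < \<rho> (?c (snd p))}"
  have D: "D \<in> sets (Par \<Otimes>\<^sub>M Leb ?I)" unfolding D_def by measurable
  have DR: "\<forall>p\<in>D. \<forall>j\<in>?I. \<bar>snd p j\<bar> \<le> R"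
  proof (intro ballI)
    fix p and j :: 'a assume p: "p \<in> D" and j: "j \<in> Basis"
    have "\<bar>snd p j\<bar> \<le> norm (?c (snd p))" using Basis_le_norm[OF j, of "?c (snd p)"] by (simp add: of_coords_inner j)
    also have "\<dots> \<le> R" using p bounded_densityD(4)[OF \<rho>, of "?c (snd p)"] by (force simp: D_def not_le[symmetric])
    finally show "\<bar>snd p j\<bar> \<le> R" .
  qed
  have sm: "(\<lambda>\<zeta>. T (\<zeta> 0)) \<in> borel_measurable Par" by measurable
  obtain \<kappa> where \<kappa> [measurable]: "\<kappa> \<in> Par \<rightarrow>\<^sub>M prob_algebra (Leb ?I \<Otimes>\<^sub>M Leb ?I)"
    and \<kappa>K: "\<And>\<zeta>. T (\<zeta> 0) > 0 \<Longrightarrow> emeasure (Leb ?I) (slice D \<zeta>) \<noteq> 0 \<Longrightarrow> knothe_kernel ?I D (T (\<zeta> 0)) \<zeta> (\<kappa> \<zeta>)"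
    using knothe_kernel_exists[OF finite_Basis D sm DR] by blast
  \<comment> \<open>A constant sequence; only its entry at position 0 enters \<open>D\<close> and
    the radius.\<close>
  define K where "K h = \<kappa> (\<lambda>_. h)" for h :: real
  have Km: "K \<in> borel \<rightarrow>\<^sub>M prob_algebra (Leb ?I \<Otimes>\<^sub>M Leb ?I)"
  proof -
    have "(\<lambda>h _. h) \<in> borel \<rightarrow>\<^sub>M Par" by (rule measurable_PiM_single') auto
    from measurable_compose[OF this \<kappa>] show ?thesis by (simp add: K_def[abs_def])
  qed
  have sl: "(\<integral>\<^sup>+x. f (?c x) * indicator (slice D (\<lambda>_. h)) x \<partial>Leb ?I) = (\<integral>\<^sup>+x. f x * indicator {x. \<rho> x > h} x \<partial>lborel)"
    if h: "h > 0" and [measurable]: "f \<in> borel_measurable borel" for h f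
  proof -
    have "(\<integral>\<^sup>+x. f (?c x) * indicator (slice D (\<lambda>_. h)) x \<partial>Leb ?I) = (\<integral>\<^sup>+x. f (?c x) * indicator {x. \<rho> x > h} (?c x) \<partial>Leb ?I)"
      using h by (intro nn_integral_cong) (auto simp: slice_def D_def space_pair_measure space_PiM indicator_def)
    also have "\<dots> = (\<integral>\<^sup>+x. f x * indicator {x. \<rho> x > h} x \<partial>lborel)"
      by (rule nn_integral_of_coords) measurable
    finally show ?thesis .
  qed
  have sl\<mu>: "emeasure (Leb ?I) (slice D (\<lambda>_. h)) = \<mu> h" if h: "h > 0" for h
    using sl[OF h, of "\<lambda>_. 1"] sets_slice[OF D, of "\<lambda>_. h"] by (simp add: \<mu>_def)
  have bl: "(\<integral>\<^sup>+x. f (?c x) * indicator (sball ?I t) x \<partial>Leb ?I) = (\<integral>\<^sup>+x. f x * indicator (cball 0 t) x \<partial>lborel)"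
    if t: "t > 0" and [measurable]: "f \<in> borel_measurable borel" for t f
  proof -
    have "(\<integral>\<^sup>+x. f (?c x) * indicator (sball ?I t) x \<partial>Leb ?I) = (\<integral>\<^sup>+x. f (?c x) * indicator (cball 0 t) (?c x) \<partial>Leb ?I)"
    proof (intro nn_integral_cong arg_cong2[where f="(*)"] refl)
      fix x assume x: "x \<in> space (Leb ?I)"
      have "norm (?c x) \<le> t \<longleftrightarrow> (norm (?c x))\<^sup>2 \<le> t\<^sup>2" using t by (simp add: power_mono_iff)
      then show "(indicator (sball ?I t) x :: ennreal) = indicator (cball 0 t) (?c x)"
        using x by (simp add: sball_def norm_of_coords[symmetric] indicator_def)
    qed
    also have "\<dots> = (\<integral>\<^sup>+x. f x * indicator (cball 0 t) x \<partial>lborel)"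
    proof (rule nn_integral_of_coords)
      have [measurable]: "(\<lambda>y. indicator (cball 0 t :: 'a set) y :: ennreal) \<in> borel_measurable borel"
        by (intro borel_measurable_indicator) simp
      show "(\<lambda>x. f x * indicator (cball 0 t) x) \<in> borel_measurable borel" by measurable
    qed
    finally show ?thesis .
  qed
  have emb: "emeasure (Leb ?I) (sball ?I (T h)) = \<mu> h" if "h > 0" "\<mu> h \<noteq> 0" for h
    using T[OF that] by (subst emeasure_sball) simp_all
  \<comment> \<open>The law of the level, a probability because the layer-cake formula gives
    \<open>\<mu>\<close> total mass one. Given the level, the two points are drawn from the
    superlevel set and from its ball.\<close>
  define Q where "Q = density lborel (\<lambda>h. indicator {0<..} h * \<mu> h)"
  have Q: "prob_space Q"
    by (rule prob_spaceI) (simp add: Q_def emeasure_density \<mu>int)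
  have Qs: "sets Q = sets borel" by (simp add: Q_def)
  let ?p = "\<lambda>p. (?c (fst p), ?c (snd p))" and ?B2 = "(borel :: 'a measure) \<Otimes>\<^sub>M (borel :: 'a measure)"
  define P where "P = distr (Q \<bind> K) ?B2 ?p"
  have pm: "?p \<in> Leb ?I \<Otimes>\<^sub>M Leb ?I \<rightarrow>\<^sub>M ?B2" by measurable
  have KQ: "K \<in> Q \<rightarrow>\<^sub>M subprob_algebra (Leb ?I \<Otimes>\<^sub>M Leb ?I)"
    using measurable_prob_algebraD[OF Km] Qs by (simp cong: measurable_cong_sets)
  have Ks: "sets (K h) = sets (Leb ?I \<Otimes>\<^sub>M Leb ?I)" "prob_space (K h)" for h
    using measurable_space[OF Km, of h] by (simp_all add: space_prob_algebra)
  have QK: "sets (Q \<bind> K) = sets (Leb ?I \<Otimes>\<^sub>M Leb ?I)"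
    by (rule sets_bind) (use Ks Q in \<open>auto simp: prob_space.not_empty\<close>)
  have intP: "(\<integral>\<^sup>+p. F p \<partial>P) = (\<integral>\<^sup>+h. indicator {0<..} h * \<mu> h * (\<integral>\<^sup>+p. F (?p p) \<partial>K h) \<partial>lborel)"
    if F [measurable]: "F \<in> borel_measurable ?B2" for F
  proof -
    have "(\<integral>\<^sup>+p. F p \<partial>P) = (\<integral>\<^sup>+p. F (?p p) \<partial>(Q \<bind> K))"
    proof -
      have "?p \<in> (Q \<bind> K) \<rightarrow>\<^sub>M ?B2" using pm QK by (simp cong: measurable_cong_sets)
      from nn_integral_distr[OF this] show ?thesis by (simp add: P_def F)
    qed
    also have "\<dots> = (\<integral>\<^sup>+h. (\<integral>\<^sup>+p. F (?p p) \<partial>K h) \<partial>Q)"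
      by (rule nn_integral_bind[OF measurable_compose[OF pm F] KQ])
    also have "\<dots> = (\<integral>\<^sup>+h. indicator {0<..} h * \<mu> h * (\<integral>\<^sup>+p. F (?p p) \<partial>K h) \<partial>lborel)"
      unfolding Q_def
    proof (rule nn_integral_density)
      have "(\<lambda>h. \<integral>\<^sup>+p. F (?p p) \<partial>K h) \<in> borel_measurable borel"
        by (rule nn_integral_measurable_subprob_algebra2[OF _ measurable_prob_algebraD[OF Km]])
          (use measurable_compose[OF measurable_snd measurable_compose[OF pm F]] in \<open>simp add: split_beta'\<close>)
      then show "(\<lambda>h. \<integral>\<^sup>+p. F (?p p) \<partial>K h) \<in> borel_measurable lborel" by simp
    qed simp
    finally show ?thesis .
  qed
  have Kh: "knothe_kernel ?I D (T h) (\<lambda>_. h) (K h)" if "h > 0" "\<mu> h \<noteq> 0" for h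
    unfolding K_def using T(2)[OF that] \<kappa>K[of "\<lambda>_. h"] sl\<mu>[OF that(1)] that(2) by simp
  have cancel: "\<mu> h * (x / \<mu> h) = x" if "h > 0" "\<mu> h \<noteq> 0" for h x
    using ennreal_divide_self[of "\<mu> h"] that \<mu>fin[OF that(1)] by (simp add: divide_ennreal_def mult.left_commute[of "\<mu> h"])
  have null: "(\<integral>\<^sup>+x. f x * indicator S x \<partial>lborel) = 0" if "emeasure lborel S = 0" "S \<in> sets borel" for f :: "'a \<Rightarrow> ennreal" and S
  proof -
    have "AE x in lborel. x \<notin> S" using that by (intro AE_not_in) (simp add: null_sets_def)
    then have "(\<integral>\<^sup>+x. f x * indicator S x \<partial>lborel) = (\<integral>\<^sup>+x. 0 \<partial>(lborel :: 'a measure))"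
      by (intro nn_integral_cong_AE) (auto elim!: eventually_mono)
    then show ?thesis by simp
  qed
  have fstP: "(\<integral>\<^sup>+p. f (fst p) \<partial>P) = (\<integral>\<^sup>+x. ennreal (\<rho> x) * f x \<partial>lborel)" if f [measurable]: "f \<in> borel_measurable borel" for f
  proof -
    have "(\<integral>\<^sup>+p. f (fst p) \<partial>P) = (\<integral>\<^sup>+h. indicator {0<..} h * \<mu> h * (\<integral>\<^sup>+p. f (?c (fst p)) \<partial>K h) \<partial>lborel)"
      by (subst intP) simp_all
    also have "\<dots> = (\<integral>\<^sup>+h. indicator {0<..} h * (\<integral>\<^sup>+x. f x * indicator {x. \<rho> x > h} x \<partial>lborel) \<partial>lborel)"
    proof (rule nn_integral_cong)
      fix h :: real
      show "indicator {0<..} h * \<mu> h * (\<integral>\<^sup>+p. f (?c (fst p)) \<partial>K h) = indicator {0<..} h * (\<integral>\<^sup>+x. f x * indicator {x. \<rho> x > h} x \<partial>lborel)"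
      proof (cases "h > 0")
        case h: True
        show ?thesis
        proof (cases "\<mu> h = 0")
          case True
          then show ?thesis using null[of "{x. \<rho> x > h}" f] by (simp add: \<mu>_def)
        next
          case False
          have "(\<integral>\<^sup>+p. f (?c (fst p)) \<partial>K h) = (\<integral>\<^sup>+x. f x * indicator {x. \<rho> x > h} x \<partial>lborel) / \<mu> h"
            using knothe_kernelD(1)[OF Kh[OF h False] measurable_compose[OF measurable_of_coords f]]
            by (simp only: sl[OF h f] sl\<mu>[OF h])
          then show ?thesis using h cancel[OF h False] by simp
        qed
      qed simp
    qed
    also have "\<dots> = (\<integral>\<^sup>+x. ennreal (\<rho> x) * f x \<partial>lborel)"
      by (rule nn_integral_layers[OF \<rho> f, symmetric])
    finally show ?thesis .
  qed
  have sndP: "(\<integral>\<^sup>+p. f (snd p) \<partial>P) = (\<integral>\<^sup>+x. ennreal (rearrange \<rho> x) * f x \<partial>lborel)" if f [measurable]: "f \<in> borel_measurable borel" for f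
  proof -
    have "(\<integral>\<^sup>+p. f (snd p) \<partial>P) = (\<integral>\<^sup>+h. indicator {0<..} h * \<mu> h * (\<integral>\<^sup>+p. f (?c (snd p)) \<partial>K h) \<partial>lborel)"
      by (subst intP) simp_all
    also have "\<dots> = (\<integral>\<^sup>+h. indicator {0<..} h * (\<integral>\<^sup>+x. f x * indicator {x. ennreal (?V * norm x ^ ?n) < emeasure lborel {y. \<rho> y > h}} x \<partial>lborel) \<partial>lborel)"
    proof (rule nn_integral_cong)
      fix h :: real
      show "indicator {0<..} h * \<mu> h * (\<integral>\<^sup>+p. f (?c (snd p)) \<partial>K h) = indicator {0<..} h *
        (\<integral>\<^sup>+x. f x * indicator {x. ennreal (?V * norm x ^ ?n) < emeasure lborel {y. \<rho> y > h}} x \<partial>lborel)"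
      proof (cases "h > 0")
        case h: True
        show ?thesis
        proof (cases "\<mu> h = 0")
          case True
          then show ?thesis by (simp add: \<mu>_def)
        next
          case False
          have "(\<integral>\<^sup>+p. f (?c (snd p)) \<partial>K h) = (\<integral>\<^sup>+x. f x * indicator (cball 0 (T h)) x \<partial>lborel) / \<mu> h"
            using knothe_kernelD(2)[OF Kh[OF h False] measurable_compose[OF measurable_of_coords f]]
            by (simp only: bl[OF T(2)[OF h False] f] emb[OF h False])
          moreover have "(\<integral>\<^sup>+x. f x * indicator (cball 0 (T h)) x \<partial>lborel) =
            (\<integral>\<^sup>+x. f x * indicator {x. ennreal (?V * norm x ^ ?n) < emeasure lborel {y. \<rho> y > h}} x \<partial>lborel)"
          proof (rule nn_integral_cong_AE)
            \<comment> \<open>The kernel has a closed ball as its second marginal, while the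
              rearrangement is built from open ones; they differ by a null sphere.\<close>
            have "sphere (0::'a) (T h) \<in> null_sets lborel"
              using negligible_sphere[of "0::'a" "T h"] by (auto simp: null_sets_completion_iff negligible_iff_null_sets)
            then have "AE x in lborel. x \<notin> sphere (0::'a) (T h)" by (rule AE_not_in)
            then show "AE x in lborel. f x * indicator (cball 0 (T h)) x =
              f x * indicator {x. ennreal (?V * norm x ^ ?n) < emeasure lborel {y. \<rho> y > h}} x"
            proof eventually_elim
              case (elim x)
              have "ennreal (?V * norm x ^ ?n) < \<mu> h \<longleftrightarrow> norm x ^ ?n < T h ^ ?n"
                unfolding T(1)[OF h False] using V T(2)[OF h False] by (simp add: ennreal_less_iff mult_less_cancel_left_pos)
              also have "\<dots> \<longleftrightarrow> norm x < T h"
                using T(2)[OF h False] power_mono_iff[of "T h" "norm x" ?n] by (simp add: not_le[symmetric])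
              finally show ?case using elim by (auto simp: \<mu>_def indicator_def)
            qed
          qed
          ultimately show ?thesis using h cancel[OF h False] by simp
        qed
      qed simp
    qed
    also have "\<dots> = (\<integral>\<^sup>+x. ennreal (rearrange \<rho> x) * f x \<partial>lborel)"
      by (rule nn_integral_rearrange[OF \<rho> f, symmetric])
    finally show ?thesis .
  qed
  have Ps: "sets P = sets ?B2" by (simp add: P_def)
  have "distr P (density_measure \<rho>) fst = density_measure \<rho>"
  proof (rule measure_eqI)
    fix A assume "A \<in> sets (distr P (density_measure \<rho>) fst)"
    then have [measurable]: "A \<in> sets borel" by simp
    have "fst \<in> P \<rightarrow>\<^sub>M density_measure \<rho>" using Ps by (simp cong: measurable_cong_sets)
    then have "emeasure (distr P (density_measure \<rho>) fst) A = (\<integral>\<^sup>+p. indicator A (fst p) \<partial>P)"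
      by (subst nn_integral_indicator[symmetric], simp, subst nn_integral_distr) simp_all
    also have "\<dots> = emeasure (density_measure \<rho>) A"
      by (subst fstP) (simp_all add: emeasure_density)
    finally show "emeasure (distr P (density_measure \<rho>) fst) A = emeasure (density_measure \<rho>) A" .
  qed simp
  moreover have "distr P (density_measure (rearrange \<rho>)) snd = density_measure (rearrange \<rho>)"
  proof (rule measure_eqI)
    fix A assume "A \<in> sets (distr P (density_measure (rearrange \<rho>)) snd)"
    then have [measurable]: "A \<in> sets borel" by simp
    have "snd \<in> P \<rightarrow>\<^sub>M density_measure (rearrange \<rho>)" using Ps by (simp cong: measurable_cong_sets)
    then have "emeasure (distr P (density_measure (rearrange \<rho>)) snd) A = (\<integral>\<^sup>+p. indicator A (snd p) \<partial>P)"
      by (subst nn_integral_indicator[symmetric], simp, subst nn_integral_distr) simp_all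
    also have "\<dots> = emeasure (density_measure (rearrange \<rho>)) A"
      by (subst sndP) (simp_all add: emeasure_density)
    finally show "emeasure (distr P (density_measure (rearrange \<rho>)) snd) A = emeasure (density_measure (rearrange \<rho>)) A" .
  qed simp
  moreover have "sets P = sets (density_measure \<rho> \<Otimes>\<^sub>M density_measure (rearrange \<rho>))"
    unfolding Ps by (intro sets_pair_measure_cong) simp_all
  ultimately have "P \<in> couplings (density_measure \<rho>) (density_measure (rearrange \<rho>))"
    by (simp add: couplings_def)
  moreover have "(\<integral>\<^sup>+p. ennreal ((dist (fst p) (snd p))\<^sup>2) \<partial>P) + (\<integral>\<^sup>+y. ennreal (rearrange \<rho> y) * ennreal ((norm y)\<^sup>2) \<partial>lborel)
      \<le> (\<integral>\<^sup>+x. ennreal (\<rho> x) * ennreal ((norm x)\<^sup>2) \<partial>lborel)"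
  proof -
    have "(\<integral>\<^sup>+p. ennreal ((dist (fst p) (snd p))\<^sup>2) \<partial>P) + (\<integral>\<^sup>+y. ennreal (rearrange \<rho> y) * ennreal ((norm y)\<^sup>2) \<partial>lborel)
      = (\<integral>\<^sup>+p. ennreal ((dist (fst p) (snd p))\<^sup>2) \<partial>P) + (\<integral>\<^sup>+p. ennreal ((norm (snd p))\<^sup>2) \<partial>P)"
      by (subst sndP[of "\<lambda>y. ennreal ((norm y)\<^sup>2)"]) simp_all
    also have "\<dots> = (\<integral>\<^sup>+p. ennreal ((dist (fst p) (snd p))\<^sup>2) + ennreal ((norm (snd p))\<^sup>2) \<partial>P)"
      using Ps by (intro nn_integral_add[symmetric]) (simp_all cong: measurable_cong_sets)
    also have "\<dots> = (\<integral>\<^sup>+h. indicator {0<..} h * \<mu> h * (\<integral>\<^sup>+p. ennreal (\<Sum>b\<in>?I. (fst p b - snd p b)\<^sup>2) + ennreal (\<Sum>b\<in>?I. (snd p b)\<^sup>2) \<partial>K h) \<partial>lborel)"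
      by (subst intP) (simp_all add: dist_of_coords norm_of_coords)
    also have "\<dots> \<le> (\<integral>\<^sup>+h. indicator {0<..} h * \<mu> h * (\<integral>\<^sup>+p. ennreal (\<Sum>b\<in>?I. (fst p b)\<^sup>2) \<partial>K h) \<partial>lborel)"
    proof (rule nn_integral_mono)
      fix h :: real
      show "indicator {0<..} h * \<mu> h * (\<integral>\<^sup>+p. ennreal (\<Sum>b\<in>?I. (fst p b - snd p b)\<^sup>2) + ennreal (\<Sum>b\<in>?I. (snd p b)\<^sup>2) \<partial>K h)
        \<le> indicator {0<..} h * \<mu> h * (\<integral>\<^sup>+p. ennreal (\<Sum>b\<in>?I. (fst p b)\<^sup>2) \<partial>K h)"
      proof (cases "h > 0 \<and> \<mu> h \<noteq> 0")
        case True
        then have h: "h > 0" "\<mu> h \<noteq> 0" by auto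
        let ?e = "real ?n / real (?n + 2) * (T h)\<^sup>2"
        let ?Y = "(\<integral>\<^sup>+p. ennreal (\<Sum>b\<in>?I. (snd p b)\<^sup>2) \<partial>K h)"
        let ?X = "(\<integral>\<^sup>+p. ennreal (\<Sum>b\<in>?I. (fst p b)\<^sup>2) \<partial>K h)"
        let ?C = "(\<integral>\<^sup>+p. ennreal (\<Sum>b\<in>?I. (fst p b - snd p b)\<^sup>2) \<partial>K h)"
        have fm: "(\<lambda>y::'a. ennreal ((norm y)\<^sup>2)) \<in> borel_measurable borel" by measurable
        have "?Y = (\<integral>\<^sup>+p. ennreal ((norm (?c (snd p)))\<^sup>2) \<partial>K h)" by (simp add: norm_of_coords)
        also have "\<dots> = (\<integral>\<^sup>+y. ennreal ((norm y)\<^sup>2) * indicator (cball 0 (T h)) y \<partial>(lborel :: 'a measure)) / \<mu> h"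
          using knothe_kernelD(2)[OF Kh[OF h] measurable_compose[OF measurable_of_coords fm]]
          by (simp only: bl[OF T(2)[OF h] fm] emb[OF h])
        also have "\<dots> = ennreal (?e * (?V * T h ^ ?n)) / ennreal (?V * T h ^ ?n)"
          using T[OF h] by (subst nn_integral_ball_moment) (simp_all add: mult_ac)
        also have "\<dots> = ennreal ?e"
        proof -
          have ek: "ennreal (e * k) / ennreal k = ennreal e" if "k > 0" "e \<ge> 0" for e k :: real
            using that by (simp add: divide_ennreal)
          show ?thesis using V T(2)[OF h] by (intro ek) auto
        qed
        finally have Y: "?Y = ennreal ?e" .
        have "emeasure (Leb ?I) (slice D (\<lambda>_. h)) = ennreal (unit_ball_vol (real (card ?I)) * T h ^ card ?I)"
          using sl\<mu>[OF h(1)] T(1)[OF h] by simp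
        from knothe_kernelD(3)[OF Kh[OF h] T(2)[OF h] this]
        have ka: "?C + ennreal (2 * (real ?n / real (?n + 2)) * T h * T h) \<le> ?X + ennreal ?e"
          by (simp only: Y)
        have e1: "2 * (real ?n / real (?n + 2)) * T h * T h = ?e + ?e" by (simp add: power2_eq_square)
        have e2: "ennreal (?e + ?e) = ennreal ?e + ennreal ?e" by (rule ennreal_plus) simp_all
        \<comment> \<open>With the ball radius equal to the volume radius of the superlevel set, the
          gain is twice the mean square \<open>e\<close> of the norm over the ball. One copy cancels
          this moment on the right, the other is kept as the moment of the ball on the left.\<close>
        have canc: "c + e \<le> x" if "c + (e + e) \<le> x + e" "e \<noteq> \<infinity>" for c e x :: ennreal
          using that ennreal_add_left_cancel_le[of e "c + e" x] by (simp add: add_ac)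
        have le: "?C + ennreal ?e \<le> ?X"
          by (rule canc[OF ka[unfolded e1 e2]]) simp
        have "(\<integral>\<^sup>+p. ennreal (\<Sum>b\<in>?I. (fst p b - snd p b)\<^sup>2) + ennreal (\<Sum>b\<in>?I. (snd p b)\<^sup>2) \<partial>K h) = ?C + ?Y"
          by (rule nn_integral_add) (use Ks(1)[of h] in \<open>simp_all cong: measurable_cong_sets\<close>)
        then show ?thesis using le Y by (simp add: mult_left_mono)
      qed auto
    qed
    also have "\<dots> = (\<integral>\<^sup>+p. ennreal ((norm (fst p))\<^sup>2) \<partial>P)"
      by (subst intP) (simp_all add: norm_of_coords)
    also have "\<dots> = (\<integral>\<^sup>+x. ennreal (\<rho> x) * ennreal ((norm x)\<^sup>2) \<partial>lborel)"
      by (subst fstP[of "\<lambda>y. ennreal ((norm y)\<^sup>2)"]) simp_all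
    finally show ?thesis .
  qed
  ultimately show thesis by (rule that)
qed


section \<open>The energy gap\<close>

text \<open>The definition integrates over positive levels and sees a superlevel set only through
  its volume. Changes on null sets and translations thereby leave the rearrangement
  unchanged.\<close>

lemma rearrange_cong_levels:
  assumes "\<And>h. h > 0 \<Longrightarrow> emeasure lborel {y. f y > h} = emeasure lborel {y. g y > h}"
  shows "rearrange f = rearrange g"
proof
  fix x
  show "rearrange f x = rearrange g x"
    unfolding rearrange_def set_lebesgue_integral_def rearrange_set_def
    by (intro Bochner_Integration.integral_cong refl) (auto simp: indicator_def assms)
qed

lemma rearrange_uminus:
  fixes f :: "'a::euclidean_space \<Rightarrow> real"
  assumes "bounded_density B R f"
  shows "rearrange f (- x) = rearrange f x"
proof -
  have "ennreal (rearrange f (- x)) = ennreal (rearrange f x)"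
    unfolding rearrange_eq_emeasure(1)[OF assms] by simp
  then show ?thesis using rearrange_eq_emeasure(2)[OF assms] by (simp add: ennreal_inj)
qed

lemma rearrange_translate:
  fixes f :: "'a::euclidean_space \<Rightarrow> real"
  assumes [measurable]: "f \<in> borel_measurable borel"
  shows "rearrange (translate a f) = rearrange f"
proof (rule rearrange_cong_levels)
  fix h :: real
  have "emeasure lborel {y. translate a f y > h} = (\<integral>\<^sup>+y. indicator {y. f y > h} (y + a) \<partial>lborel)"
  proof -
    have "(\<integral>\<^sup>+y. indicator {y. f y > h} (y + a) \<partial>lborel) = (\<integral>\<^sup>+y. indicator {y. f (y + a) > h} y \<partial>lborel)"
      by (intro nn_integral_cong) (simp add: indicator_def)
    also have "\<dots> = emeasure lborel {y. f (y + a) > h}" by (rule nn_integral_indicator) measurable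
    finally show ?thesis by (simp add: translate_def)
  qed
  also have "\<dots> = (\<integral>\<^sup>+y. indicator {y. f y > h} y \<partial>lborel)"
    by (rule nn_integral_lborel_shift) measurable
  finally show "emeasure lborel {y. translate a f y > h} = emeasure lborel {y. f y > h}" by simp
qed

lemma bounded_density_integrable:
  fixes g :: "'a::euclidean_space \<Rightarrow> 'b::euclidean_space"
  assumes f: "bounded_density B R f" and g: "continuous_on UNIV g"
  shows "integrable lborel (\<lambda>x. f x *\<^sub>R g x)"
proof -
  note [measurable] = bounded_densityD(1)[OF f] borel_measurable_continuous_onI[OF g]
  have "bounded (g ` cball 0 R)"
    by (intro compact_imp_bounded compact_continuous_image continuous_on_subset[OF g]) auto
  then obtain C where "\<forall>y\<in>g ` cball 0 R. norm y \<le> C" unfolding bounded_iff by blast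
  then have C: "\<And>x. x \<in> cball 0 R \<Longrightarrow> norm (g x) \<le> C" by blast
  have B: "0 \<le> B" using bounded_densityD(2,3)[OF f] order.trans by blast
  show ?thesis
  proof (rule Bochner_Integration.integrable_bound)
    show "integrable lborel (\<lambda>x. B * C * indicator (cball (0::'a) R) x)"
      using emeasure_lborel_cball_finite[of "0::'a" R] by (intro integrable_mult_right integrable_real_indicator) auto
    show "AE x in lborel. norm (f x *\<^sub>R g x) \<le> norm (B * C * indicator (cball (0::'a) R) x)"
    proof (rule AE_I2)
      fix x :: 'a
      show "norm (f x *\<^sub>R g x) \<le> norm (B * C * indicator (cball (0::'a) R) x)"
      proof (cases "R < norm x")
        case True
        then show ?thesis using bounded_densityD(4)[OF f] by simp
      next
        case False
        then have "f x * norm (g x) \<le> B * C" using C[of x] B bounded_densityD(2,3)[OF f, of x] by (intro mult_mono) auto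
        then show ?thesis using False bounded_densityD(2)[OF f, of x] by simp
      qed
    qed
  qed measurable
qed

text \<open>Expansion of the square; the mixed term gives \<open>(norm m)\<^sup>2\<close>, and the
  result is twice the variance. The integrability claims allow this part to be separated from the
  energy of \<open>W\<close>.\<close>

lemma quadratic_energy:
  fixes f :: "'a::euclidean_space \<Rightarrow> real"
  assumes f: "bounded_density B R f" and mass: "(\<integral>x. f x \<partial>lborel) = 1"
  defines "m \<equiv> (\<integral>x. f x *\<^sub>R x \<partial>lborel)" and "S \<equiv> (\<integral>x. f x * (norm x)\<^sup>2 \<partial>lborel)"
  shows "\<And>x. integrable lborel (\<lambda>y. f x * f y * (norm (x - y))\<^sup>2)"
    and "integrable lborel (\<lambda>x. \<integral>y. f x * f y * (norm (x - y))\<^sup>2 \<partial>lborel)"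
    and "(\<integral>x. (\<integral>y. f x * f y * (norm (x - y))\<^sup>2 \<partial>lborel) \<partial>lborel) = 2 * S - 2 * (norm m)\<^sup>2"
proof -
  have i0: "integrable lborel f"
    using bounded_density_integrable[OF f, of "\<lambda>_. 1 :: real"] by simp
  have i1: "integrable lborel (\<lambda>x. f x *\<^sub>R x)"
    by (rule bounded_density_integrable[OF f]) (intro continuous_intros)
  have i2: "integrable lborel (\<lambda>x. f x * (norm x)\<^sup>2)"
    using bounded_density_integrable[OF f, of "\<lambda>x. (norm x)\<^sup>2"] by (simp add: continuous_intros)
  have i3: "integrable lborel (\<lambda>x. f x * (x \<bullet> a))" for a
    using bounded_density_integrable[OF f, of "\<lambda>x. x \<bullet> a"] by (simp add: continuous_intros)
  have m3: "(\<integral>x. f x * (x \<bullet> a) \<partial>lborel) = m \<bullet> a" for a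
    using integral_inner_left[of a lborel "\<lambda>x. f x *\<^sub>R x"] i1 by (simp add: m_def)
  have ex: "f x * f y * (norm (x - y))\<^sup>2 = f x * ((norm x)\<^sup>2 * f y - 2 * (f y * (y \<bullet> x)) + f y * (norm y)\<^sup>2)" for x y
    by (simp add: power2_norm_eq_inner inner_diff_left inner_diff_right inner_commute algebra_simps)
  show "integrable lborel (\<lambda>y. f x * f y * (norm (x - y))\<^sup>2)" for x
    unfolding ex by (intro integrable_mult_right Bochner_Integration.integrable_add Bochner_Integration.integrable_diff i0 i2 i3)
  have in1: "(\<integral>y. f x * f y * (norm (x - y))\<^sup>2 \<partial>lborel) = f x * (norm x)\<^sup>2 - 2 * (f x * (x \<bullet> m)) + f x * S" for x
  proof -
    have "(\<integral>y. f x * f y * (norm (x - y))\<^sup>2 \<partial>lborel) = f x * ((norm x)\<^sup>2 * (\<integral>y. f y \<partial>lborel) - 2 * (\<integral>y. f y * (y \<bullet> x) \<partial>lborel) + S)"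
      unfolding ex S_def using i0 i2 i3[of x] by simp
    then show ?thesis by (simp add: mass m3 inner_commute algebra_simps)
  qed
  show "integrable lborel (\<lambda>x. \<integral>y. f x * f y * (norm (x - y))\<^sup>2 \<partial>lborel)"
    unfolding in1 by (intro Bochner_Integration.integrable_add Bochner_Integration.integrable_diff integrable_mult_right integrable_mult_left i0 i2 i3)
  have "(\<integral>x. (\<integral>y. f x * f y * (norm (x - y))\<^sup>2 \<partial>lborel) \<partial>lborel) = S - 2 * (m \<bullet> m) + (\<integral>x. f x \<partial>lborel) * S"
    unfolding in1 using i0 i2 i3[of m] by (simp add: m3 S_def)
  then show "(\<integral>x. (\<integral>y. f x * f y * (norm (x - y))\<^sup>2 \<partial>lborel) \<partial>lborel) = 2 * S - 2 * (norm m)\<^sup>2"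
    by (simp add: mass power2_norm_eq_inner)
qed

lemma nn_energy_finite:
  fixes f :: "'a::euclidean_space \<Rightarrow> real"
  assumes f: "bounded_density B R f" and mass: "(\<integral>\<^sup>+x. ennreal (f x) \<partial>lborel) = 1"
    and [measurable]: "K \<in> borel_measurable borel"
  shows "(\<integral>\<^sup>+y. ennreal (f x) * ennreal (f y) * K (x - y) \<partial>lborel) \<le> ennreal (f x) * (ennreal B * (\<integral>\<^sup>+x. K x \<partial>lborel))"
    and "nn_energy K f \<le> ennreal B * (\<integral>\<^sup>+x. K x \<partial>lborel)"
proof -
  note [measurable] = bounded_densityD(1)[OF f]
  show le: "(\<integral>\<^sup>+y. ennreal (f x) * ennreal (f y) * K (x - y) \<partial>lborel) \<le> ennreal (f x) * (ennreal B * (\<integral>\<^sup>+x. K x \<partial>lborel))" for x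
  proof -
    have "(\<integral>\<^sup>+y. ennreal (f x) * ennreal (f y) * K (x - y) \<partial>lborel) \<le> (\<integral>\<^sup>+y. ennreal (f x) * (ennreal B * K (x - y)) \<partial>lborel)"
      using bounded_densityD(3)[OF f] unfolding mult.assoc
      by (intro nn_integral_mono mult_left_mono mult_right_mono ennreal_leI) auto
    also have "\<dots> = ennreal (f x) * (ennreal B * (\<integral>\<^sup>+x. K x \<partial>lborel))"
      by (simp add: nn_integral_cmult nn_integral_lborel_reflect)
    finally show ?thesis .
  qed
  have "nn_energy K f \<le> (\<integral>\<^sup>+x. ennreal (f x) * (ennreal B * (\<integral>\<^sup>+x. K x \<partial>lborel)) \<partial>lborel)"
    unfolding nn_energy_def by (intro nn_integral_mono le)
  also have "\<dots> = ennreal B * (\<integral>\<^sup>+x. K x \<partial>lborel)"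
    by (subst nn_integral_multc) (simp_all add: mass)
  finally show "nn_energy K f \<le> ennreal B * (\<integral>\<^sup>+x. K x \<partial>lborel)" .
qed

text \<open>Links the real-valued energy of \<open>W\<close> to the \<open>ennreal\<close> energy of
  the modified kernel. The constant \<open>A\<close> is multiplied by mass one, and
  \<open>c / 2\<close> by twice the variance. Points of the ball are at most \<open>2 * R\<close>
  apart and the diagonal is a null set, so \<open>K\<close> is prescribed only at the remaining
  distances.\<close>

lemma interaction_energy_decomposition:
  fixes f :: "'a::euclidean_space \<Rightarrow> real" and W :: "'a \<Rightarrow> real"
  assumes f: "bounded_density B R f" and mass: "(\<integral>\<^sup>+x. ennreal (f x) \<partial>lborel) = 1"
    and [measurable]: "K \<in> borel_measurable borel" and Kfin: "(\<integral>\<^sup>+x. K x \<partial>lborel) < \<infinity>"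
    and W [measurable]: "W \<in> borel_measurable borel"
    and WK: "\<And>x. x \<noteq> 0 \<Longrightarrow> norm x \<le> 2 * R \<Longrightarrow> K x = ennreal (W x + c / 2 * (norm x)\<^sup>2 - A) \<and> 0 \<le> W x + c / 2 * (norm x)\<^sup>2 - A"
  shows "interaction_energy W f = enn2real (nn_energy K f) + A
    - c * ((\<integral>x. f x * (norm x)\<^sup>2 \<partial>lborel) - (norm (\<integral>x. f x *\<^sub>R x \<partial>lborel))\<^sup>2)"
proof -
  note [measurable] = bounded_densityD(1)[OF f]
  have B: "0 \<le> B" using bounded_densityD(2,3)[OF f] order.trans by blast
  have i0: "integrable lborel f"
    using bounded_density_integrable[OF f, of "\<lambda>_. 1 :: real"] by simp
  have mass': "(\<integral>x. f x \<partial>lborel) = 1"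
    using mass bounded_densityD(2)[OF f] by (subst integral_eq_nn_integral) auto
  define I where "I x = (\<integral>\<^sup>+y. ennreal (f x) * ennreal (f y) * K (x - y) \<partial>lborel)" for x
  have [measurable]: "I \<in> borel_measurable borel" unfolding I_def by measurable
  have Ifin: "I x < \<infinity>" for x
  proof -
    have "I x \<le> ennreal (f x) * (ennreal B * (\<integral>\<^sup>+x. K x \<partial>lborel))"
      unfolding I_def by (rule nn_energy_finite(1)[OF f mass]) simp
    also have "\<dots> < \<infinity>" using Kfin by (simp add: ennreal_mult_less_top)
    finally show ?thesis .
  qed
  have IE: "nn_energy K f = (\<integral>\<^sup>+x. I x \<partial>lborel)" by (simp add: nn_energy_def I_def)
  have Efin: "nn_energy K f < \<infinity>"
  proof -
    have "nn_energy K f \<le> ennreal B * (\<integral>\<^sup>+x. K x \<partial>lborel)"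
      by (rule nn_energy_finite(2)[OF f mass]) simp
    also have "\<dots> < \<infinity>" using Kfin by (simp add: ennreal_mult_less_top)
    finally show ?thesis .
  qed
  define k where "k x y = f x * f y * (W (x - y) + c / 2 * (norm (x - y))\<^sup>2 - A)" for x y
  have kK: "AE y in lborel. ennreal (k x y) = ennreal (f x) * ennreal (f y) * K (x - y) \<and> 0 \<le> k x y" for x
    using AE_lborel_singleton[of x]
  proof eventually_elim
    case (elim y)
    show ?case
    proof (cases "R < norm x \<or> R < norm y")
      case True
      then show ?thesis using bounded_densityD(4)[OF f, of x] bounded_densityD(4)[OF f, of y] by (auto simp: k_def)
    next
      case False
      then have "norm (x - y) \<le> 2 * R" using norm_triangle_ineq4[of x y] by linarith
      then have "K (x - y) = ennreal (W (x - y) + c / 2 * (norm (x - y))\<^sup>2 - A) \<and> 0 \<le> W (x - y) + c / 2 * (norm (x - y))\<^sup>2 - A"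
        using elim by (intro WK) auto
      then show ?thesis using bounded_densityD(2)[OF f, of x] bounded_densityD(2)[OF f, of y]
        by (simp add: k_def ennreal_mult)
    qed
  qed
  have kI: "(\<integral>\<^sup>+y. ennreal (k x y) \<partial>lborel) = I x" for x
    unfolding I_def using kK[of x] by (intro nn_integral_cong_AE) (auto elim!: eventually_mono)
  have [measurable]: "k x \<in> borel_measurable borel" for x unfolding k_def by measurable
  have ki: "integrable lborel (k x)" for x
    using Ifin[of x] kI[of x] kK[of x] by (intro integrableI_nonneg) (auto elim!: eventually_mono)
  have k1: "(\<integral>y. k x y \<partial>lborel) = enn2real (I x)" for x
    using kK[of x] by (subst integral_eq_nn_integral) (auto simp: kI elim!: eventually_mono)
  have nI: "(\<integral>\<^sup>+x. ennreal (enn2real (I x)) \<partial>lborel) = nn_energy K f"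
    unfolding IE using Ifin by (intro nn_integral_cong) (simp add: less_top)
  have Ii: "integrable lborel (\<lambda>x. enn2real (I x))"
    using nI Efin by (intro integrableI_nonneg) auto
  have I1: "(\<integral>x. enn2real (I x) \<partial>lborel) = enn2real (nn_energy K f)"
    by (subst integral_eq_nn_integral) (auto simp: nI)
  note q = quadratic_energy[OF f mass']
  have dec: "f x * f y * W (x - y) = k x y - c / 2 * (f x * f y * (norm (x - y))\<^sup>2) + A * (f x * f y)" for x y
    by (simp add: k_def algebra_simps)
  have in1: "(\<integral>y. f x * f y * W (x - y) \<partial>lborel) = enn2real (I x) - c / 2 * (\<integral>y. f x * f y * (norm (x - y))\<^sup>2 \<partial>lborel) + A * f x" for x
  proof -
    have "(\<integral>y. f x * f y * W (x - y) \<partial>lborel) =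
      (\<integral>y. k x y \<partial>lborel) - (\<integral>y. c / 2 * (f x * f y * (norm (x - y))\<^sup>2) \<partial>lborel) + (\<integral>y. A * (f x * f y) \<partial>lborel)"
    proof -
      have a2: "integrable lborel (\<lambda>y. c / 2 * (f x * f y * (norm (x - y))\<^sup>2))"
        by (intro integrable_mult_right q(1))
      have a3: "integrable lborel (\<lambda>y. A * (f x * f y))" by (intro integrable_mult_right i0)
      show ?thesis unfolding dec
        by (simp only: Bochner_Integration.integral_add[OF Bochner_Integration.integrable_diff[OF ki a2] a3]
            Bochner_Integration.integral_diff[OF ki a2])
    qed
    also have "(\<integral>y. A * (f x * f y) \<partial>lborel) = A * f x" by (simp add: mass')
    finally show ?thesis by (simp only: k1 integral_mult_right_zero)
  qed
  have "interaction_energy W f = (\<integral>x. enn2real (I x) - c / 2 * (\<integral>y. f x * f y * (norm (x - y))\<^sup>2 \<partial>lborel) + A * f x \<partial>lborel)"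
    unfolding interaction_energy_def in1 ..
  also have "\<dots> = (\<integral>x. enn2real (I x) \<partial>lborel) - c / 2 * (\<integral>x. (\<integral>y. f x * f y * (norm (x - y))\<^sup>2 \<partial>lborel) \<partial>lborel) + A * (\<integral>x. f x \<partial>lborel)"
    using Ii q(2) i0 by simp
  finally show ?thesis
    unfolding I1 q(3) mass' by (simp add: algebra_simps)
qed

lemma nn_integral_moment:
  fixes f :: "'a::euclidean_space \<Rightarrow> real"
  assumes f: "bounded_density B R f"
  shows "(\<integral>\<^sup>+x. ennreal (f x) * ennreal ((norm x)\<^sup>2) \<partial>lborel) = ennreal (\<integral>x. f x * (norm x)\<^sup>2 \<partial>lborel)"
proof -
  have "integrable lborel (\<lambda>x. f x * (norm x)\<^sup>2)"
    using bounded_density_integrable[OF f, of "\<lambda>x. (norm x)\<^sup>2"] by (simp add: continuous_intros)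
  from nn_integral_eq_integral[OF this] show ?thesis
    using bounded_densityD(2)[OF f] by (simp add: ennreal_mult)
qed

lemma integral_lborel_reflect:
  fixes f :: "'a::euclidean_space \<Rightarrow> 'b::euclidean_space"
  assumes [measurable]: "f \<in> borel_measurable borel"
  shows "(\<integral>x. f (- x) \<partial>lborel) = (\<integral>x. f x \<partial>lborel)"
proof -
  have "distr lborel borel uminus = (lborel :: 'a measure)"
  proof (rule measure_eqI)
    fix A assume "A \<in> sets (distr lborel borel (uminus :: 'a \<Rightarrow> 'a))"
    then have [measurable]: "A \<in> sets borel" by simp
    have "emeasure (distr lborel borel uminus) A = (\<integral>\<^sup>+x. indicator A (0 - x) \<partial>lborel)"
      by (subst nn_integral_indicator[symmetric], simp, subst nn_integral_distr) simp_all
    also have "\<dots> = (\<integral>\<^sup>+x. indicator A x \<partial>lborel)" by (rule nn_integral_lborel_reflect) simp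
    finally show "emeasure (distr lborel borel uminus) A = emeasure lborel A" by simp
  qed simp
  then have "(\<integral>x. f x \<partial>lborel) = (\<integral>x. f x \<partial>distr lborel borel uminus)" by simp
  then show ?thesis by (simp add: integral_distr)
qed

theorem wasserstein2_le_moments:
  fixes \<rho> :: "'a::euclidean_space \<Rightarrow> real"
  assumes \<rho>: "bounded_density B R \<rho>" and mass: "(\<integral>\<^sup>+x. ennreal (\<rho> x) \<partial>lborel) = 1" and R: "R \<ge> 0"
  shows "(wasserstein2 (density_measure \<rho>) (density_measure (rearrange \<rho>)))\<^sup>2
    \<le> (\<integral>x. \<rho> x * (norm x)\<^sup>2 \<partial>lborel) - (\<integral>x. rearrange \<rho> x * (norm x)\<^sup>2 \<partial>lborel)"
proof -
  let ?M = "(\<integral>x. \<rho> x * (norm x)\<^sup>2 \<partial>lborel)" and ?N = "(\<integral>x. rearrange \<rho> x * (norm x)\<^sup>2 \<partial>lborel)"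
  let ?c = "couplings (density_measure \<rho>) (density_measure (rearrange \<rho>))"
  let ?inf = "INF P\<in>?c. \<integral>\<^sup>+ z. ennreal ((dist (fst z) (snd z))\<^sup>2) \<partial>P"
  note \<rho>r = bounded_density_rearrange[OF \<rho> R]
  obtain P where P: "P \<in> ?c" and le: "(\<integral>\<^sup>+p. ennreal ((dist (fst p) (snd p))\<^sup>2) \<partial>P) + ennreal ?N \<le> ennreal ?M"
    using layered_coupling[OF \<rho> mass] unfolding nn_integral_moment[OF \<rho>] nn_integral_moment[OF \<rho>r] by blast
  have N0: "0 \<le> ?N" using bounded_densityD(2)[OF \<rho>r] by simp
  have M0: "0 \<le> ?M" using bounded_densityD(2)[OF \<rho>] by simp
  have "?inf \<le> (\<integral>\<^sup>+p. ennreal ((dist (fst p) (snd p))\<^sup>2) \<partial>P)" using P by (rule INF_lower)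
  then have "?inf + ennreal ?N \<le> ennreal ?M" using le by (meson add_right_mono order.trans)
  \<comment> \<open>The bound makes the infimum finite, so \<open>enn2real\<close> returns its value
    and not the default 0.\<close>
  then obtain r where r: "?inf = ennreal r" "r \<ge> 0" "ennreal r + ennreal ?N \<le> ennreal ?M"
    by (cases ?inf) (auto simp: top_unique)
  have "r + ?N \<le> ?M" using r(3) N0 M0 r(2) by (simp add: ennreal_plus[symmetric] del: ennreal_plus)
  moreover have "(wasserstein2 (density_measure \<rho>) (density_measure (rearrange \<rho>)))\<^sup>2 = r"
    unfolding wasserstein2_def r(1) using r(2) by simp
  ultimately show ?thesis by simp
qed

text \<open>\<open>W\<close> is the pointwise limit of its restrictions to balls, which are
  integrable and therefore measurable.\<close>

lemma locally_integrable_borel: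
  fixes W :: "'a::euclidean_space \<Rightarrow> real"
  assumes "locally_integrable W"
  shows "W \<in> borel_measurable borel"
proof (rule borel_measurable_LIMSEQ_real)
  show "(\<lambda>x. indicator (cball 0 (real n)) x * W x) \<in> borel_measurable borel" for n
    using assms by (auto simp: locally_integrable_def set_integrable_def dest!: spec[of _ "cball 0 (real n)"] borel_measurable_integrable)
  fix x :: 'a
  obtain N :: nat where N: "norm x \<le> real N" using real_arch_simple by blast
  have "\<forall>\<^sub>F n in sequentially. indicator (cball 0 (real n)) x * W x = W x"
    using eventually_ge_at_top[of N] by eventually_elim (use N in auto)
  then show "(\<lambda>n. indicator (cball 0 (real n)) x * W x) \<longlonglongrightarrow> W x" by (rule tendsto_eventually)
qed

text \<open>The complement of the support is a union of null open sets. By Lindelof countably many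
  of them suffice, so the density vanishes almost everywhere off the ball; the exceptional values
  are replaced by 0.\<close>

lemma bounded_prob_density_normalize:
  fixes \<rho> :: "'a::euclidean_space \<Rightarrow> real"
  assumes \<rho>: "bounded_prob_density \<rho>" and supp: "measure_support (density_measure \<rho>) \<subseteq> ball 0 R"
  obtains B \<sigma> where "bounded_density B R \<sigma>" "AE x in lborel. \<rho> x = \<sigma> x" "(\<integral>\<^sup>+x. ennreal (\<sigma> x) \<partial>lborel) = 1"
proof -
  have [measurable]: "\<rho> \<in> borel_measurable borel" and nonneg: "AE x in lborel. 0 \<le> \<rho> x"
    and prob: "prob_space (density_measure \<rho>)" using \<rho> by (auto simp: bounded_prob_density_def)
  obtain M where M: "AE x in lborel. \<bar>\<rho> x\<bar> \<le> M" using \<rho> by (auto simp: bounded_prob_density_def)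
  define F where "F = {U. open U \<and> emeasure (density_measure \<rho>) U = 0}"
  have "\<And>S. S \<in> F \<Longrightarrow> open S" by (simp add: F_def)
  then obtain F' where F': "F' \<subseteq> F" "countable F'" "\<Union>F' = \<Union>F" using Lindelof[of F] by blast
  have "(\<Union>U\<in>F'. U) \<in> null_sets (density_measure \<rho>)"
    using F' by (intro null_sets_UN') (auto simp: null_sets_def F_def)
  then have "\<Union>F \<in> null_sets (density_measure \<rho>)" using F'(3) by simp
  then have "AE x in density_measure \<rho>. x \<notin> \<Union>F" by (rule AE_not_in)
  then have ae: "AE x in lborel. 0 < ennreal (\<rho> x) \<longrightarrow> x \<notin> \<Union>F" by (simp add: AE_density)
  have sub: "x \<in> \<Union>F" if "R \<le> norm x" for x
  proof -
    have "x \<notin> measure_support (density_measure \<rho>)" using supp that by auto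
    then show ?thesis by (auto simp: measure_support_def F_def)
  qed
  define \<sigma> where "\<sigma> x = (if norm x \<le> R \<and> 0 \<le> \<rho> x \<and> \<rho> x \<le> \<bar>M\<bar> then \<rho> x else 0)" for x
  have [measurable]: "\<sigma> \<in> borel_measurable borel" unfolding \<sigma>_def by measurable
  have 1: "bounded_density \<bar>M\<bar> R \<sigma>" unfolding bounded_density_def by (auto simp: \<sigma>_def)
  have 2: "AE x in lborel. \<rho> x = \<sigma> x" using nonneg M ae
  proof eventually_elim
    case (elim x)
    then show ?case using sub[of x] by (cases "\<rho> x = 0"; cases "R \<le> norm x") (auto simp: \<sigma>_def)
  qed
  have "(\<integral>\<^sup>+x. ennreal (\<sigma> x) \<partial>lborel) = (\<integral>\<^sup>+x. ennreal (\<rho> x) \<partial>lborel)"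
    using 2 by (intro nn_integral_cong_AE) (auto elim!: eventually_mono)
  also have "\<dots> = 1" using prob_space.emeasure_space_1[OF prob] by (simp add: emeasure_density)
  finally show thesis using that[OF 1 2] by blast
qed

lemma interaction_energy_cong_AE:
  fixes \<rho> \<sigma> :: "'a::euclidean_space \<Rightarrow> real"
  assumes [measurable]: "\<rho> \<in> borel_measurable borel" "\<sigma> \<in> borel_measurable borel" "W \<in> borel_measurable borel"
    and ae: "AE x in lborel. \<rho> x = \<sigma> x"
  shows "interaction_energy W \<rho> = interaction_energy W \<sigma>"
proof -
  have "(\<integral>y. \<rho> x * \<rho> y * W (x - y) \<partial>lborel) = (\<integral>y. \<rho> x * \<sigma> y * W (x - y) \<partial>lborel)" for x
    using ae by (intro integral_cong_AE) (auto elim!: eventually_mono)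
  then have "interaction_energy W \<rho> = (\<integral>x. (\<integral>y. \<rho> x * \<sigma> y * W (x - y) \<partial>lborel) \<partial>lborel)"
    by (simp add: interaction_energy_def)
  also have "\<dots> = (\<integral>x. (\<integral>y. \<sigma> x * \<sigma> y * W (x - y) \<partial>lborel) \<partial>lborel)"
    using ae by (intro integral_cong_AE) (auto elim!: eventually_mono)
  finally show ?thesis by (simp add: interaction_energy_def)
qed

lemma AE_lborel_shift:
  fixes P :: "'a::euclidean_space \<Rightarrow> bool"
  assumes [measurable]: "Measurable.pred borel P" and "AE x in lborel. P x"
  shows "AE x in lborel. P (x + a)"
proof -
  have "(\<integral>\<^sup>+x. indicator {x. \<not> P x} (x + a) \<partial>lborel) = (\<integral>\<^sup>+x. indicator {x. \<not> P x} x \<partial>lborel)"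
    by (rule nn_integral_lborel_shift) measurable
  also have "\<dots> = 0" using assms(2) by (subst nn_integral_0_iff_AE) (auto elim!: eventually_mono)
  finally have "AE x in lborel. indicator {x. \<not> P x} (x + a) = (0::ennreal)"
    by (subst (asm) nn_integral_0_iff_AE) auto
  then show ?thesis by eventually_elim (auto simp: indicator_def split: if_splits)
qed

text \<open>The Riesz inequality for \<open>K\<close> leaves \<open>c\<close> times the difference
  of the variances of the density and of its rearrangement. The latter is even, hence centered; the
  variance of the former is the second moment of its centered translate, which has the same
  rearrangement. The moment bound for the Wasserstein distance is applied to this translate.\<close>

theorem energy_gap:
  fixes W :: "'a::euclidean_space \<Rightarrow> real" and w w' :: "real \<Rightarrow> real"
  assumes W: "locally_integrable W" and Ww: "\<And>x. x \<noteq> 0 \<Longrightarrow> W x = w (norm x)"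
    and w: "\<And>r. r > 0 \<Longrightarrow> (w has_real_derivative w' r) (at r)"
    and w': "\<And>r. 0 < r \<Longrightarrow> r < 2 * R \<Longrightarrow> w' r \<le> - c * r"
    and R: "R > 0" and c: "c \<ge> 0"
    and \<rho>: "bounded_prob_density \<rho>" and supp: "measure_support (density_measure \<rho>) \<subseteq> ball 0 R"
  shows "interaction_energy W (rearrange \<rho>) - interaction_energy W \<rho> \<ge>
    c * (wasserstein2 (density_measure (translate (center_of_mass \<rho>) \<rho>)) (density_measure (rearrange \<rho>)))\<^sup>2"
proof -
  have Wm [measurable]: "W \<in> borel_measurable borel" by (rule locally_integrable_borel[OF W])
  have \<rho>m [measurable]: "\<rho> \<in> borel_measurable borel" using \<rho> by (simp add: bounded_prob_density_def)
  obtain B \<sigma> where \<sigma>: "bounded_density B R \<sigma>" and ae: "AE x in lborel. \<rho> x = \<sigma> x" and mass: "(\<integral>\<^sup>+x. ennreal (\<sigma> x) \<partial>lborel) = 1"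
    using bounded_prob_density_normalize[OF \<rho> supp] by blast
  note [measurable] = bounded_densityD(1)[OF \<sigma>] borel_measurable_rearrange[OF \<sigma>]
  have r_eq: "rearrange \<rho> = rearrange \<sigma>"
  proof (rule rearrange_cong_levels)
    fix h :: real
    show "emeasure lborel {y. \<rho> y > h} = emeasure lborel {y. \<sigma> y > h}"
      using ae by (intro emeasure_eq_AE) (auto elim!: eventually_mono)
  qed
  have E_eq: "interaction_energy W \<rho> = interaction_energy W \<sigma>"
    by (rule interaction_energy_cong_AE) (use ae in auto)
  define a where "a = (\<integral>x. \<sigma> x *\<^sub>R x \<partial>lborel)"
  have a_eq: "center_of_mass \<rho> = a"
    unfolding center_of_mass_def a_def using ae by (intro integral_cong_AE) (auto elim!: eventually_mono)
  have T_eq: "density_measure (translate a \<rho>) = density_measure (translate a \<sigma>)"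
    unfolding translate_def
    by (rule density_cong) (use AE_lborel_shift[OF _ ae, of a] in \<open>auto elim!: eventually_mono\<close>)
  have R0: "0 \<le> R" using R by simp
  note \<sigma>r = bounded_density_rearrange[OF \<sigma> R0]
  have mass_r: "(\<integral>\<^sup>+x. ennreal (rearrange \<sigma> x) \<partial>lborel) = 1" using nn_integral_rearrange_eq[OF \<sigma>] mass by simp
  define M where "M = (\<integral>x. \<sigma> x * (norm x)\<^sup>2 \<partial>lborel)"
  define N where "N = (\<integral>x. rearrange \<sigma> x * (norm x)\<^sup>2 \<partial>lborel)"
  \<comment> \<open>The value of \<open>\<phi>\<close> at \<open>2 * R\<close>. Subtracting it makes
    the kernel nonnegative up to that distance and 0 there, so that cutting it off preserves
    monotonicity.\<close>
  define A where "A = w (2 * R) + c / 2 * (2 * R)\<^sup>2"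
  define \<phi> where "\<phi> r = w r + c / 2 * r\<^sup>2" for r
  have \<phi>d: "(\<phi> has_real_derivative w' r + c * r) (at r)" if "r > 0" for r
    unfolding \<phi>_def by (auto intro!: derivative_eq_intros w that)
  have \<phi>dec: "\<phi> t \<le> \<phi> r" if "0 < r" "r \<le> t" "t \<le> 2 * R" for r t
  proof (cases "r = t")
    case False
    then have "r < t" using that by simp
    have "\<exists>z>r. z < t \<and> \<phi> t - \<phi> r = (t - r) * (w' z + c * z)"
      by (rule MVT2[OF \<open>r < t\<close>]) (use \<phi>d that(1) in auto)
    then obtain z where z: "z > r" "z < t" "\<phi> t - \<phi> r = (t - r) * (w' z + c * z)" by blast
    have "w' z \<le> - c * z" using z that by (intro w') auto
    then have "(t - r) * (w' z + c * z) \<le> 0" using \<open>r < t\<close> by (intro mult_nonneg_nonpos) auto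
    then show ?thesis using z(3) by simp
  qed simp
  have A\<phi>: "A = \<phi> (2 * R)" by (simp add: A_def \<phi>_def)
  \<comment> \<open>The value at 0 is infinite because \<open>W 0\<close> is arbitrary and could
    spoil monotonicity; a single point does not affect the integrals.\<close>
  define K :: "'a \<Rightarrow> ennreal" where
    "K x = (if x = 0 then \<infinity> else if norm x \<le> 2 * R then ennreal (W x + c / 2 * (norm x)\<^sup>2 - A) else 0)" for x
  have Km [measurable]: "K \<in> borel_measurable borel" unfolding K_def by measurable
  have W\<phi>: "W x + c / 2 * (norm x)\<^sup>2 = \<phi> (norm x)" if "x \<noteq> 0" for x using Ww[OF that] by (simp add: \<phi>_def)
  have Kmono: "K y \<le> K x" if "norm x \<le> norm y" for x y
  proof (cases "x = 0 \<or> 2 * R < norm y")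
    case False
    then have "y \<noteq> 0" "norm x \<le> 2 * R" "x \<noteq> 0" "norm y \<le> 2 * R" using that by auto
    moreover from this have "W y + c / 2 * (norm y)\<^sup>2 \<le> W x + c / 2 * (norm x)\<^sup>2"
      unfolding W\<phi>[OF \<open>y \<noteq> 0\<close>] W\<phi>[OF \<open>x \<noteq> 0\<close>] using that by (intro \<phi>dec) auto
    ultimately show ?thesis by (simp add: K_def ennreal_leI)
  qed (use R in \<open>auto simp: K_def\<close>)
  have Kfin: "(\<integral>\<^sup>+x. K x \<partial>lborel) < \<infinity>"
  proof -
    have iW: "integrable lborel (\<lambda>x. indicator (cball 0 (2 * R)) x *\<^sub>R W x)"
      using W by (auto simp: locally_integrable_def set_integrable_def)
    have iD: "integrable lborel (\<lambda>x. \<bar>indicator (cball 0 (2 * R)) x *\<^sub>R W x\<bar> + (c / 2 * (2 * R)\<^sup>2 + \<bar>A\<bar>) * indicator (cball (0::'a) (2 * R)) x)"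
      using emeasure_lborel_cball_finite[of "0::'a" "2 * R"]
      by (intro Bochner_Integration.integrable_add integrable_abs iW integrable_mult_right integrable_real_indicator) auto
    have "(\<integral>\<^sup>+x. K x \<partial>lborel) \<le> (\<integral>\<^sup>+x. ennreal (\<bar>indicator (cball 0 (2 * R)) x *\<^sub>R W x\<bar> + (c / 2 * (2 * R)\<^sup>2 + \<bar>A\<bar>) * indicator (cball (0::'a) (2 * R)) x) \<partial>lborel)"
    proof (rule nn_integral_mono_AE)
      show "AE x in lborel. K x \<le> ennreal (\<bar>indicator (cball 0 (2 * R)) x *\<^sub>R W x\<bar> + (c / 2 * (2 * R)\<^sup>2 + \<bar>A\<bar>) * indicator (cball (0::'a) (2 * R)) x)"
        using AE_lborel_singleton[of 0]
      proof eventually_elim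
        case (elim x)
        show ?case
        proof (cases "norm x \<le> 2 * R")
          case True
          then have "c / 2 * (norm x)\<^sup>2 \<le> c / 2 * (2 * R)\<^sup>2" using c by (intro mult_left_mono power_mono) auto
          then show ?thesis using True elim by (auto simp: K_def intro!: ennreal_leI)
        qed (use elim in \<open>simp add: K_def\<close>)
      qed
    qed
    also have "\<dots> < \<infinity>"
      using iD c by (subst nn_integral_eq_integral) auto
    finally show ?thesis .
  qed
  have WK: "K x = ennreal (W x + c / 2 * (norm x)\<^sup>2 - A) \<and> 0 \<le> W x + c / 2 * (norm x)\<^sup>2 - A" if "x \<noteq> 0" "norm x \<le> 2 * R" for x
  proof -
    have "0 \<le> W x + c / 2 * (norm x)\<^sup>2 - A"
      unfolding W\<phi>[OF that(1)] A\<phi> using that \<phi>dec[of "norm x" "2 * R"] by simp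
    then show ?thesis using that by (simp add: K_def)
  qed
  have m0: "(\<integral>x. rearrange \<sigma> x *\<^sub>R x \<partial>lborel) = 0"
  proof -
    have "(\<integral>x. rearrange \<sigma> x *\<^sub>R x \<partial>lborel) = (\<integral>x. rearrange \<sigma> (- x) *\<^sub>R (- x) \<partial>lborel)"
      by (rule integral_lborel_reflect[symmetric]) measurable
    also have "\<dots> = - (\<integral>x. rearrange \<sigma> x *\<^sub>R x \<partial>lborel)" by (simp add: rearrange_uminus[OF \<sigma>])
    finally have "(\<integral>x. rearrange \<sigma> x *\<^sub>R x \<partial>lborel) + (\<integral>x. rearrange \<sigma> x *\<^sub>R x \<partial>lborel) = 0"
      by (simp only: eq_neg_iff_add_eq_0)
    then show ?thesis by (simp only: scaleR_2[symmetric]) simp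
  qed
  have E\<sigma>: "interaction_energy W \<sigma> = enn2real (nn_energy K \<sigma>) + A - c * (M - (norm a)\<^sup>2)"
    unfolding M_def a_def by (rule interaction_energy_decomposition[OF \<sigma> mass Km Kfin Wm WK])
  have E\<sigma>r: "interaction_energy W (rearrange \<sigma>) = enn2real (nn_energy K (rearrange \<sigma>)) + A - c * N"
    using interaction_energy_decomposition[OF \<sigma>r mass_r Km Kfin Wm WK] by (simp add: N_def m0)
  have "nn_energy K (rearrange \<sigma>) < \<infinity>"
  proof -
    have "nn_energy K (rearrange \<sigma>) \<le> ennreal B * (\<integral>\<^sup>+x. K x \<partial>lborel)" by (rule nn_energy_finite(2)[OF \<sigma>r mass_r Km])
    also have "\<dots> < \<infinity>" using Kfin by (simp add: ennreal_mult_less_top)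
    finally show ?thesis .
  qed
  then have riesz: "enn2real (nn_energy K \<sigma>) \<le> enn2real (nn_energy K (rearrange \<sigma>))"
    using riesz_rearrangement[OF \<sigma> R0 Km Kmono Kfin] by (intro enn2real_mono) auto
  have T: "bounded_density B (R + norm a) (translate a \<sigma>)"
    unfolding bounded_density_def
  proof (intro conjI allI impI)
    show "translate a \<sigma> \<in> borel_measurable borel" unfolding translate_def by measurable
    fix x
    show "0 \<le> translate a \<sigma> x" "translate a \<sigma> x \<le> B" using bounded_densityD(2,3)[OF \<sigma>] by (simp_all add: translate_def)
    assume "R + norm a < norm x"
    then have "R < norm (x + a)" using norm_triangle_ineq4[of "x + a" a] by simp
    then show "translate a \<sigma> x = 0" using bounded_densityD(4)[OF \<sigma>] by (simp add: translate_def)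
  qed
  have massT: "(\<integral>\<^sup>+x. ennreal (translate a \<sigma> x) \<partial>lborel) = 1"
    unfolding translate_def by (subst nn_integral_lborel_shift[of "\<lambda>x. ennreal (\<sigma> x)"]) (simp_all add: mass)
  \<comment> \<open>Parallel axis identity: the second moment about the center of mass.\<close>
  have MT: "(\<integral>x. translate a \<sigma> x * (norm x)\<^sup>2 \<partial>lborel) = M - (norm a)\<^sup>2"
  proof -
    have mass': "(\<integral>x. \<sigma> x \<partial>lborel) = 1"
      using mass bounded_densityD(2)[OF \<sigma>] by (subst integral_eq_nn_integral) auto
    have i0: "integrable lborel \<sigma>" using bounded_density_integrable[OF \<sigma>, of "\<lambda>_. 1 :: real"] by simp
    have i1: "integrable lborel (\<lambda>x. \<sigma> x *\<^sub>R x)"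
      by (rule bounded_density_integrable[OF \<sigma>]) (intro continuous_intros)
    have i2: "integrable lborel (\<lambda>x. \<sigma> x * (norm x)\<^sup>2)"
      using bounded_density_integrable[OF \<sigma>, of "\<lambda>x. (norm x)\<^sup>2"] by (simp add: continuous_intros)
    have i3: "integrable lborel (\<lambda>x. \<sigma> x * (x \<bullet> a))"
      using bounded_density_integrable[OF \<sigma>, of "\<lambda>x. x \<bullet> a"] by (simp add: continuous_intros)
    have m3: "(\<integral>x. \<sigma> x * (x \<bullet> a) \<partial>lborel) = a \<bullet> a"
      using integral_inner_left[of a lborel "\<lambda>x. \<sigma> x *\<^sub>R x"] i1 by (simp add: a_def)
    have "(\<integral>\<^sup>+x. ennreal (translate a \<sigma> x * (norm x)\<^sup>2) \<partial>lborel) = (\<integral>\<^sup>+x. ennreal (\<sigma> (x + a) * (norm ((x + a) - a))\<^sup>2) \<partial>lborel)"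
      by (simp add: translate_def)
    also have "\<dots> = (\<integral>\<^sup>+x. ennreal (\<sigma> x * (norm (x - a))\<^sup>2) \<partial>lborel)"
      by (rule nn_integral_lborel_shift[of "\<lambda>x. ennreal (\<sigma> x * (norm (x - a))\<^sup>2)"]) measurable
    finally have "(\<integral>x. translate a \<sigma> x * (norm x)\<^sup>2 \<partial>lborel) = (\<integral>x. \<sigma> x * (norm (x - a))\<^sup>2 \<partial>lborel)"
      using bounded_densityD(2)[OF \<sigma>] bounded_densityD(1,2)[OF T]
      by (subst (1 2) integral_eq_nn_integral) auto
    also have "\<dots> = (\<integral>x. \<sigma> x * (norm x)\<^sup>2 - 2 * (\<sigma> x * (x \<bullet> a)) + \<sigma> x * (norm a)\<^sup>2 \<partial>lborel)"
      by (intro Bochner_Integration.integral_cong refl)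
        (simp add: power2_norm_eq_inner inner_diff_left inner_diff_right inner_commute algebra_simps)
    also have "\<dots> = M - 2 * (a \<bullet> a) + (norm a)\<^sup>2"
      using i0 i2 i3 by (simp add: M_def m3 mass')
    finally show ?thesis by (simp add: power2_norm_eq_inner)
  qed
  have "(wasserstein2 (density_measure (translate a \<sigma>)) (density_measure (rearrange (translate a \<sigma>))))\<^sup>2
      \<le> (\<integral>x. translate a \<sigma> x * (norm x)\<^sup>2 \<partial>lborel) - (\<integral>x. rearrange (translate a \<sigma>) x * (norm x)\<^sup>2 \<partial>lborel)"
    using R by (intro wasserstein2_le_moments[OF T massT]) simp
  then have w2: "(wasserstein2 (density_measure (translate a \<sigma>)) (density_measure (rearrange \<sigma>)))\<^sup>2 \<le> M - (norm a)\<^sup>2 - N"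
    unfolding rearrange_translate[OF bounded_densityD(1)[OF \<sigma>]] MT N_def .
  have "c * (wasserstein2 (density_measure (translate a \<sigma>)) (density_measure (rearrange \<sigma>)))\<^sup>2 \<le> c * (M - (norm a)\<^sup>2 - N)"
    using w2 c by (rule mult_left_mono)
  also have "\<dots> \<le> interaction_energy W (rearrange \<sigma>) - interaction_energy W \<sigma>"
    unfolding E\<sigma> E\<sigma>r using riesz by (simp add: algebra_simps)
  finally show ?thesis unfolding r_eq E_eq a_eq T_eq .
qed


section \<open>Profiles of the potentials\<close>

text \<open>Near 0 the constant comes from the assumption on \<open>(0, 1)\<close>. On
  \<open>[1, max 1 (2 * R)]\<close> the derivative is continuous and negative, so it attains a
  negative maximum, which is compared with a linear function at the right end.\<close>

lemma interaction_potential_profile: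
  fixes W :: "'a::euclidean_space \<Rightarrow> real"
  assumes W: "interaction_potential W" and R: "R > 0"
  obtains c w w' where "c > 0" "\<And>x. x \<noteq> 0 \<Longrightarrow> W x = w (norm x)"
    "\<And>r. r > 0 \<Longrightarrow> (w has_real_derivative w' r) (at r)" "\<And>r. 0 < r \<Longrightarrow> r < 2 * R \<Longrightarrow> w' r \<le> - c * r"
proof -
  obtain W' where W': "\<And>x. x \<noteq> 0 \<Longrightarrow> (W has_derivative blinfun_apply (W' x)) (at x)" "continuous_on (- {0}) W'"
    using W unfolding interaction_potential_def C1_off_origin_def by blast
  obtain w c0 where w: "\<And>x. x \<noteq> 0 \<Longrightarrow> W x = w (norm x)" and neg: "\<And>r. r > 0 \<Longrightarrow> deriv w r < 0"
    and c0: "c0 > 0" "\<And>r. r \<in> {0<..<1} \<Longrightarrow> deriv w r \<le> - c0 * r"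
    using W unfolding interaction_potential_def by blast
  define e :: 'a where "e = (SOME b. b \<in> Basis)"
  have e: "norm e = 1" by (simp add: e_def SOME_Basis norm_Basis)
  \<comment> \<open>The derivative of the profile read along one ray. Continuity of the differential
    of \<open>W\<close> off the origin becomes continuity of this function.\<close>
  define D where "D r = blinfun_apply (W' (r *\<^sub>R e)) e" for r
  have wD: "(w has_real_derivative D r) (at r)" if r: "r > 0" for r
  proof -
    have e0: "r *\<^sub>R e \<noteq> 0" using r e by auto
    have "((\<lambda>t. W (t *\<^sub>R e)) has_derivative (\<lambda>t. blinfun_apply (W' (r *\<^sub>R e)) (t *\<^sub>R e))) (at r)"
      by (rule has_derivative_compose[of "\<lambda>t. t *\<^sub>R e", OF _ W'(1)[OF e0]]) (auto intro!: derivative_eq_intros)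
    then have "((\<lambda>t. W (t *\<^sub>R e)) has_real_derivative D r) (at r)"
      by (simp add: has_field_derivative_def D_def blinfun.scaleR_right mult_commute_abs)
    moreover have "W (t *\<^sub>R e) = w t" if "t \<in> {0<..}" for t
    proof -
      have "t *\<^sub>R e \<noteq> 0" using that e by auto
      from w[OF this] show ?thesis using that e by simp
    qed
    ultimately show ?thesis
      using r by (rule_tac has_field_derivative_transform_within_open[of "\<lambda>t. W (t *\<^sub>R e)" _ _ "{0<..}"]) auto
  qed
  have dD: "deriv w r = D r" if "r > 0" for r using wD[OF that] by (rule DERIV_imp_deriv)
  define S where "S = max 1 (2 * R)"
  have S: "S \<ge> 1" by (simp add: S_def)
  have "continuous_on {1..S} D"
    unfolding D_def using e by (intro continuous_intros continuous_on_compose2[OF W'(2)]) auto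
  then obtain x where x: "x \<in> {1..S}" "\<And>r. r \<in> {1..S} \<Longrightarrow> D r \<le> D x"
    using continuous_attains_sup[of "{1..S}" D] S by auto
  have Dx: "D x < 0" using x(1) neg[of x] dD[of x] by simp
  \<comment> \<open>On \<open>[1, S]\<close> the line through 0 with slope \<open>D x / S\<close>
    stays above the maximal value \<open>D x\<close>, since \<open>r \<le> S\<close> and
    \<open>D x < 0\<close>.\<close>
  define c where "c = min c0 (- D x / S)"
  have c: "c > 0" using c0(1) Dx S by (simp add: c_def divide_neg_pos)
  have "D r \<le> - c * r" if r: "0 < r" "r < 2 * R" for r
  proof (cases "r < 1")
    case True
    have "D r \<le> - c0 * r" using c0(2)[of r] r True dD[of r] by simp
    also have "\<dots> \<le> - c * r" using r by (intro mult_right_mono) (auto simp: c_def)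
    finally show ?thesis .
  next
    case False
    then have "r \<in> {1..S}" using r by (simp add: S_def)
    then have "D r \<le> D x" by (rule x(2))
    also have "D x = - (- D x / S) * S" using S by simp
    also have "\<dots> \<le> - (- D x / S) * r"
      using \<open>r \<in> {1..S}\<close> Dx S by (intro mult_left_mono_neg) (auto simp: divide_le_0_iff)
    also have "\<dots> \<le> - c * r" using r by (intro mult_right_mono) (auto simp: c_def)
    finally show ?thesis .
  qed
  then show thesis using that[OF c w wD] by blast
qed

text \<open>Layer cake in the radius: \<open>norm x powr (- a)\<close> is its value at
  \<open>S\<close> plus the integral of \<open>a * r powr (- a - 1)\<close> from
  \<open>norm x\<close> to \<open>S\<close>. Exchanging the integrals brings in ball volumes of
  order \<open>r ^ n\<close>, and \<open>r powr (n - a - 1)\<close> is integrable at 0 because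
  \<open>a < n\<close>.\<close>

lemma nn_integral_norm_powr:
  assumes a: "0 < a" "a < real DIM('a::euclidean_space)" and S: "S > 0"
  shows "(\<integral>\<^sup>+x. ennreal (norm x powr (- a)) * indicator (cball (0::'a) S) x \<partial>lborel) < \<infinity>"
proof -
  let ?n = "DIM('a)" and ?V = "unit_ball_vol (real DIM('a))"
  have V: "0 < ?V" by simp
  define g where "g r = a * r powr (- a - 1)" for r :: real
  have [measurable]: "g \<in> borel_measurable borel" unfolding g_def by measurable
  have mb [measurable]: "(\<lambda>y. indicator (cball 0 S :: 'a set) y :: ennreal) \<in> borel_measurable borel"
    by (intro borel_measurable_indicator) simp
  have g0: "0 \<le> g r" for r using a by (simp add: g_def)
  have ftc: "ennreal (t powr (- a)) = ennreal (S powr (- a)) + (\<integral>\<^sup>+r. ennreal (g r) * indicator {t..S} r \<partial>lborel)"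
    if t: "0 < t" "t \<le> S" for t
  proof -
    have "(\<integral>\<^sup>+r. ennreal (g r) * indicator {t..S} r \<partial>lborel) = ennreal ((\<lambda>r. - (r powr (- a))) S - (\<lambda>r. - (r powr (- a))) t)"
    proof (rule nn_integral_FTC_Icc)
      fix r assume "r \<in> {t..S}"
      then have "r > 0" using t by simp
      then show "((\<lambda>r. - (r powr (- a))) has_real_derivative g r) (at r)"
        unfolding g_def by (auto intro!: derivative_eq_intros)
    qed (use t g0 in auto)
    moreover have "S powr (- a) \<le> t powr (- a)" using t a by (intro powr_mono2') auto
    ultimately show ?thesis by (simp add: ennreal_plus[symmetric] del: ennreal_plus)
  qed
  have gn: "g r * (?V * r ^ ?n) = a * ?V * r powr (real ?n - a - 1)" if "r > 0" for r
    using that by (simp add: g_def powr_realpow[symmetric] powr_add[symmetric] algebra_simps)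
  have int: "(\<integral>\<^sup>+r. ennreal (g r * (?V * r ^ ?n)) * indicator {0<..S} r \<partial>lborel) < \<infinity>"
  proof -
    have "set_integrable lborel {0<..S} (\<lambda>r. a * ?V * r powr (real ?n - a - 1))"
    proof -
      have "(\<lambda>r. r powr (real ?n - a - 1)) integrable_on {0..S}"
        using a S by (intro integrable_on_powr_from_0) auto
      then have "(\<lambda>r. r powr (real ?n - a - 1)) absolutely_integrable_on {0..S}"
        by (intro nonnegative_absolutely_integrable_1) auto
      then have "set_integrable lebesgue {0<..S} (\<lambda>r. r powr (real ?n - a - 1))"
        by (rule set_integrable_subset) auto
      then have "set_integrable lborel {0<..S} (\<lambda>r. r powr (real ?n - a - 1))"
        unfolding set_integrable_def by (subst (asm) integrable_completion) auto
      then show ?thesis by (intro set_integrable_mult_right)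
    qed
    then have "(\<integral>\<^sup>+r. ennreal (indicator {0<..S} r *\<^sub>R (a * ?V * r powr (real ?n - a - 1))) \<partial>lborel) < \<infinity>"
      unfolding set_integrable_def using a V by (subst nn_integral_eq_integral) auto
    moreover have "(\<integral>\<^sup>+r. ennreal (indicator {0<..S} r *\<^sub>R (a * ?V * r powr (real ?n - a - 1))) \<partial>lborel) =
      (\<integral>\<^sup>+r. ennreal (g r * (?V * r ^ ?n)) * indicator {0<..S} r \<partial>lborel)"
      by (intro nn_integral_cong) (auto simp: indicator_def gn)
    ultimately show ?thesis by simp
  qed
  have "(\<integral>\<^sup>+x. ennreal (norm x powr (- a)) * indicator (cball (0::'a) S) x \<partial>lborel) \<le>
    (\<integral>\<^sup>+x. ennreal (S powr (- a)) * indicator (cball (0::'a) S) x + (\<integral>\<^sup>+r. ennreal (g r) * indicator {0<..S} r * indicator {x. norm x \<le> r} x \<partial>lborel) \<partial>lborel)"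
  proof (rule nn_integral_mono_AE)
    show "AE x in lborel. ennreal (norm x powr (- a)) * indicator (cball (0::'a) S) x \<le>
      ennreal (S powr (- a)) * indicator (cball (0::'a) S) x + (\<integral>\<^sup>+r. ennreal (g r) * indicator {0<..S} r * indicator {x. norm x \<le> r} x \<partial>lborel)"
      using AE_lborel_singleton[of 0]
    proof eventually_elim
      case (elim x)
      show ?case
      proof (cases "norm x \<le> S")
        case True
        have "(\<integral>\<^sup>+r. ennreal (g r) * indicator {norm x..S} r \<partial>lborel) = (\<integral>\<^sup>+r. ennreal (g r) * indicator {0<..S} r * indicator {x. norm x \<le> r} x \<partial>lborel)"
        proof (rule nn_integral_cong)
          fix r :: real
          have "0 < r" if "norm x \<le> r" using elim that by (meson less_le_trans zero_less_norm_iff)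
          then show "ennreal (g r) * indicator {norm x..S} r = ennreal (g r) * indicator {0<..S} r * indicator {x. norm x \<le> r} x"
            by (auto simp: indicator_def)
        qed
        then show ?thesis using ftc[of "norm x"] elim True by simp
      qed simp
    qed
  qed
  also have "\<dots> = ennreal (S powr (- a)) * emeasure lborel (cball (0::'a) S) +
     (\<integral>\<^sup>+x. (\<integral>\<^sup>+r. ennreal (g r) * indicator {0<..S} r * indicator {x. norm x \<le> r} (x::'a) \<partial>lborel) \<partial>lborel)"
  proof (subst nn_integral_add)
    show "(\<lambda>x. \<integral>\<^sup>+r. ennreal (g r) * indicator {0<..S} r * indicator {x. norm x \<le> r} (x::'a) \<partial>lborel) \<in> borel_measurable lborel"
    proof (rule lborel.borel_measurable_nn_integral)
      have [measurable]: "(\<lambda>x. indicator {y. norm y \<le> snd x} (fst x) :: ennreal) \<in> borel_measurable ((borel :: 'a measure) \<Otimes>\<^sub>M (borel :: real measure))"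
        unfolding indicator_def by simp
      have "(\<lambda>x. ennreal (g (snd x)) * indicator {0<..S} (snd x) * indicator {y. norm y \<le> snd x} (fst x)) \<in> borel_measurable ((borel :: 'a measure) \<Otimes>\<^sub>M borel)"
        by measurable
      then show "(\<lambda>(x, r). ennreal (g r) * indicator {0<..S} r * indicator {x. norm x \<le> r} (x::'a)) \<in> borel_measurable (lborel \<Otimes>\<^sub>M lborel)"
        by (simp add: split_beta' cong: measurable_cong_sets)
    qed
  qed (simp_all add: nn_integral_cmult_indicator)
  also have "(\<integral>\<^sup>+x. (\<integral>\<^sup>+r. ennreal (g r) * indicator {0<..S} r * indicator {x. norm x \<le> r} (x::'a) \<partial>lborel) \<partial>lborel) =
     (\<integral>\<^sup>+r. (\<integral>\<^sup>+x. ennreal (g r) * indicator {0<..S} r * indicator {x. norm x \<le> r} (x::'a) \<partial>lborel) \<partial>lborel)"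
  proof (rule lborel_pair.Fubini')
    have [measurable]: "(\<lambda>x. indicator {y. norm y \<le> fst x} (snd x) :: ennreal) \<in> borel_measurable ((borel :: real measure) \<Otimes>\<^sub>M (borel :: 'a measure))"
      unfolding indicator_def by simp
    have "(\<lambda>x. ennreal (g (fst x)) * indicator {0<..S} (fst x) * indicator {y. norm y \<le> fst x} (snd x)) \<in> borel_measurable (borel \<Otimes>\<^sub>M (borel :: 'a measure))"
      by measurable
    then show "(\<lambda>(r, x). ennreal (g r) * indicator {0<..S} r * indicator {x. norm x \<le> r} (x::'a)) \<in> borel_measurable (lborel \<Otimes>\<^sub>M lborel)"
      by (simp add: split_beta' cong: measurable_cong_sets)
  qed
  also have "\<dots> = (\<integral>\<^sup>+r. ennreal (g r * (?V * r ^ ?n)) * indicator {0<..S} r \<partial>lborel)"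
  proof (rule nn_integral_cong)
    fix r :: real
    show "(\<integral>\<^sup>+x. ennreal (g r) * indicator {0<..S} r * indicator {x. norm x \<le> r} (x::'a) \<partial>lborel) = ennreal (g r * (?V * r ^ ?n)) * indicator {0<..S} r"
    proof (cases "r \<in> {0<..S}")
      case True
      have "(\<integral>\<^sup>+x. ennreal (g r) * indicator {0<..S} r * indicator {x. norm x \<le> r} (x::'a) \<partial>lborel) = (\<integral>\<^sup>+x. ennreal (g r) * indicator (cball 0 r) (x::'a) \<partial>lborel)"
        using True by (intro nn_integral_cong) (simp add: indicator_def)
      also have "\<dots> = ennreal (g r) * ennreal (?V * r ^ ?n)"
        using True by (subst nn_integral_cmult_indicator) (simp_all add: emeasure_cball)
      finally show ?thesis using True g0[of r] V by (simp add: ennreal_mult)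
    qed simp
  qed
  also have "ennreal (S powr (- a)) * emeasure lborel (cball (0::'a) S) + (\<integral>\<^sup>+r. ennreal (g r * (?V * r ^ ?n)) * indicator {0<..S} r \<partial>lborel) < \<infinity>"
    using int emeasure_lborel_cball_finite[of "0::'a" S] by (simp add: ennreal_mult_less_top)
  finally show ?thesis .
qed

lemma locally_integrable_powr_bound:
  fixes W :: "'a::euclidean_space \<Rightarrow> real"
  assumes [measurable]: "W \<in> borel_measurable borel" and a: "0 < a" "a < real DIM('a)"
    and bound: "\<And>S x. S > 0 \<Longrightarrow> x \<noteq> 0 \<Longrightarrow> norm x \<le> S \<Longrightarrow> \<bar>W x\<bar> \<le> C S + C S * norm x powr (- a)"
    and C: "\<And>S. 0 \<le> C S"
  shows "locally_integrable W"
  unfolding locally_integrable_def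
proof (intro allI impI)
  fix L :: "'a set" assume L: "compact L"
  then obtain S where S: "S > 0" "L \<subseteq> cball 0 S"
    using compact_imp_bounded[OF L] by (meson bounded_subset_ballD ball_subset_cball order.trans)
  have [measurable]: "L \<in> sets borel" using L by (intro borel_closed compact_imp_closed)
  show "set_integrable lborel L W"
    unfolding set_integrable_def
  proof (rule integrableI_bounded)
    have mb [measurable]: "(\<lambda>y. indicator (cball 0 S :: 'a set) y :: ennreal) \<in> borel_measurable borel"
      by (intro borel_measurable_indicator) simp
    have "(\<integral>\<^sup>+x. ennreal (norm (indicator L x *\<^sub>R W x)) \<partial>lborel) \<le>
      (\<integral>\<^sup>+x. ennreal (C S) * indicator (cball (0::'a) S) x + ennreal (C S) * (ennreal (norm x powr (- a)) * indicator (cball 0 S) x) \<partial>lborel)"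
    proof (rule nn_integral_mono_AE)
      show "AE x in lborel. ennreal (norm (indicator L x *\<^sub>R W x)) \<le> ennreal (C S) * indicator (cball (0::'a) S) x + ennreal (C S) * (ennreal (norm x powr (- a)) * indicator (cball 0 S) x)"
        using AE_lborel_singleton[of 0]
      proof eventually_elim
        case (elim x)
        show ?case
        proof (cases "x \<in> L")
          case True
          then have xS: "norm x \<le> S" using S by auto
          have "ennreal \<bar>W x\<bar> \<le> ennreal (C S + C S * norm x powr (- a))"
            by (intro ennreal_leI bound S elim xS)
          then show ?thesis using True xS C[of S] by (simp add: ennreal_mult)
        qed simp
      qed
    qed
    also have "\<dots> = ennreal (C S) * emeasure lborel (cball (0::'a) S) + ennreal (C S) * (\<integral>\<^sup>+x. ennreal (norm x powr (- a)) * indicator (cball (0::'a) S) x \<partial>lborel)"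
      by (subst nn_integral_add) (simp_all add: nn_integral_cmult nn_integral_cmult_indicator)
    also have "\<dots> < \<infinity>"
      using nn_integral_norm_powr[OF a S(1)] emeasure_lborel_cball_finite[of "0::'a" S] by (simp add: ennreal_mult_less_top)
    finally show "(\<integral>\<^sup>+x. ennreal (norm (indicator L x *\<^sub>R W x)) \<partial>lborel) < \<infinity>" .
  qed measurable
qed

text \<open>The bound \<open>ln r \<le> 2 * sqrt r\<close>, applied to \<open>r\<close> and to
  \<open>1 / r\<close>.\<close>

lemma abs_ln_le_powr:
  fixes r :: real assumes "r > 0"
  shows "\<bar>ln r\<bar> \<le> 2 * r powr (1/2) + 2 * r powr (-1/2)"
proof -
  have "ln r \<le> 2 * r powr (1/2)" if "r > 0" for r :: real
    using ln_le_minus_one[of "r powr (1/2)"] that by (simp add: ln_powr)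
  from this[OF assms] this[of "1 / r"] assms show ?thesis
    by (auto simp: ln_div powr_minus_divide powr_divide abs_le_iff intro: order.trans add_increasing add_increasing2)
qed

lemma locally_integrable_power_potential:
  assumes k: "- real DIM('a) < k"
  shows "locally_integrable (power_potential k :: 'a::euclidean_space \<Rightarrow> real)"
proof -
  have m: "(power_potential k :: 'a \<Rightarrow> real) \<in> borel_measurable borel"
    unfolding power_potential_def by measurable
  \<comment> \<open>The exponent 1/2 is admissible in every dimension. It controls the logarithm,
    and for \<open>k > 0\<close> the potential is already bounded near the origin.\<close>
  have n1: "1/2 < real DIM('a)" using DIM_positive[where 'a='a] by linarith
  consider "k < 0" | "k = 0" | "k > 0" by linarith
  then show ?thesis
  proof cases
    case 1
    show ?thesis
    proof (rule locally_integrable_powr_bound[OF m, of "- k" "\<lambda>_. 1 / - k"])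
      fix S and x :: 'a
      show "\<bar>power_potential k x\<bar> \<le> 1 / - k + 1 / - k * norm x powr - (- k)"
        using 1 by (simp add: power_potential_def abs_div)
    qed (use 1 k in \<open>auto simp: divide_le_0_iff\<close>)
  next
    case 2
    show ?thesis
    proof (rule locally_integrable_powr_bound[OF m, of "1/2" "\<lambda>S. 2 * S powr (1/2) + 2"])
      fix S :: real and x :: 'a assume S: "S > 0" and x: "x \<noteq> 0" "norm x \<le> S"
      have "\<bar>power_potential k x\<bar> = \<bar>ln (norm x)\<bar>" using 2 by (simp add: power_potential_def)
      also have "\<dots> \<le> 2 * norm x powr (1/2) + 2 * norm x powr (-1/2)" using x by (intro abs_ln_le_powr) simp
      also have "\<dots> \<le> (2 * S powr (1/2) + 2) + (2 * S powr (1/2) + 2) * norm x powr (-1/2)"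
      proof (intro add_mono mult_right_mono)
        have "norm x powr (1/2) \<le> S powr (1/2)" using x by (intro powr_mono2) auto
        then show "2 * norm x powr (1/2) \<le> 2 * S powr (1/2) + 2" by simp
      qed auto
      finally show "\<bar>power_potential k x\<bar> \<le> (2 * S powr (1/2) + 2) + (2 * S powr (1/2) + 2) * norm x powr - (1/2)" by simp
    qed (use n1 in auto)
  next
    case 3
    show ?thesis
    proof (rule locally_integrable_powr_bound[OF m, of "1/2" "\<lambda>S. S powr k / k"])
      fix S :: real and x :: 'a assume S: "S > 0" and x: "x \<noteq> 0" "norm x \<le> S"
      have "\<bar>power_potential k x\<bar> = norm x powr k / k" using 3 by (simp add: power_potential_def)
      also have "\<dots> \<le> S powr k / k" using x 3 by (intro divide_right_mono powr_mono2) auto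
      also have "\<dots> \<le> S powr k / k + S powr k / k * norm x powr - (1/2)" using 3 by simp
      finally show "\<bar>power_potential k x\<bar> \<le> S powr k / k + S powr k / k * norm x powr - (1/2)" .
    qed (use n1 3 in auto)
  qed
qed

text \<open>In the general case the constant comes from the profile before any density is chosen, so
  it depends on \<open>W\<close> and \<open>R\<close> alone. For the power potentials the derivative
  \<open>- (r powr (k - 1))\<close> is inserted into the energy gap directly.\<close>

theorem theorem1p2:
  shows "(\<forall>W :: real ^ 'n \<Rightarrow> real. interaction_potential W \<longrightarrow>
           (\<forall>R>0. \<exists>c>0. \<forall>\<rho> :: real ^ 'n \<Rightarrow> real.
              bounded_prob_density \<rho> \<and> measure_support (density_measure \<rho>) \<subseteq> ball 0 R \<longrightarrow>
              interaction_energy W (rearrange \<rho>) - interaction_energy W \<rho>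
                \<ge> c * (wasserstein2 (density_measure (translate (center_of_mass \<rho>) \<rho>))
                                     (density_measure (rearrange \<rho>)))\<^sup>2)) \<and>
         (\<forall>k R :: real. - real CARD('n) < k \<and> k \<le> 2 \<and> 0 < R \<longrightarrow>
           (\<forall>\<rho> :: real ^ 'n \<Rightarrow> real.
              bounded_prob_density \<rho> \<and> measure_support (density_measure \<rho>) \<subseteq> ball 0 R \<longrightarrow>
              interaction_energy (power_potential k) (rearrange \<rho>)
                - interaction_energy (power_potential k) \<rho>
                \<ge> (2 * R) powr (k - 2)
                   * (wasserstein2 (density_measure (translate (center_of_mass \<rho>) \<rho>))
                                   (density_measure (rearrange \<rho>)))\<^sup>2))"
proof (intro conjI allI impI)
  fix W :: "real ^ 'n \<Rightarrow> real" and R :: real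
  assume W: "interaction_potential W" and R: "R > 0"
  obtain c w w' where c: "c > 0" and w: "\<And>x. x \<noteq> 0 \<Longrightarrow> W x = w (norm x)"
    "\<And>r. r > 0 \<Longrightarrow> (w has_real_derivative w' r) (at r)" "\<And>r. 0 < r \<Longrightarrow> r < 2 * R \<Longrightarrow> w' r \<le> - c * r"
    using interaction_potential_profile[OF W R] by metis
  have loc: "locally_integrable W" using W by (simp add: interaction_potential_def)
  show "\<exists>c>0. \<forall>\<rho> :: real ^ 'n \<Rightarrow> real.
     bounded_prob_density \<rho> \<and> measure_support (density_measure \<rho>) \<subseteq> ball 0 R \<longrightarrow>
     interaction_energy W (rearrange \<rho>) - interaction_energy W \<rho>
       \<ge> c * (wasserstein2 (density_measure (translate (center_of_mass \<rho>) \<rho>)) (density_measure (rearrange \<rho>)))\<^sup>2"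
    using energy_gap[OF loc w R less_imp_le[OF c]] c by (intro exI[of _ c]) blast
next
  fix k R :: real and \<rho> :: "real ^ 'n \<Rightarrow> real"
  assume k: "- real CARD('n) < k \<and> k \<le> 2 \<and> 0 < R"
    and \<rho>: "bounded_prob_density \<rho> \<and> measure_support (density_measure \<rho>) \<subseteq> ball 0 R"
  define w where "w r = (if k = 0 then - ln r else - (r powr k / k))" for r :: real
  show "interaction_energy (power_potential k) (rearrange \<rho>) - interaction_energy (power_potential k) \<rho>
     \<ge> (2 * R) powr (k - 2) * (wasserstein2 (density_measure (translate (center_of_mass \<rho>) \<rho>)) (density_measure (rearrange \<rho>)))\<^sup>2"
  proof (rule energy_gap[where w = w and w' = "\<lambda>r. - (r powr (k - 1))" and R = R])
    show "locally_integrable (power_potential k :: real ^ 'n \<Rightarrow> real)"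
      using k by (intro locally_integrable_power_potential) simp
    show "power_potential k x = w (norm x)" for x :: "real ^ 'n"
      by (simp add: power_potential_def w_def)
    fix r :: real assume r: "r > 0"
    show "(w has_real_derivative - (r powr (k - 1))) (at r)"
    proof (cases "k = 0")
      case True
      then show ?thesis unfolding w_def using r by (auto intro!: derivative_eq_intros simp: powr_minus_divide)
    next
      case False
      then show ?thesis unfolding w_def using r by (auto intro!: derivative_eq_intros)
    qed
    assume r2: "r < 2 * R"
    \<comment> \<open>Here \<open>k \<le> 2\<close> enters: \<open>r powr (k - 2)\<close> is
      nonincreasing, so on \<open>(0, 2 * R)\<close> it is bounded below by its value at
      \<open>2 * R\<close>.\<close>
    have "(2 * R) powr (k - 2) * r \<le> r powr (k - 2) * r"
      using r r2 k by (intro mult_right_mono powr_mono2') auto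
    also have "\<dots> = r powr (k - 1)" using r powr_add[of r "k - 2" 1] by simp
    finally show "- (r powr (k - 1)) \<le> - ((2 * R) powr (k - 2)) * r" by simp
  qed (use k \<rho> in auto)
qed

end
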